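(* Let $p$ be a prime. Then, with absolute implied constants: (i) $S_{p+2}$ has a presentation with $3$ generators, $6$ relations and bit-length $O(\log p)$. (ii) If $p\equiv 2\pmod 3$ then the subgroup of index $2$ in $S_{p+2}\times \mathrm{AGL}(1,p)$ that projects onto each factor has a presentation with $2$ generators, $3$ relations and bit-length $O(\log p)$. (iii) If $p\equiv 2\pmod 3$ then $S_{p+2}$ has a presentation with $2$ generators, $4$ relations and bit-length $O(\log p)$.
   Context: $\mathrm{AGL}(1,p)$ is the group of all maps $x\mapsto ax+b$ of $\mathbb{F}_p$ with $a\in\mathbb{F}_p^*$, $b\in\mathbb{F}_p$. A presentation $\langle X\mid R\rangle$ has $|X|$ generators and $|R|$ relations. Its bit-length is the total number of bits required to write the presentation: all exponents are encoded as binary strings, the sum of whose lengths enters into the bit-length, as does the space required to enumerate the list of generators and relations. The bit-length $bl(w)$ of a word $w$ (words may be written using nested powers) is required to satisfy $bl(x)=1$ for $x\in X$; $bl(w^m)\le bl(w)+\log|m|$ for $m\in\mathbb{Z}\setminus\{0,1,-1\}$; and $bl(ww')\le bl(w)+bl(w')$ for all words $w,w'$. Logarithms are to the base $2$. *)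

theory Defs
  imports "HOL-Algebra.Sym_Groups" "HOL-Algebra.Bij" "HOL-Number_Theory.Residues"
begin

section \<open>Free groups\<close>

text \<open>The letter \<open>(True, x)\<close> stands for the generator \<open>x\<close>, and \<open>(False, x)\<close> for its inverse.
  Elements of the free group on \<open>X\<close> are the reduced words over \<open>X\<close>.\<close>

type_synonym 'x letter = "bool \<times> 'x"

definition inv_letter :: "'x letter \<Rightarrow> 'x letter" where
  "inv_letter a = (\<not> fst a, snd a)"

fun reduced :: "'x letter list \<Rightarrow> bool" where
  "reduced [] \<longleftrightarrow> True"
| "reduced [a] \<longleftrightarrow> True"
| "reduced (a # b # w) \<longleftrightarrow> b \<noteq> inv_letter a \<and> reduced (b # w)"

text \<open>Multiplication of a reduced word by a letter on the left, followed by free reduction.\<close>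

fun lmult_letter :: "'x letter \<Rightarrow> 'x letter list \<Rightarrow> 'x letter list" where
  "lmult_letter a [] = [a]"
| "lmult_letter a (b # w) = (if b = inv_letter a then w else a # b # w)"

definition free_group :: "'x set \<Rightarrow> 'x letter list monoid" where
  "free_group X =
    \<lparr>carrier = {w. reduced w \<and> snd ` set w \<subseteq> X},
     mult = foldr lmult_letter,
     one = []\<rparr>"

lemma inv_letter_inv_letter [simp]: "inv_letter (inv_letter a) = a"
  by (simp add: inv_letter_def)

lemma snd_inv_letter [simp]: "snd (inv_letter a) = snd a"
  by (simp add: inv_letter_def)

lemma inv_letter_eq_iff: "a = inv_letter b \<longleftrightarrow> b = inv_letter a"
  by auto

lemma reduced_ConsD: "reduced (a # w) \<Longrightarrow> reduced w"
  by (cases w) auto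

lemma reduced_lmult_letter: "reduced w \<Longrightarrow> reduced (lmult_letter a w)"
  by (cases w) (auto dest: reduced_ConsD)

lemma set_lmult_letter: "set (lmult_letter a w) \<subseteq> insert a (set w)"
  by (cases w) auto

lemma lmult_letter_cancel: "reduced w \<Longrightarrow> lmult_letter (inv_letter a) (lmult_letter a w) = w"
proof (cases w)
  case (Cons b v)
  assume "reduced w"
  then show ?thesis using Cons by (cases v) auto
qed simp

lemma lmult_letter_reduced: "reduced (a # w) \<Longrightarrow> lmult_letter a w = a # w"
  by (cases w) auto

lemma reduced_foldr: "reduced v \<Longrightarrow> reduced (foldr lmult_letter u v)"
  by (induction u) (auto simp: reduced_lmult_letter)

lemma set_foldr: "set (foldr lmult_letter u v) \<subseteq> set u \<union> set v"
proof (induction u)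
  case (Cons a u)
  then show ?case using set_lmult_letter[of a "foldr lmult_letter u v"] by auto
qed simp

lemma foldr_lmult_letter:
  assumes "reduced w"
  shows "foldr lmult_letter (lmult_letter a u) w = lmult_letter a (foldr lmult_letter u w)"
proof (cases u)
  case (Cons b v)
  show ?thesis
  proof (cases "b = inv_letter a")
    case True
    have "lmult_letter (inv_letter b) (lmult_letter b (foldr lmult_letter v w)) = foldr lmult_letter v w"
      by (rule lmult_letter_cancel) (rule reduced_foldr[OF assms])
    with True Cons show ?thesis by simp
  qed (use Cons in simp)
qed simp

lemma foldr_lmult_assoc:
  assumes "reduced w"
  shows "foldr lmult_letter (foldr lmult_letter u v) w = foldr lmult_letter u (foldr lmult_letter v w)"
  by (induction u) (simp_all add: foldr_lmult_letter[OF assms])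

lemma foldr_lmult_Nil: "reduced u \<Longrightarrow> foldr lmult_letter u [] = u"
proof (induction u)
  case (Cons a u)
  then show ?case using reduced_ConsD[OF Cons.prems] lmult_letter_reduced[OF Cons.prems] by simp
qed simp

lemma foldr_inv_cancel:
  "reduced w \<Longrightarrow> foldr lmult_letter (rev (map inv_letter u)) (foldr lmult_letter u w) = w"
  by (induction u arbitrary: w) (auto simp: lmult_letter_cancel reduced_foldr)

lemma group_free_group: "group (free_group X)"
proof (rule groupI)
  fix u v assume uv: "u \<in> carrier (free_group X)" "v \<in> carrier (free_group X)"
  have "snd ` set (foldr lmult_letter u v) \<subseteq> snd ` set u \<union> snd ` set v"
    using image_mono[OF set_foldr[of u v], of snd] by (simp only: image_Un)
  also have "\<dots> \<subseteq> X" using uv by (simp add: free_group_def)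
  finally show "u \<otimes>\<^bsub>free_group X\<^esub> v \<in> carrier (free_group X)"
    using uv by (simp add: free_group_def reduced_foldr)
next
  fix u assume u: "u \<in> carrier (free_group X)"
  define v where "v = foldr lmult_letter (rev (map inv_letter u)) []"
  have "set v \<subseteq> inv_letter ` set u"
    using set_foldr[of "rev (map inv_letter u)" "[]"] by (simp add: v_def)
  then have "snd ` set v \<subseteq> snd ` inv_letter ` set u"
    by (rule image_mono)
  also have "\<dots> = snd ` set u"
    by (simp only: image_image snd_inv_letter)
  also have "\<dots> \<subseteq> X" using u by (simp add: free_group_def)
  finally have "v \<in> carrier (free_group X)"
    by (simp add: free_group_def v_def reduced_foldr)
  moreover have "foldr lmult_letter v u = []"
    using u foldr_inv_cancel[of "[]" u]
    by (simp add: v_def foldr_lmult_assoc free_group_def foldr_lmult_Nil)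
  ultimately show "\<exists>v\<in>carrier (free_group X). v \<otimes>\<^bsub>free_group X\<^esub> u = \<one>\<^bsub>free_group X\<^esub>"
    by (intro bexI[of _ v]) (simp_all add: free_group_def)
qed (simp_all add: free_group_def foldr_lmult_assoc)

section \<open>Presentations\<close>

definition normal_closure :: "('a, 'b) monoid_scheme \<Rightarrow> 'a set \<Rightarrow> 'a set" where
  "normal_closure G R = \<Inter> {N. N \<lhd> G \<and> R \<subseteq> N}"

definition presented_group :: "'x set \<Rightarrow> 'x letter list set \<Rightarrow> 'x letter list set monoid" where
  "presented_group X R = free_group X Mod normal_closure (free_group X) R"

section \<open>Words with nested powers and bit-length\<close>

text \<open>A word is a formal expression, since its bit-length depends on how it is written.\<close>

datatype 'x word_expr =
    Gen 'x
  | Mul "'x word_expr" "'x word_expr"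
  | Power "'x word_expr" int

fun word_of :: "'x set \<Rightarrow> 'x word_expr \<Rightarrow> 'x letter list" where
  "word_of X (Gen x) = [(True, x)]"
| "word_of X (Mul e f) = word_of X e \<otimes>\<^bsub>free_group X\<^esub> word_of X f"
| "word_of X (Power e m) = word_of X e [^]\<^bsub>free_group X\<^esub> m"

text \<open>The rules \<open>bl(x) = 1\<close>, \<open>bl(w w') \<le> bl(w) + bl(w')\<close> and \<open>bl(w\<^sup>m) \<le> bl(w) + log |m|\<close>
  for \<open>m \<noteq> 0, 1, -1\<close> all hold with equality. They leave the exponents \<open>0\<close>, \<open>1\<close> and \<open>-1\<close> open,
  whose logarithm would be undefined or zero; these are charged one bit each. Hence this \<open>bl\<close> is the
  largest function that obeys the rules and spends at most one bit on such an exponent.\<close>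

fun bl :: "'x word_expr \<Rightarrow> real" where
  "bl (Gen x) = 1"
| "bl (Mul e f) = bl e + bl f"
| "bl (Power e m) = bl e + log 2 (real_of_int (max 2 \<bar>m\<bar>))"

text \<open>The first two summands account for listing the generators and the relations.\<close>

definition bit_length :: "'x set \<Rightarrow> 'x word_expr list \<Rightarrow> real" where
  "bit_length X R = real (card X) + real (length R) + (\<Sum>e\<leftarrow>R. bl e)"

definition is_presentation ::
    "('a, 'b) monoid_scheme \<Rightarrow> 'x set \<Rightarrow> 'x word_expr list \<Rightarrow> bool" where
  "is_presentation G X R \<longleftrightarrow>
     finite X \<and> (\<forall>e\<in>set R. set_word_expr e \<subseteq> X) \<and>
     G \<cong> presented_group X (word_of X ` set R)"

definition has_presentation ::
    "('a, 'b) monoid_scheme \<Rightarrow> nat \<Rightarrow> nat \<Rightarrow> real \<Rightarrow> bool" where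
  "has_presentation G d r L \<longleftrightarrow>
     (\<exists>(X :: nat set) R. is_presentation G X R \<and> card X = d \<and> length R = r \<and> bit_length X R \<le> L)"

section \<open>The groups in question\<close>

definition AGL1 :: "('a, 'b) ring_scheme \<Rightarrow> ('a \<Rightarrow> 'a) monoid" where
  "AGL1 F = (BijGroup (carrier F))
     \<lparr>carrier := {\<lambda>x\<in>carrier F. a \<otimes>\<^bsub>F\<^esub> x \<oplus>\<^bsub>F\<^esub> b | a b. a \<in> carrier F - {\<zero>\<^bsub>F\<^esub>} \<and> b \<in> carrier F}\<rparr>"

definition index2_subdirect ::
    "('a, 'c) monoid_scheme \<Rightarrow> ('b, 'd) monoid_scheme \<Rightarrow> ('a \<times> 'b) set \<Rightarrow> bool" where
  "index2_subdirect G K H \<longleftrightarrow>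
     subgroup H (G \<times>\<times> K) \<and> card (rcosets\<^bsub>G \<times>\<times> K\<^esub> H) = 2 \<and>
     fst ` H = carrier G \<and> snd ` H = carrier K"

end

theory Submission
  imports Defs
begin

text \<open>Let \<open>a\<close> be the translation \<open>x \<mapsto> x + 1\<close> and \<open>b\<close> the multiplication by a primitive root \<open>r\<close>, both
  acting on \<open>p\<close> of the \<open>p + 2\<close> points, and let \<open>x\<close> be the 3-cycle \<open>(0 \<infinity> \<infinity>')\<close>. Since \<open>b\<close> commutes with
  \<open>x\<close> and \<open>AGL(1, p)\<close> is 2-transitive, the single relation \<open>(x x\<^sup>a)\<^sup>2 = 1\<close> implies Carmichael's relations
  \<open>(x\<^sub>i x\<^sub>j)\<^sup>2 = 1\<close> for the conjugates \<open>x\<^sub>i = (i \<infinity> \<infinity>')\<close>, which by coset enumeration generate a normal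
  subgroup of order at most \<open>(p + 2)! / 2\<close>. This bounds the order of the presented group and identifies it
  with the subdirect product. \<open>AGL(1, p)\<close> itself is given by \<open>a\<^sup>p = b\<^bsup>p-1\<^esup>\<close> and \<open>(a\<^sup>s)\<^sup>b = a\<^bsup>s-1\<^esup>\<close> with
  \<open>s (r - 1) \<equiv> -1\<close>: the element \<open>z = a\<^sup>p\<close> is central, and raising the second relation to the power \<open>p\<close>
  gives \<open>z\<^sup>s = z\<^bsup>s-1\<^esup>\<close>. To pass to \<open>S\<^bsub>p+2\<^esub>\<close> one adds \<open>(x\<^sup>a b)\<^bsup>p+1\<^esup> = 1\<close>, which holds because \<open>x\<^sup>a b\<close> is a
  \<open>(p + 1)\<close>-cycle, and which puts \<open>b\<^sup>2\<close>, hence also \<open>a\<close>, into the subgroup of the 3-cycles if \<open>p \<ge> 5\<close>.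
  For \<open>p = 3\<close> the \<open>5\<close>-cycle \<open>x a\<close> does the same, and for \<open>p = 2\<close>, where \<open>s\<close> does not exist, \<open>b = 1\<close> replaces
  the relation involving \<open>s\<close>. Conjugation is \<open>g\<^sup>h = h g h\<^sup>-\<^sup>1\<close>.\<close>

subsection \<open>Von Dyck's theorem with a cardinality bound\<close>

fun eval_expr :: "('g, 'b) monoid_scheme \<Rightarrow> ('x \<Rightarrow> 'g) \<Rightarrow> 'x word_expr \<Rightarrow> 'g" where
  "eval_expr G f (Gen x) = f x"
| "eval_expr G f (Mul e e') = eval_expr G f e \<otimes>\<^bsub>G\<^esub> eval_expr G f e'"
| "eval_expr G f (Power e m) = eval_expr G f e [^]\<^bsub>G\<^esub> m"

lemma eval_expr_closed:
  assumes "group G" "f ` X \<subseteq> carrier G" "set_word_expr e \<subseteq> X"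
  shows "eval_expr G f e \<in> carrier G"
  using assms(3)
proof (induction e)
  case (Mul e1 e2)
  then show ?case using group.is_monoid[OF assms(1)] by (auto intro: monoid.m_closed)
qed (use assms in \<open>auto intro: group.int_pow_closed\<close>)

text \<open>Turns \<open>word_of\<close> into an evaluation at the free generators, so that
  \<open>hom_eval_expr\<close> yields the image of a relator under any homomorphism defined on the
  free group.\<close>

lemma word_of_eq_eval_expr: "word_of X e = eval_expr (free_group X) (\<lambda>x. [(True, x)]) e"
  by (induction e) auto

lemma gen_in_free_group: "x \<in> X \<Longrightarrow> [(b, x)] \<in> carrier (free_group X)"
  by (simp add: free_group_def)

lemma word_of_closed: "set_word_expr e \<subseteq> X \<Longrightarrow> word_of X e \<in> carrier (free_group X)"
  unfolding word_of_eq_eval_expr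
  by (rule eval_expr_closed[OF group_free_group]) (auto intro: gen_in_free_group)

lemma hom_eval_expr:
  assumes "group_hom G K h" "f ` X \<subseteq> carrier G" "set_word_expr e \<subseteq> X"
  shows "h (eval_expr G f e) = eval_expr K (h \<circ> f) e"
proof -
  interpret group_hom G K h by fact
  show ?thesis using assms(3)
  proof (induction e)
    case (Mul e1 e2)
    then show ?case
      using eval_expr_closed[OF G.is_group assms(2), of e1] eval_expr_closed[OF G.is_group assms(2), of e2]
      by (simp add: hom_mult)
  next
    case (Power e m)
    then show ?case
      using eval_expr_closed[OF G.is_group assms(2), of e] by (simp add: hom_int_pow)
  qed simp
qed

definition letter_val :: "('g, 'b) monoid_scheme \<Rightarrow> ('x \<Rightarrow> 'g) \<Rightarrow> 'x letter \<Rightarrow> 'g" where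
  "letter_val G f l = (if fst l then f (snd l) else inv\<^bsub>G\<^esub> f (snd l))"

definition word_val :: "('g, 'b) monoid_scheme \<Rightarrow> ('x \<Rightarrow> 'g) \<Rightarrow> 'x letter list \<Rightarrow> 'g" where
  "word_val G f w = foldr (\<lambda>l g. letter_val G f l \<otimes>\<^bsub>G\<^esub> g) w \<one>\<^bsub>G\<^esub>"

text \<open>Universal property of the free group. Free reduction does not change values: a letter
  and its \<open>inv_letter\<close> have mutually inverse values, so the cancelling case of
  \<open>lmult_letter\<close> is harmless.\<close>

lemma word_val_hom:
  fixes G (structure)
  assumes "group G" "f ` X \<subseteq> carrier G"
  shows "group_hom (free_group X) G (word_val G f)"
proof -
  interpret group G by fact
  let ?v = "letter_val G f" and ?h = "word_val G f"
  have v: "?v l \<in> carrier G" if "snd l \<in> X" for l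
    using that assms(2) by (auto simp: letter_val_def)
  have v_inv: "?v (inv_letter l) = inv (?v l)" if "snd l \<in> X" for l
    using that assms(2) by (auto simp: letter_val_def inv_letter_def)
  have h_Nil [simp]: "?h [] = \<one>" and h_Cons [simp]: "?h (l # w) = ?v l \<otimes> ?h w" for l w
    by (simp_all add: word_val_def)
  have h: "?h w \<in> carrier G" if "snd ` set w \<subseteq> X" for w
    using that by (induction w) (auto intro: v)
  have lmult: "?h (lmult_letter l w) = ?v l \<otimes> ?h w" if "snd l \<in> X" "snd ` set w \<subseteq> X" for l w
  proof (cases w)
    case (Cons l' w')
    have "?v l \<otimes> (inv (?v l) \<otimes> ?h w') = ?h w'"
      using that Cons v[of l] h[of w'] by (simp add: m_assoc[symmetric])
    then show ?thesis using that Cons by (simp add: v_inv)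
  qed (use that v in simp)
  have mult: "?h (foldr lmult_letter u w) = ?h u \<otimes> ?h w"
    if "snd ` set u \<subseteq> X" "snd ` set w \<subseteq> X" for u w
    using that(1)
  proof (induction u)
    case (Cons l u)
    have "snd ` set (foldr lmult_letter u w) \<subseteq> snd ` set u \<union> snd ` set w"
      by (metis image_Un image_mono set_foldr)
    also have "\<dots> \<subseteq> X" using Cons.prems that(2) by simp
    finally have "snd ` set (foldr lmult_letter u w) \<subseteq> X" .
    then show ?case
      using Cons v[of l] h[of u] h[of w] that(2) by (simp add: lmult m_assoc)
  qed (use h that in simp)
  have "?h \<in> hom (free_group X) G"
    by (rule homI) (auto simp: free_group_def mult h)
  then show ?thesis
    by (simp add: group_hom_def group_hom_axioms_def is_group group_free_group)
qed

lemma word_val_gen: "group G \<Longrightarrow> f x \<in> carrier G \<Longrightarrow> word_val G f [(True, x)] = f x"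
  by (simp add: word_val_def letter_val_def group.is_monoid monoid.r_one)

lemma generate_free_group: "generate (free_group X) ((\<lambda>x. [(True, x)]) ` X) = carrier (free_group X)"
proof -
  interpret group "free_group X" by (rule group_free_group)
  let ?S = "generate (free_group X) ((\<lambda>x. [(True, x)]) ` X)"
  have letter: "[l] \<in> ?S" if "snd l \<in> X" for l
  proof (cases "fst l")
    case True
    then have "[l] = [(True, snd l)]" by (cases l) simp
    then show ?thesis using that by (auto intro: generate.incl)
  next
    case False
    then have l: "l = (False, snd l)" by (cases l) simp
    have "inv\<^bsub>free_group X\<^esub> [(True, snd l)] = [l]"
      by (rule inv_equality) (use that l False gen_in_free_group[of "snd l" X] in
          \<open>simp_all add: free_group_def inv_letter_def split: prod.splits\<close>)
    then show ?thesis using that by (metis generate.inv imageI)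
  qed
  have "w \<in> ?S" if "reduced w" "snd ` set w \<subseteq> X" for w
    using that
  proof (induction w)
    case Nil
    then show ?case using generate.one[of "free_group X"] by (simp add: free_group_def)
  next
    case (Cons l w)
    have "l # w = [l] \<otimes>\<^bsub>free_group X\<^esub> w"
      using Cons.prems lmult_letter_reduced[of l w] by (simp add: free_group_def)
    moreover have "[l] \<otimes>\<^bsub>free_group X\<^esub> w \<in> ?S"
      by (rule generate.eng) (use Cons letter[of l] reduced_ConsD[of l w] in simp_all)
    ultimately show ?case by (simp only:)
  qed
  moreover have "?S \<subseteq> carrier (free_group X)"
    by (rule generate_incl) (auto intro: gen_in_free_group)
  ultimately show ?thesis by (auto simp: free_group_def)
qed

lemma normal_closure_normal:
  assumes "group G" "R \<subseteq> carrier G"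
  shows "normal_closure G R \<lhd> G" "R \<subseteq> normal_closure G R"
proof -
  interpret group G by fact
  \<comment> \<open>The whole group belongs to the intersected family, which is therefore
    nonempty.\<close>
  have c: "carrier G \<lhd> G"
    by (simp add: normal_inv_iff subgroup_self)
  have "subgroup (normal_closure G R) G"
    unfolding normal_closure_def
  proof (rule subgroups_Inter)
    show "subgroup N G" if "N \<in> {N. N \<lhd> G \<and> R \<subseteq> N}" for N
      using that by (simp add: normal_imp_subgroup)
  qed (use c assms(2) in auto)
  then show "normal_closure G R \<lhd> G"
    by (auto simp: normal_inv_iff normal_closure_def)
  show "R \<subseteq> normal_closure G R" by (auto simp: normal_closure_def)
qed

text \<open>Von Dyck's theorem maps the presented group \<open>P\<close> onto \<open>G\<close>. The
  classes of the generators satisfy the relations in \<open>P\<close>, so \<open>bound\<close>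
  applies to \<open>P\<close>, and the surjection between finite groups becomes an isomorphism. The
  type in \<open>bound\<close> is that of a quotient of the free group.\<close>

theorem is_presentationI:
  fixes G :: "('a, 'b) monoid_scheme" and X :: "'x set"
  assumes G: "group G" "finite (carrier G)" and X: "finite X"
    and f: "f ` X \<subseteq> carrier G" "generate G (f ` X) = carrier G"
    and R: "\<And>e. e \<in> set R \<Longrightarrow> set_word_expr e \<subseteq> X"
    and rel: "\<And>e. e \<in> set R \<Longrightarrow> eval_expr G f e = \<one>\<^bsub>G\<^esub>"
    and bound: "\<And>(P :: 'x letter list set monoid) g. \<lbrakk>group P; g ` X \<subseteq> carrier P;
      generate P (g ` X) = carrier P; \<And>e. e \<in> set R \<Longrightarrow> eval_expr P g e = \<one>\<^bsub>P\<^esub>\<rbrakk>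
      \<Longrightarrow> finite (carrier P) \<and> card (carrier P) \<le> card (carrier G)"
  shows "is_presentation G X R"
proof -
  define F where "F = free_group X"
  define gen where "gen = (\<lambda>x. [(True, x)] :: 'x letter list)"
  define N where "N = normal_closure F (word_of X ` set R)"
  define P where "P = F Mod N"
  interpret F: group F unfolding F_def by (rule group_free_group)
  have gen: "gen ` X \<subseteq> carrier F"
    by (auto simp: gen_def F_def gen_in_free_group)
  have words: "word_of X ` set R \<subseteq> carrier F"
    using R by (auto simp: F_def intro: word_of_closed)
  interpret N: normal N F
    unfolding N_def by (rule normal_closure_normal(1)[OF F.is_group words])
  have RN: "word_of X ` set R \<subseteq> N"
    unfolding N_def by (rule normal_closure_normal(2)[OF F.is_group words])
  interpret P: group P unfolding P_def by (rule N.factorgroup_is_group)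
  interpret q: group_hom F P "\<lambda>w. N #>\<^bsub>F\<^esub> w"
    by unfold_locales (simp add: P_def N.r_coset_hom_Mod)
  interpret h: group_hom F G "word_val G f"
    unfolding F_def by (rule word_val_hom[OF G(1) f(1)])

  have q_onto: "(\<lambda>w. N #>\<^bsub>F\<^esub> w) ` carrier F = carrier P"
    by (simp add: P_def carrier_FactGroup)
  have "generate P (((\<lambda>w. N #>\<^bsub>F\<^esub> w) \<circ> gen) ` X) = carrier P"
    using q.generate_img[OF gen] generate_free_group[of X] q_onto
    by (simp add: F_def gen_def image_comp)
  moreover have "eval_expr P ((\<lambda>w. N #>\<^bsub>F\<^esub> w) \<circ> gen) e = \<one>\<^bsub>P\<^esub>" if "e \<in> set R" for e
  proof -
    have "eval_expr P ((\<lambda>w. N #>\<^bsub>F\<^esub> w) \<circ> gen) e = N #>\<^bsub>F\<^esub> word_of X e"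
      using hom_eval_expr[OF q.group_hom_axioms gen R[OF that]]
      by (simp add: word_of_eq_eval_expr F_def gen_def)
    also have "\<dots> = N"
      using that RN by (intro F.coset_join2) (auto simp: N.subgroup_axioms)
    finally show ?thesis by (simp add: P_def)
  qed
  moreover have "((\<lambda>w. N #>\<^bsub>F\<^esub> w) \<circ> gen) ` X \<subseteq> carrier P"
    using gen q_onto by auto
  ultimately have P: "finite (carrier P)" "card (carrier P) \<le> card (carrier G)"
    using bound[OF P.is_group] by blast+

  have h_gen: "word_val G f (gen x) = f x" if "x \<in> X" for x
    using that f(1) G(1) by (auto simp: gen_def intro: word_val_gen)
  then have h_gens: "word_val G f ` gen ` X = f ` X" by (auto simp: image_image)
  have h_onto: "word_val G f ` carrier F = carrier G"
    using h.generate_img[OF gen] generate_free_group[of X] f(2) h_gens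
    by (simp add: F_def gen_def)
  have h_word: "word_val G f (word_of X e) = \<one>\<^bsub>G\<^esub>" if "e \<in> set R" for e
  proof -
    have "word_val G f (word_of X e) = eval_expr G (word_val G f \<circ> gen) e"
      using hom_eval_expr[OF h.group_hom_axioms gen R[OF that]]
      by (simp add: word_of_eq_eval_expr F_def gen_def)
    also have "\<dots> = eval_expr G f e"
      using R[OF that] by (induction e) (auto simp: h_gen)
    finally show ?thesis using rel[OF that] by simp
  qed
  \<comment> \<open>The kernel is normal and contains the relators, hence also their normal closure;
    this makes \<open>k\<close> well defined on cosets.\<close>
  have "word_of X ` set R \<subseteq> kernel F G (word_val G f)"
    using words h_word by (auto simp: kernel_def)
  then have NK: "N \<subseteq> kernel F G (word_val G f)"
    unfolding N_def normal_closure_def using h.normal_kernel by blast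
  obtain k where k: "k \<in> hom P G" "\<And>w. w \<in> carrier F \<Longrightarrow> k (N #>\<^bsub>F\<^esub> w) = word_val G f w"
  proof (rule FactGroup_universal[OF h.homh N.normal_axioms])
    fix u w assume uw: "u \<in> carrier F" "w \<in> carrier F" "N #>\<^bsub>F\<^esub> u = N #>\<^bsub>F\<^esub> w"
    then obtain n where n: "n \<in> N" "u = n \<otimes>\<^bsub>F\<^esub> w"
      using F.rcos_self[OF uw(1) N.subgroup_axioms] by (auto simp: r_coset_def)
    then show "word_val G f u = word_val G f w"
      using NK uw(2) by (auto simp: kernel_def)
  qed (auto simp: P_def)
  have k_onto: "k ` carrier P = carrier G"
    using k(2) h_onto q_onto by (metis (no_types, lifting) image_cong image_image)
  then have "inj_on k (carrier P)"
    using P G(2) by (metis card_image_le eq_card_imp_inj_on le_antisym)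
  then have "k \<in> iso P G"
    using k(1) k_onto by (simp add: iso_def bij_betw_def)
  then have "G \<cong> P"
    using P.iso_sym by (auto simp: is_iso_def)
  then show ?thesis
    using X R by (simp add: is_presentation_def presented_group_def P_def N_def F_def)
qed

subsection \<open>Groups generated by 3-cycles\<close>

text \<open>The principle behind the coset enumerations below: a set that contains
  \<open>\<one>\<close> and absorbs generators from the left exhausts the subgroup. Finite orders
  make the inverse of a generator one of its powers.\<close>

lemma (in group) generate_subset_if_left_closed:
  assumes S: "S \<subseteq> carrier G" "\<And>s. s \<in> S \<Longrightarrow> \<exists>n>0. s [^] (n::nat) = \<one>"
    and U: "U \<subseteq> carrier G" "\<one> \<in> U" "\<And>s u. s \<in> S \<Longrightarrow> u \<in> U \<Longrightarrow> s \<otimes> u \<in> U"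
  shows "generate G S \<subseteq> U"
proof -
  have pow: "s [^] (k::nat) \<otimes> u \<in> U" if "s \<in> S" "u \<in> U" for s k u
    using that(2)
  proof (induction k arbitrary: u)
    case 0
    then show ?case using U(1) by auto
  next
    case (Suc k)
    have "s [^] Suc k \<otimes> u = s [^] k \<otimes> (s \<otimes> u)"
      using that(1) S(1) U(1) Suc.prems by (auto simp: m_assoc subset_iff)
    then show ?case using Suc.IH[OF U(3)[OF that(1) Suc.prems]] by simp
  qed
  have "g \<otimes> u \<in> U" if "g \<in> generate G S" "u \<in> U" for g u
    using that
  proof (induction arbitrary: u)
    case one
    then show ?case using U(1) by auto
  next
    case (incl s)
    then show ?case by (rule U(3))
  next
    case (inv s)
    obtain n :: nat where n: "n > 0" "s [^] n = \<one>" using S(2)[OF inv(1)] by blast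
    have s: "s \<in> carrier G" using inv(1) S(1) by auto
    have "s [^] (n - 1) \<otimes> s = \<one>"
      using n s by (metis Suc_diff_1 nat_pow_Suc)
    then have "inv s = s [^] (n - 1)" using s by (simp add: inv_equality)
    then show ?case using pow[OF inv(1,2)] by simp
  next
    case (eng g h)
    then have "g \<in> carrier G" "h \<in> carrier G"
      using generate_in_carrier[OF S(1)] by blast+
    then have "(g \<otimes> h) \<otimes> u = g \<otimes> (h \<otimes> u)" using U(1) eng.prems by (auto simp: m_assoc)
    then show ?case using eng by simp
  qed
  then show ?thesis
    using U generate_in_carrier[OF S(1)] by (metis r_one subsetI)
qed

text \<open>With \<open>y i\<close> the 3-cycle \<open>(i \<infinity> \<infinity>')\<close>, these are Carmichael's relations for the alternating group
  on \<open>n + 2\<close> points; left cosets of the subgroup of the first \<open>n\<close> generators correspond to the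
  possible images of the last point.\<close>

lemma (in group) card_generate_three_cycles:
  fixes y :: "nat \<Rightarrow> 'a"
  assumes "\<And>i. i < n \<Longrightarrow> y i \<in> carrier G"
    and "\<And>i. i < n \<Longrightarrow> y i [^] (3::nat) = \<one>"
    and "\<And>i j. i < n \<Longrightarrow> j < n \<Longrightarrow> i \<noteq> j \<Longrightarrow> (y i \<otimes> y j) [^] (2::nat) = \<one>"
  shows "finite (generate G (y ` {..<n})) \<and> 2 * card (generate G (y ` {..<n})) \<le> fact (n + 2)"
  using assms
proof (induction n)
  case 0
  then show ?case by (simp add: generate_empty)
next
  case (Suc n)
  define z where "z = y n"
  define H where "H = generate G (y ` {..<n})"
  have y: "y i \<in> carrier G" if "i < n" for i using Suc.prems(1) that by simp
  have z: "z \<in> carrier G" using Suc.prems(1) by (simp add: z_def)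
  have cube: "c \<otimes> (c \<otimes> g) = inv c \<otimes> g" if "c \<in> carrier G" "c [^] (3::nat) = \<one>" "g \<in> carrier G" for c g
  proof -
    have "c \<otimes> c \<otimes> c = \<one>" using that by (simp add: numeral_3_eq_3)
    then have "inv c = c \<otimes> c" using that by (simp add: inv_equality)
    then show ?thesis using that by (simp add: m_assoc)
  qed
  \<comment> \<open>The relation \<open>(c d)^2 = 1\<close> exchanges two factors at the price of
    inverting them. Together with \<open>cube\<close>, which trades a square for an inverse, it does
    all the rewriting below.\<close>
  have swap: "c \<otimes> (d \<otimes> g) = inv d \<otimes> (inv c \<otimes> g)"
    if "c \<in> carrier G" "d \<in> carrier G" "(c \<otimes> d) [^] (2::nat) = \<one>" "g \<in> carrier G" for c d g
  proof -
    have "(c \<otimes> d) \<otimes> (c \<otimes> d) = \<one>" using that by (simp add: numeral_2_eq_2)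
    then have "c \<otimes> d = inv (c \<otimes> d)" using that by (metis inv_equality m_closed)
    then have "c \<otimes> d = inv d \<otimes> inv c" using that by (simp add: inv_mult_group)
    then show ?thesis using that by (metis inv_closed m_assoc)
  qed
  have y3: "y i [^] (3::nat) = \<one>" if "i < n" for i using Suc.prems(2) that by simp
  have z3: "z [^] (3::nat) = \<one>" using Suc.prems(2) by (simp add: z_def)
  have yy: "(y i \<otimes> y j) [^] (2::nat) = \<one>" if "i < n" "j < n" "i \<noteq> j" for i j
    using Suc.prems(3) that by simp
  have yz: "(y i \<otimes> z) [^] (2::nat) = \<one>" "(z \<otimes> y i) [^] (2::nat) = \<one>" if "i < n" for i
    using Suc.prems(3)[of i n] Suc.prems(3)[of n i] that by (simp_all add: z_def)
  have cube_inv: "inv c \<otimes> g = c \<otimes> (c \<otimes> g)" if "c \<in> carrier G" "c [^] (3::nat) = \<one>" "g \<in> carrier G" for c g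
    using cube[OF that] by simp

  have IH: "finite H" "2 * card H \<le> fact (n + 2)"
    using Suc.IH Suc.prems by (auto simp: H_def)
  have subH: "subgroup H G"
    unfolding H_def using y by (intro generate_is_subgroup) auto
  have H: "h \<in> carrier G" if "h \<in> H" for h
    using subgroup.mem_carrier[OF subH that] .
  have one_H: "\<one> \<in> H" using subgroup.one_closed[OF subH] .
  have yH: "y i \<in> H" "inv (y i) \<in> H" if "i < n" for i
    using that by (auto simp: H_def intro: generate.incl generate.inv)
  have HH: "g \<otimes> h \<in> H" if "g \<in> H" "h \<in> H" for g h
    using subgroup.m_closed[OF subH that] .

  define C where "C g = (\<lambda>h. g \<otimes> h) ` H" for g
  \<comment> \<open>In the model, where \<open>z\<close> is the 3-cycle (n \<infinity>
    \<infinity>'), the representatives \<open>\<one>\<close>, \<open>z\<close>, \<open>inv z\<close>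
    and \<open>inv (y i) \<otimes> z\<close> send the point n to n, \<infinity>, \<infinity>' and i:
    one coset for each of the \<open>n + 3\<close> points.\<close>
  define U where "U = (C \<one> \<union> C z \<union> C (inv z)) \<union> (\<Union>i<n. C (inv (y i) \<otimes> z))"
  have U1: "h \<in> U" if "h \<in> H" for h
    using that H by (force simp: U_def C_def)
  have U2: "z \<otimes> h \<in> U" "inv z \<otimes> h \<in> U" if "h \<in> H" for h
    using that by (auto simp: U_def C_def)
  have U3: "inv (y i) \<otimes> (z \<otimes> h) \<in> U" if "i < n" "h \<in> H" for i h
    using that H y z by (force simp: U_def C_def m_assoc)
  have U_cases: "(u \<in> H) \<or> (\<exists>h\<in>H. u = z \<otimes> h) \<or> (\<exists>h\<in>H. u = inv z \<otimes> h) \<or>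
      (\<exists>i<n. \<exists>h\<in>H. u = inv (y i) \<otimes> (z \<otimes> h))" if "u \<in> U" for u
    using that H y z by (auto simp: U_def C_def m_assoc)

  have left_y: "y j \<otimes> u \<in> U" if j: "j < n" and "u \<in> U" for j u
    using U_cases[OF \<open>u \<in> U\<close>]
  proof (elim disjE bexE exE conjE)
    assume "u \<in> H"
    then show ?thesis using U1 HH yH j by simp
  next
    fix h assume h: "h \<in> H" and u: "u = z \<otimes> h"
    have "y j \<otimes> u = inv z \<otimes> (inv (y j) \<otimes> h)"
      unfolding u using swap yz j y z H h by simp
    then show ?thesis using U2 HH yH j h by simp
  next
    fix h assume h: "h \<in> H" and u: "u = inv z \<otimes> h"
    have "y j \<otimes> u = inv (y j) \<otimes> (inv (y j) \<otimes> (inv z \<otimes> h))"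
      unfolding u using cube_inv[of "y j" "inv (y j) \<otimes> (inv z \<otimes> h)"] y3 j y z H h
      by (simp add: m_assoc[symmetric])
    also have "\<dots> = inv (y j) \<otimes> (z \<otimes> (y j \<otimes> h))"
      using swap[of z "y j"] yz j y z H h by simp
    finally show ?thesis using U3 HH yH j h by simp
  next
    fix i h assume i: "i < n" and h: "h \<in> H" and u: "u = inv (y i) \<otimes> (z \<otimes> h)"
    show ?thesis
    proof (cases "i = j")
      case True
      then have "y j \<otimes> u = z \<otimes> h"
        unfolding u using y[OF j] z H[OF h] by (simp add: m_assoc[symmetric])
      then show ?thesis using U2 h by simp
    next
      case False
      \<comment> \<open>Writing \<open>inv (y i)\<close> as a square exposes to \<open>swap\<close>
        first the pair \<open>y j\<close>, \<open>y i\<close>, then \<open>y i\<close>,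
        \<open>z\<close>, and finally the inverses of \<open>y j\<close> and \<open>z\<close>. The
        result lies in the coset of index \<open>i\<close>.\<close>
      have "y j \<otimes> u = y j \<otimes> (y i \<otimes> (y i \<otimes> (z \<otimes> h)))"
        unfolding u using cube_inv[of "y i"] y3 i y z H h by simp
      also have "\<dots> = inv (y i) \<otimes> (inv (y j) \<otimes> (y i \<otimes> (z \<otimes> h)))"
        using swap[of "y j" "y i"] yy[of j i] False i j y z H h by simp
      also have "\<dots> = inv (y i) \<otimes> (inv (y j) \<otimes> (inv z \<otimes> (inv (y i) \<otimes> h)))"
        using swap[of "y i" z] yz i y z H h by simp
      also have "\<dots> = inv (y i) \<otimes> (z \<otimes> (y j \<otimes> (inv (y i) \<otimes> h)))"
        using swap[of z "y j"] yz i j y z H h by simp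
      finally show ?thesis using U3 HH yH i j h by simp
    qed
  qed
  have left_z: "z \<otimes> u \<in> U" if "u \<in> U" for u
    using U_cases[OF \<open>u \<in> U\<close>]
  proof (elim disjE bexE exE conjE)
    assume "u \<in> H"
    then show ?thesis using U2 by simp
  next
    fix h assume h: "h \<in> H" and u: "u = z \<otimes> h"
    have "z \<otimes> u = inv z \<otimes> h" unfolding u using cube z z3 H h by simp
    then show ?thesis using U2 h by simp
  next
    fix h assume h: "h \<in> H" and u: "u = inv z \<otimes> h"
    have "z \<otimes> u = h" unfolding u using z H[OF h] by (simp add: m_assoc[symmetric])
    then show ?thesis using U1 h by simp
  next
    fix i h assume i: "i < n" and h: "h \<in> H" and u: "u = inv (y i) \<otimes> (z \<otimes> h)"
    have "z \<otimes> u = z \<otimes> (y i \<otimes> (y i \<otimes> (z \<otimes> h)))"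
      unfolding u using cube_inv[of "y i"] y3 i y z H h by simp
    also have "\<dots> = inv (y i) \<otimes> (inv z \<otimes> (inv z \<otimes> (inv (y i) \<otimes> h)))"
      using swap[of z "y i"] swap[of "y i" z] yz i y z H h by simp
    also have "\<dots> = inv (y i) \<otimes> (z \<otimes> (inv (y i) \<otimes> h))"
      using cube_inv[of z "inv z \<otimes> (inv (y i) \<otimes> h)"] z3 i y z H h
      by (simp add: m_assoc[symmetric])
    finally show ?thesis using U3 HH yH i h by simp
  qed

  have "generate G (y ` {..<Suc n}) \<subseteq> U"
  proof (rule generate_subset_if_left_closed)
    show "\<exists>k>0. s [^] (k::nat) = \<one>" if "s \<in> y ` {..<Suc n}" for s
      using that Suc.prems(2) by (intro exI[of _ 3]) auto
    show "s \<otimes> u \<in> U" if "s \<in> y ` {..<Suc n}" "u \<in> U" for s u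
      using that left_y left_z by (auto simp: z_def less_Suc_eq)
    show "U \<subseteq> carrier G" using H y z by (auto simp: U_def C_def)
  qed (use Suc.prems U1[OF one_H] in auto)
  moreover have fin: "finite U"
    using IH(1) by (auto simp: U_def C_def)
  moreover have "card U \<le> (n + 3) * card H"
  proof -
    have C: "card (C g) \<le> card H" for g
      unfolding C_def using IH(1) by (rule card_image_le)
    have "card U \<le> card (C \<one> \<union> C z \<union> C (inv z)) + card (\<Union>i<n. C (inv (y i) \<otimes> z))"
      unfolding U_def by (rule card_Un_le)
    also have "card (C \<one> \<union> C z \<union> C (inv z)) \<le> card (C \<one>) + card (C z) + card (C (inv z))"
      by (meson add_mono card_Un_le order_refl order_trans)
    also have "\<dots> \<le> card H + card H + card H"
      using C by (intro add_mono)
    also have "card (\<Union>i<n. C (inv (y i) \<otimes> z)) \<le> (\<Sum>i<n. card (C (inv (y i) \<otimes> z)))"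
      by (rule card_UN_le) simp
    also have "\<dots> \<le> (\<Sum>i<n. card H)"
      using C by (intro sum_mono)
    finally show ?thesis by (simp add: algebra_simps)
  qed
  ultimately have "finite (generate G (y ` {..<Suc n}))"
      "card (generate G (y ` {..<Suc n})) \<le> (n + 3) * card H"
    by (auto intro: finite_subset dest: card_mono[OF fin] order_trans)
  \<comment> \<open>The bound \<open>n + 3\<close> on the index is the factor that turns
    \<open>fact (n + 2)\<close> into \<open>fact (n + 3)\<close>.\<close>
  moreover have "2 * ((n + 3) * card H) \<le> fact (Suc n + 2)"
    using mult_le_mono2[OF IH(2), of "n + 3"] by (simp add: algebra_simps)
  ultimately show ?case by linarith
qed

subsection \<open>Extensions of a group of 3-cycles by \<open>AGL(1, p)\<close>\<close>

lemma (in group) nat_pow_mod: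
  assumes "g \<in> carrier G" "g [^] (n::nat) = \<one>"
  shows "g [^] (i mod n) = g [^] i"
proof -
  have "g [^] i = g [^] (n * (i div n) + i mod n)" by simp
  also have "\<dots> = (g [^] n) [^] (i div n) \<otimes> g [^] (i mod n)"
    using assms(1) by (simp only: nat_pow_mult nat_pow_pow)
  also have "\<dots> = g [^] (i mod n)" using assms by simp
  finally show ?thesis by simp
qed

lemma (in group) nat_pow_cong:
  assumes "g \<in> carrier G" "g [^] (n::nat) = \<one>" "[i = j] (mod n)"
  shows "g [^] i = g [^] j"
  using nat_pow_mod[OF assms(1,2)] assms(3) by (metis cong_def)

context group
begin

definition conj_by :: "'a \<Rightarrow> 'a \<Rightarrow> 'a" where "conj_by g h = g \<otimes> (h \<otimes> inv g)"

lemma conj_closed [simp]: "g \<in> carrier G \<Longrightarrow> h \<in> carrier G \<Longrightarrow> conj_by g h \<in> carrier G"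
  by (simp add: conj_by_def)

lemma inv_mult_cancel: "g \<in> carrier G \<Longrightarrow> h \<in> carrier G \<Longrightarrow> inv g \<otimes> (g \<otimes> h) = h"
  by (simp add: m_assoc[symmetric])

lemma conj_mult: "g \<in> carrier G \<Longrightarrow> h \<in> carrier G \<Longrightarrow> k \<in> carrier G \<Longrightarrow>
    conj_by g (h \<otimes> k) = conj_by g h \<otimes> conj_by g k"
  by (simp add: conj_by_def m_assoc inv_mult_cancel)

lemma conj_conj: "g \<in> carrier G \<Longrightarrow> h \<in> carrier G \<Longrightarrow> k \<in> carrier G \<Longrightarrow>
    conj_by (g \<otimes> h) k = conj_by g (conj_by h k)"
  by (simp add: conj_by_def m_assoc inv_mult_group)

lemma conj_eqI: "g \<in> carrier G \<Longrightarrow> h \<in> carrier G \<Longrightarrow> k \<in> carrier G \<Longrightarrow> g \<otimes> h = k \<otimes> g \<Longrightarrow> conj_by g h = k"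
  by (simp add: conj_by_def m_assoc[symmetric]) (simp add: m_assoc)

lemma mult_eq_conj_mult: "g \<in> carrier G \<Longrightarrow> h \<in> carrier G \<Longrightarrow> g \<otimes> h = conj_by g h \<otimes> g"
  by (simp add: conj_by_def m_assoc)

lemma group_hom_conj: "g \<in> carrier G \<Longrightarrow> group_hom G G (conj_by g)"
  by unfold_locales (auto intro: homI simp: conj_mult)

lemma conj_pow: "g \<in> carrier G \<Longrightarrow> h \<in> carrier G \<Longrightarrow> conj_by g (h [^] (n::nat)) = conj_by g h [^] n"
  using group_hom.hom_nat_pow[OF group_hom_conj] by blast

lemma conj_one: "g \<in> carrier G \<Longrightarrow> conj_by g \<one> = \<one>"
  by (simp add: conj_by_def)

lemma one_conj: "h \<in> carrier G \<Longrightarrow> conj_by \<one> h = h"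
  by (simp add: conj_by_def)

end

text \<open>The working form of the relations, used both in an unknown group and in the model. The
  shorter lists of relators introduced later are shown to be equivalent to it.\<close>

definition agl_relations :: "('g, 'm) monoid_scheme \<Rightarrow> nat \<Rightarrow> nat \<Rightarrow> 'g \<Rightarrow> 'g \<Rightarrow> 'g \<Rightarrow> bool" where
  "agl_relations G p r a b x \<longleftrightarrow>
     a \<in> carrier G \<and> b \<in> carrier G \<and> x \<in> carrier G \<and>
     a [^]\<^bsub>G\<^esub> p = \<one>\<^bsub>G\<^esub> \<and> b [^]\<^bsub>G\<^esub> (p - 1) = \<one>\<^bsub>G\<^esub> \<and>
     b \<otimes>\<^bsub>G\<^esub> a = a [^]\<^bsub>G\<^esub> r \<otimes>\<^bsub>G\<^esub> b \<and> b \<otimes>\<^bsub>G\<^esub> x = x \<otimes>\<^bsub>G\<^esub> b \<and> x [^]\<^bsub>G\<^esub> (3::nat) = \<one>\<^bsub>G\<^esub> \<and>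
     (x \<otimes>\<^bsub>G\<^esub> (a \<otimes>\<^bsub>G\<^esub> (x \<otimes>\<^bsub>G\<^esub> inv\<^bsub>G\<^esub> a))) [^]\<^bsub>G\<^esub> (2::nat) = \<one>\<^bsub>G\<^esub>"

text \<open>For prime \<open>p\<close> this makes \<open>r\<close> a primitive root modulo
  \<open>p\<close>; for \<open>p = 2\<close> it forces \<open>r = 1\<close>.\<close>

definition generates_units :: "nat \<Rightarrow> nat \<Rightarrow> bool" where
  "generates_units p r \<longleftrightarrow> 0 < r \<and> r < p \<and> (\<forall>j. 0 < j \<and> j < p \<longrightarrow> (\<exists>k. r ^ k mod p = j))"

text \<open>An unknown group in which the relations hold; its finiteness is a conclusion.\<close>

locale agl_extension = group G for G (structure) +
  fixes p r :: nat and a b x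
  assumes prime: "prime p" and r: "generates_units p r"
    and rels: "agl_relations G p r a b x"
    and gens: "generate G {a, b, x} = carrier G"
begin

lemma p_ge_2: "p \<ge> 2" using prime by (rule prime_ge_2_nat)

lemma abx [simp]: "a \<in> carrier G" "b \<in> carrier G" "x \<in> carrier G"
  and a_pow: "a [^] p = \<one>" and b_pow: "b [^] (p - 1) = \<one>" and b_a: "b \<otimes> a = a [^] r \<otimes> b"
  and b_x: "b \<otimes> x = x \<otimes> b" and x_pow: "x [^] (3::nat) = \<one>"
  and x_a: "(x \<otimes> (a \<otimes> (x \<otimes> inv a))) [^] (2::nat) = \<one>"
  using rels by (simp_all add: agl_relations_def)

lemma conj_b_x: "conj_by b x = x"
  by (rule conj_eqI) (simp_all add: b_x)

lemma b_a_pow: "b \<otimes> a [^] (i::nat) = a [^] (r * i) \<otimes> b"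
proof -
  have "conj_by b (a [^] i) = (a [^] r) [^] i"
    using conj_eqI[of b a "a [^] r"] by (simp add: conj_pow b_a)
  then show ?thesis using mult_eq_conj_mult[of b "a [^] i"] by (simp add: nat_pow_pow)
qed

definition y :: "nat \<Rightarrow> 'a" where "y i = conj_by (a [^] i) x"

lemma y_closed [simp]: "y i \<in> carrier G" by (simp add: y_def)

lemma y_0: "y 0 = x" by (simp add: y_def one_conj)

lemma y_mod: "y (i mod p) = y i"
  by (simp add: y_def nat_pow_mod a_pow)

lemma conj_a_pow_y: "conj_by (a [^] (i::nat)) (y j) = y (i + j)"
  by (simp add: y_def conj_conj[symmetric] nat_pow_mult)

lemma conj_a_y: "conj_by a (y j) = y (j + 1)"
  using conj_a_pow_y[of 1 j] by simp

lemma conj_b_y: "conj_by b (y i) = y (r * i)"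
proof -
  have "conj_by b (y i) = conj_by (b \<otimes> a [^] i) x" by (simp add: y_def conj_conj)
  also have "\<dots> = conj_by (a [^] (r * i)) (conj_by b x)" by (simp add: b_a_pow conj_conj)
  finally show ?thesis by (simp add: conj_b_x y_def)
qed

lemma y_cube: "y i [^] (3::nat) = \<one>"
  by (simp add: y_def conj_pow[symmetric] x_pow conj_one)

text \<open>Conjugation by \<open>b\<close> fixes \<open>x\<close> and sends \<open>y i\<close> to
  \<open>y (r * i)\<close>. The given relation is the case of index 1, so it spreads to all powers
  of \<open>r\<close>, which cover the nonzero residues.\<close>

lemma x_y_square:
  assumes "j mod p \<noteq> 0"
  shows "(x \<otimes> y j) [^] (2::nat) = \<one>"
proof -
  have "(x \<otimes> y (r ^ k)) [^] (2::nat) = \<one>" for k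
  proof (induction k)
    case 0
    then show ?case using x_a by (simp add: y_def conj_by_def)
  next
    case (Suc k)
    have "(x \<otimes> y (r ^ Suc k)) [^] (2::nat) = conj_by b ((x \<otimes> y (r ^ k)) [^] (2::nat))"
      by (simp add: conj_pow conj_mult conj_b_y conj_b_x)
    then show ?case by (simp add: Suc conj_one)
  qed
  moreover obtain k where "r ^ k mod p = j mod p"
    using r assms p_ge_2 unfolding generates_units_def
    by (metis bot_nat_0.not_eq_extremum mod_less_divisor not_numeral_le_zero)
  ultimately show ?thesis by (metis y_mod)
qed

lemma y_y_square:
  assumes "i < p" "j < p" "i \<noteq> j"
  shows "(y i \<otimes> y j) [^] (2::nat) = \<one>"
proof -
  \<comment> \<open>Adding \<open>p\<close> keeps the subtraction of natural numbers exact; modulo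
    \<open>p\<close> this is the difference \<open>j - i\<close>. Conjugation by
    \<open>a [^] i\<close> then moves the pair of indices \<open>0, d\<close> to
    \<open>i, j\<close>.\<close>
  define d where "d = j + p - i"
  have "d mod p \<noteq> 0"
  proof
    assume "d mod p = 0"
    then obtain c where c: "d = p * c" by (auto elim: dvdE)
    have "0 < d" "d < p * 2" using assms by (auto simp: d_def)
    then have "0 < c" "c < 2" using c by auto
    then have "d = p" using c by (cases c) auto
    then show False using assms by (simp add: d_def)
  qed
  then have "conj_by (a [^] i) ((x \<otimes> y d) [^] (2::nat)) = \<one>"
    by (simp add: x_y_square conj_one)
  moreover have "conj_by (a [^] i) ((x \<otimes> y d) [^] (2::nat)) = (y i \<otimes> y (i + d)) [^] (2::nat)"
    using conj_a_pow_y[of i 0] by (simp add: conj_pow conj_mult conj_a_pow_y y_0)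
  moreover have "y (i + d) = y j"
  proof -
    have "i + d = j + p" using assms by (simp add: d_def)
    then show ?thesis using y_mod[of "j + p"] y_mod[of j] by simp
  qed
  ultimately show ?thesis by simp
qed

definition N :: "'a set" where "N = generate G (y ` {..<p})"

lemma y_in_N: "y i \<in> N"
  using p_ge_2 y_mod[of i] by (auto simp: N_def intro!: generate.incl image_eqI[of _ _ "i mod p"])

lemma x_in_N: "x \<in> N" using y_in_N[of 0] by (simp add: y_0)

lemma subgroup_N: "subgroup N G"
  unfolding N_def by (rule generate_is_subgroup) auto

lemmas N_closed = subgroup.m_closed[OF subgroup_N]
lemmas one_N = subgroup.one_closed[OF subgroup_N]
lemmas N_carrier [simp] = subgroup.mem_carrier[OF subgroup_N]

lemma finite_N: "finite N" and card_N: "2 * card N \<le> fact (p + 2)"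
  using card_generate_three_cycles[of p y] y_cube y_y_square by (auto simp: N_def)

text \<open>Normality of \<open>N\<close>. Conjugation by \<open>a\<close> or \<open>b\<close> sends
  each \<open>y i\<close> to some \<open>y j\<close>, and \<open>x\<close> lies in \<open>N\<close>,
  so the elements conjugating \<open>N\<close> into itself are closed under left multiplication by
  the generators.\<close>

lemma conj_N: "n \<in> N \<Longrightarrow> g \<in> carrier G \<Longrightarrow> conj_by g n \<in> N"
proof -
  let ?U = "{g \<in> carrier G. \<forall>n\<in>N. conj_by g n \<in> N}"
  have step: "conj_by g n \<in> N" if "g \<in> carrier G" "conj_by g ` y ` {..<p} \<subseteq> N" "n \<in> N" for g n
  proof -
    have "conj_by g ` N = generate G (conj_by g ` y ` {..<p})"
      unfolding N_def
      by (rule group_hom.generate_img[OF group_hom_conj, symmetric]) (use that in auto)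
    also have "\<dots> \<subseteq> N" using that(2) subgroup_N by (rule generate_subgroup_incl)
    finally show ?thesis using that(3) by auto
  qed
  have abx_N: "conj_by g n \<in> N" if "g \<in> {a, b, x}" "n \<in> N" for g n
  proof (rule step)
    show "conj_by g ` y ` {..<p} \<subseteq> N"
      using that(1) y_in_N x_in_N
      by (auto simp: conj_a_y conj_b_y)
         (auto simp: conj_by_def intro: N_closed subgroup.m_inv_closed[OF subgroup_N])
  qed (use that in auto)
  have "generate G {a, b, x} \<subseteq> ?U"
  proof (rule generate_subset_if_left_closed)
    show "\<exists>n>0. s [^] (n::nat) = \<one>" if "s \<in> {a, b, x}" for s
    proof -
      have "p - 1 > 0" "p > 0" using p_ge_2 by auto
      then show ?thesis using that a_pow b_pow x_pow
        by (metis empty_iff insert_iff zero_less_numeral)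
    qed
    show "s \<otimes> u \<in> ?U" if "s \<in> {a, b, x}" "u \<in> ?U" for s u
      using that abx_N[of s] by (auto simp: conj_conj)
  qed (auto simp: one_conj)
  then show "n \<in> N \<Longrightarrow> g \<in> carrier G \<Longrightarrow> conj_by g n \<in> N"
    using gens by auto
qed

text \<open>Coset enumeration modulo the normal subgroup \<open>N\<close>: the product
  \<open>N <#> W\<close> absorbs \<open>a\<close> and \<open>b\<close> by hypothesis and
  \<open>x\<close> because \<open>x\<close> lies in \<open>N\<close>, so it is the whole
  group.\<close>

lemma card_le_transversal:
  assumes W: "finite W" "W \<subseteq> carrier G" "\<one> \<in> W"
    and aW: "\<And>w. w \<in> W \<Longrightarrow> a \<otimes> w \<in> N <#> W" and bW: "\<And>w. w \<in> W \<Longrightarrow> b \<otimes> w \<in> N <#> W"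
  shows "finite (carrier G)" "2 * card (carrier G) \<le> fact (p + 2) * card W"
proof -
  have NW: "N <#> W = (\<lambda>(n, w). n \<otimes> w) ` (N \<times> W)"
    by (auto simp: set_mult_def)
  have left: "g \<otimes> u \<in> N <#> W"
    if g: "g \<in> carrier G" "\<And>w. w \<in> W \<Longrightarrow> g \<otimes> w \<in> N <#> W" and u_NW: "u \<in> N <#> W" for g u
  proof -
    obtain n w where n: "n \<in> N" and w: "w \<in> W" and u: "u = n \<otimes> w"
      using u_NW by (auto simp: set_mult_def)
    obtain n' w' where n': "n' \<in> N" and w': "w' \<in> W" and gw: "g \<otimes> w = n' \<otimes> w'"
      using g(2)[OF w] by (auto simp: set_mult_def)
    have wc: "w \<in> carrier G" "w' \<in> carrier G" using w w' W(2) by auto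
    have "g \<otimes> u = (g \<otimes> n) \<otimes> w"
      using g n wc u by (simp add: m_assoc)
    also have "\<dots> = conj_by g n \<otimes> (g \<otimes> w)"
      using g n wc mult_eq_conj_mult[of g n] by (simp add: m_assoc)
    also have "\<dots> = (conj_by g n \<otimes> n') \<otimes> w'"
      using g n n' wc gw by (simp add: m_assoc)
    finally show ?thesis using conj_N[OF n g(1)] n' w' N_closed by (auto simp: set_mult_def)
  qed
  have "generate G {a, b, x} \<subseteq> N <#> W"
  proof (rule generate_subset_if_left_closed)
    show "\<exists>n>0. s [^] (n::nat) = \<one>" if "s \<in> {a, b, x}" for s
    proof -
      have "p - 1 > 0" "p > 0" using p_ge_2 by auto
      then show ?thesis using that a_pow b_pow x_pow
        by (metis empty_iff insert_iff zero_less_numeral)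
    qed
    show "N <#> W \<subseteq> carrier G" using W(2) by (auto simp: set_mult_def)
    show "\<one> \<in> N <#> W" using W(3) one_N by (force simp: set_mult_def)
    have "x \<otimes> w \<in> N <#> W" if "w \<in> W" for w
      using that x_in_N by (auto simp: set_mult_def)
    then show "s \<otimes> u \<in> N <#> W" if "s \<in> {a, b, x}" "u \<in> N <#> W" for s u
      using left[OF _ _ that(2), of s] that(1) aW bW by auto
  qed auto
  then have sub: "carrier G \<subseteq> N <#> W" using gens by simp
  have fin: "finite (N <#> W)" unfolding NW using finite_N W(1) by simp
  then show "finite (carrier G)" using sub by (rule rev_finite_subset)
  have "card (carrier G) \<le> card (N <#> W)" using fin sub by (rule card_mono)
  also have "\<dots> \<le> card (N \<times> W)" unfolding NW using finite_N W(1) by (intro card_image_le) simp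
  finally have "2 * card (carrier G) \<le> (2 * card N) * card W" by (simp add: card_cartesian_product)
  also have "\<dots> \<le> fact (p + 2) * card W" using card_N by (rule mult_le_mono1)
  finally show "2 * card (carrier G) \<le> fact (p + 2) * card W" .
qed

text \<open>Since \<open>b\<close> moves past powers of \<open>a\<close>, the products
  \<open>a [^] i \<otimes> b [^] j\<close> represent all cosets of \<open>N\<close>. There are at
  most \<open>p * (p - 1)\<close> of them, the order of AGL(1, p).\<close>

lemma card_le_subdirect:
  "finite (carrier G)" "2 * card (carrier G) \<le> fact (p + 2) * (p * (p - 1))"
proof -
  define W where "W = (\<lambda>(i, j). a [^] i \<otimes> b [^] j) ` ({..<p} \<times> {..<p - 1})"
  have W: "a [^] i \<otimes> b [^] j \<in> W" for i j :: nat
  proof -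
    have "a [^] i \<otimes> b [^] j = a [^] (i mod p) \<otimes> b [^] (j mod (p - 1))"
      using nat_pow_mod[of a p i] nat_pow_mod[of b "p - 1" j] a_pow b_pow by simp
    then show ?thesis using p_ge_2 by (auto simp: W_def intro!: image_eqI[of _ _ "(i mod p, j mod (p - 1))"])
  qed
  have sub: "W \<subseteq> N <#> W"
    using one_N by (force simp: W_def set_mult_def)
  have aW: "a \<otimes> w \<in> N <#> W" if w: "w \<in> W" for w
  proof -
    obtain i j :: nat where w: "w = a [^] i \<otimes> b [^] j" using w by (auto simp: W_def)
    have "a \<otimes> w = (a \<otimes> a [^] i) \<otimes> b [^] j" unfolding w by (simp add: m_assoc)
    also have "\<dots> = a [^] Suc i \<otimes> b [^] j" by (simp only: nat_pow_Suc2 abx)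
    finally show ?thesis using subsetD[OF sub W[of "Suc i" j]] by (simp only:)
  qed
  have bW: "b \<otimes> w \<in> N <#> W" if w: "w \<in> W" for w
  proof -
    obtain i j :: nat where w: "w = a [^] i \<otimes> b [^] j" using w by (auto simp: W_def)
    have "b \<otimes> w = (b \<otimes> a [^] i) \<otimes> b [^] j" unfolding w by (simp add: m_assoc)
    also have "\<dots> = a [^] (r * i) \<otimes> (b \<otimes> b [^] j)" by (simp add: b_a_pow m_assoc)
    also have "\<dots> = a [^] (r * i) \<otimes> b [^] Suc j" by (simp only: nat_pow_Suc2 abx)
    finally show ?thesis using subsetD[OF sub W[of "r * i" "Suc j"]] by (simp only:)
  qed
  have "finite W" "W \<subseteq> carrier G" "\<one> \<in> W" using W[of 0 0] by (auto simp: W_def)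
  note * = card_le_transversal[OF this aW bW]
  then show "finite (carrier G)" by simp
  have "card W \<le> p * (p - 1)"
    unfolding W_def by (rule order_trans[OF card_image_le]) (auto simp: card_cartesian_product)
  then show "2 * card (carrier G) \<le> fact (p + 2) * (p * (p - 1))"
    using *(2) by (meson le_trans mult_le_mono2)
qed

text \<open>In the quotient by \<open>N\<close> the factor \<open>n\<close> disappears, so a
  relation on \<open>n \<otimes> g\<close> becomes one on \<open>g\<close>.\<close>

lemma N_pow:
  assumes "n \<in> N" "g \<in> carrier G" "(n \<otimes> g) [^] (k::nat) = \<one>"
  shows "g [^] k \<in> N"
proof -
  have "\<exists>n'\<in>N. (n \<otimes> g) [^] k = n' \<otimes> g [^] k" for k :: nat
  proof (induction k)
    case 0
    then show ?case using one_N by auto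
  next
    case (Suc k)
    then obtain n' where n': "n' \<in> N" "(n \<otimes> g) [^] k = n' \<otimes> g [^] k" by blast
    have "(n \<otimes> g) [^] Suc k = n' \<otimes> ((g [^] k \<otimes> n) \<otimes> g)"
      using n' assms by (simp add: m_assoc)
    also have "\<dots> = (n' \<otimes> conj_by (g [^] k) n) \<otimes> g [^] Suc k"
      using n' assms mult_eq_conj_mult[of "g [^] k" n] by (simp add: m_assoc)
    finally show ?case using n' conj_N[OF assms(1), of "g [^] k"] assms(2) N_closed by auto
  qed
  then obtain n' where n': "n' \<in> N" "n' \<otimes> g [^] k = \<one>" using assms(3) by metis
  then have "g [^] k = inv n'"
    using assms(2) by (metis N_carrier inv_equality inv_inv nat_pow_closed)
  then show ?thesis using n'(1) subgroup.m_inv_closed[OF subgroup_N] by simp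
qed

text \<open>Either assumption leaves a quotient by \<open>N\<close> of order at most 2, generated by
  the class of \<open>t\<close>: by \<open>a\<close>, of order dividing \<open>p = 2\<close>, or by
  \<open>b\<close>, whose square lies in \<open>N\<close>.\<close>

lemma card_le_sym:
  assumes "b = \<one> \<and> p = 2 \<or> a \<in> N \<and> b \<otimes> b \<in> N"
  shows "finite (carrier G)" "card (carrier G) \<le> fact (p + 2)"
proof -
  define t where "t = (if b = \<one> \<and> p = 2 then a else b)"
  have t: "t \<in> carrier G" by (simp add: t_def)
  have NW: "n \<in> N <#> {\<one>, t}" "n \<otimes> t \<in> N <#> {\<one>, t}" if "n \<in> N" for n
    using that by (auto simp: set_mult_def)
  note NW = NW[OF one_N] NW
  have "a \<otimes> w \<in> N <#> {\<one>, t}" "b \<otimes> w \<in> N <#> {\<one>, t}" if "w \<in> {\<one>, t}" for w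
  proof -
    have "a \<otimes> a = \<one>" if "p = 2" using a_pow that by (simp add: numeral_2_eq_2)
    then show "a \<otimes> w \<in> N <#> {\<one>, t}" "b \<otimes> w \<in> N <#> {\<one>, t}"
      using assms that NW t by (auto simp: t_def split: if_splits)
  qed
  note * = card_le_transversal[OF _ _ _ this]
  have "2 * card (carrier G) \<le> fact (p + 2) * card {\<one>, t}"
    by (rule *(2)) (auto simp: t)
  also have "\<dots> \<le> fact (p + 2) * 2"
    by (rule mult_le_mono2) (simp add: card_insert_if)
  finally show "card (carrier G) \<le> fact (p + 2)" by simp
  show "finite (carrier G)" by (rule *(1)) (auto simp: t)
qed

text \<open>Otherwise the powers of \<open>r\<close> would take at most two values, whereas they
  have to reach at least four nonzero residues.\<close>

lemma primitive_square_not_1: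
  assumes "p \<ge> 5"
  shows "\<not> [r * r = 1] (mod p)"
proof
  assume "[r * r = 1] (mod p)"
  then have sq: "(r * r) mod p = 1" using assms by (simp add: cong_def)
  have "r ^ k mod p \<in> {1, r mod p}" for k
  proof (induction k)
    case (Suc k)
    have "r ^ Suc k mod p = r * (r ^ k mod p) mod p" by (simp add: mod_mult_right_eq)
    moreover have "r * (r mod p) mod p = 1" using sq by (simp add: mod_mult_right_eq)
    ultimately show ?case using Suc by auto
  qed (use assms in simp)
  then have "{1..<p} \<subseteq> {1, r mod p}"
    using r unfolding generates_units_def
    by (metis Suc_eq_plus1 add.commute atLeastLessThan_iff less_eq_Suc_le plus_1_eq_Suc subsetI One_nat_def)
  then have "card {1..<p} \<le> card {1, r mod p}" by (rule card_mono[rotated]) simp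
  also have "\<dots> \<le> 2" by (simp add: card_insert_if)
  finally show False using assms by simp
qed

text \<open>By \<open>N_pow\<close> the relation puts \<open>b [^] (p + 1)\<close> into
  \<open>N\<close>, and this is \<open>b \<otimes> b\<close> since \<open>b\<close> has order
  dividing \<open>p - 1\<close>. Conjugation by \<open>b \<otimes> b\<close> raises \<open>a\<close>
  to the power \<open>r * r\<close>, so \<open>a [^] (r * r - 1)\<close> lies in \<open>N\<close>.
  As \<open>r * r - 1\<close> is invertible modulo \<open>p\<close>, so does
  \<open>a\<close>.\<close>

lemma card_le_sym_large:
  assumes "p \<ge> 5" "(a \<otimes> (x \<otimes> inv a) \<otimes> b) [^] (p + 1) = \<one>"
  shows "finite (carrier G)" "card (carrier G) \<le> fact (p + 2)"
proof -
  have y1: "y 1 = a \<otimes> (x \<otimes> inv a)" by (simp add: y_def conj_by_def)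
  have "b [^] (p + 1) \<in> N"
    by (rule N_pow[OF y_in_N[of 1] abx(2)]) (use assms(2) in \<open>simp only: y1\<close>)
  moreover have "b [^] (p + 1) = b \<otimes> b"
  proof -
    have "b [^] (p + 1) = b [^] ((p - 1) + 2)" using assms(1) by simp
    also have "\<dots> = b [^] (p - 1) \<otimes> b [^] (2::nat)"
      by (rule nat_pow_mult[symmetric]) simp
    finally show ?thesis unfolding b_pow by (simp add: numeral_2_eq_2)
  qed
  ultimately have bb: "b \<otimes> b \<in> N" by simp
  have r1: "r * r \<ge> 1" using r by (simp add: generates_units_def)
  have "(b \<otimes> b) \<otimes> a = a [^] (r * r) \<otimes> (b \<otimes> b)"
    using b_a_pow[of r] b_a by (simp add: m_assoc) (simp add: m_assoc[symmetric])
  moreover have "a [^] (r * r) = a [^] (r * r - 1) \<otimes> a"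
    using r1 by (metis Suc_diff_1 Suc_le_eq One_nat_def nat_pow_Suc)
  ultimately have "(b \<otimes> b) \<otimes> a = a [^] (r * r - 1) \<otimes> (a \<otimes> (b \<otimes> b))"
    by (simp add: m_assoc)
  also have "a \<otimes> (b \<otimes> b) = conj_by a (b \<otimes> b) \<otimes> a"
    by (rule mult_eq_conj_mult) simp_all
  finally have "b \<otimes> b = a [^] (r * r - 1) \<otimes> conj_by a (b \<otimes> b)"
    by (simp add: m_assoc[symmetric])
  then have "a [^] (r * r - 1) = (b \<otimes> b) \<otimes> inv (conj_by a (b \<otimes> b))"
    by (metis abx(1,2) conj_closed inv_solve_right m_closed nat_pow_closed)
  then have aN: "a [^] (r * r - 1) \<in> N"
    using bb conj_N[OF bb, of a] N_closed subgroup.m_inv_closed[OF subgroup_N] by simp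
  have "\<not> p dvd (r * r - 1)"
    using primitive_square_not_1[OF assms(1)] r1 by (metis cong_altdef_nat cong_sym)
  then have "coprime (r * r - 1) p"
    using prime by (metis coprime_commute prime_imp_coprime)
  then obtain m where "[(r * r - 1) * m = 1] (mod p)"
    using cong_solve_coprime_nat by auto
  then have "a = (a [^] (r * r - 1)) [^] m"
    using nat_pow_cong[of a p "(r * r - 1) * m" 1] a_pow by (simp add: nat_pow_pow)
  moreover have "(a [^] (r * r - 1)) [^] m \<in> N"
    using aN by (induction m) (auto intro: one_N N_closed)
  ultimately have "a \<in> N" by simp
  then show "finite (carrier G)" "card (carrier G) \<le> fact (p + 2)"
    using card_le_sym bb by auto
qed

text \<open>For \<open>p = 3\<close> the primitive root is 2, whose square is 1 modulo 3, so
  \<open>b \<otimes> b\<close> gives no information about \<open>a\<close>. Here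
  \<open>N_pow\<close> yields \<open>a [^] 5\<close>, which equals \<open>a [^] 2\<close>, and the
  square of that is \<open>a\<close>.\<close>

lemma card_le_sym_3:
  assumes "p = 3" "(x \<otimes> a) [^] (5::nat) = \<one>"
  shows "finite (carrier G)" "card (carrier G) \<le> fact (p + 2)"
proof -
  have "a [^] (5::nat) \<in> N" using N_pow[of x a 5] x_in_N assms(2) by simp
  moreover have "a [^] (5::nat) = a [^] (2::nat)"
    by (rule nat_pow_cong[of _ p]) (use assms(1) a_pow in \<open>simp_all add: cong_def\<close>)
  ultimately have "a [^] (2::nat) \<otimes> a [^] (2::nat) \<in> N" using N_closed by simp
  moreover have "a [^] (2::nat) \<otimes> a [^] (2::nat) = a [^] (4::nat)"
    by (simp add: nat_pow_mult)
  moreover have "a [^] (4::nat) = a [^] (1::nat)"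
    by (rule nat_pow_cong[of _ p]) (use assms(1) a_pow in \<open>simp_all add: cong_def\<close>)
  ultimately have "a \<in> N" by simp
  moreover have "b \<otimes> b = \<one>" using b_pow assms(1) by (simp add: numeral_2_eq_2)
  ultimately show "finite (carrier G)" "card (carrier G) \<le> fact (p + 2)"
    using card_le_sym one_N by auto
qed

end

subsection \<open>The relators\<close>

text \<open>One relator for two orders: it only equates \<open>a^p\<close> with
  \<open>b^(p-1)\<close>, and both become trivial in conjunction with
  \<open>rel_act\<close>.\<close>

definition rel_order :: "nat \<Rightarrow> 'x word_expr \<Rightarrow> 'x word_expr \<Rightarrow> 'x word_expr" where
  "rel_order p A B = Mul (Power A (int p)) (Power B (1 - int p))"

definition rel_act :: "nat \<Rightarrow> int \<Rightarrow> 'x word_expr \<Rightarrow> 'x word_expr \<Rightarrow> 'x word_expr" where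
  "rel_act p s A B =
     (if p = 2 then B else Mul (Mul B (Power A s)) (Mul (Power B (-1)) (Power A (1 - s))))"

definition rel_comm :: "'x word_expr \<Rightarrow> 'x word_expr \<Rightarrow> 'x word_expr" where
  "rel_comm B X = Mul (Mul B X) (Mul (Power B (-1)) (Power X (-1)))"

definition rel_square :: "'x word_expr \<Rightarrow> 'x word_expr \<Rightarrow> 'x word_expr" where
  "rel_square A X = Power (Mul X (Mul A (Mul X (Power A (-1))))) 2"

definition rel_sym :: "nat \<Rightarrow> 'x word_expr \<Rightarrow> 'x word_expr \<Rightarrow> 'x word_expr \<Rightarrow> 'x word_expr" where
  "rel_sym p A B X =
     (if p = 2 then B else if p = 3 then Power (Mul X A) 5
      else Power (Mul (Mul A (Mul X (Power A (-1)))) B) (int p + 1))"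

lemmas rel_defs = rel_order_def rel_act_def rel_comm_def rel_square_def rel_sym_def

text \<open>The congruence says that \<open>s\<close> is the negative inverse of
  \<open>r - 1\<close>. For \<open>p = 2\<close> the root \<open>r = 1\<close> admits no such
  \<open>s\<close>. The range of \<open>s\<close> keeps the bit-length logarithmic.\<close>

definition agl_exponents :: "nat \<Rightarrow> nat \<Rightarrow> int \<Rightarrow> bool" where
  "agl_exponents p r s \<longleftrightarrow> prime p \<and> generates_units p r \<and> 0 \<le> s \<and> s < int p \<and>
     (p = 2 \<or> [s * int r = s - 1] (mod int p))"

definition sym_relation :: "('g, 'm) monoid_scheme \<Rightarrow> nat \<Rightarrow> 'g \<Rightarrow> 'g \<Rightarrow> 'g \<Rightarrow> bool" where
  "sym_relation G p a b x \<longleftrightarrow>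
     (if p = 2 then b = \<one>\<^bsub>G\<^esub> else if p = 3 then (x \<otimes>\<^bsub>G\<^esub> a) [^]\<^bsub>G\<^esub> (5::nat) = \<one>\<^bsub>G\<^esub>
      else (a \<otimes>\<^bsub>G\<^esub> (x \<otimes>\<^bsub>G\<^esub> inv\<^bsub>G\<^esub> a) \<otimes>\<^bsub>G\<^esub> b) [^]\<^bsub>G\<^esub> (p + 1) = \<one>\<^bsub>G\<^esub>)"

section \<open>Equivalence of the relators for \<open>a\<close> and \<open>b\<close> with the
  working relations\<close>

context group
begin

lemma int_pow_cong:
  assumes "g \<in> carrier G" "g [^] (n::nat) = \<one>" "[i = j] (mod int n)"
  shows "g [^] i = g [^] j"
proof -
  obtain k where k: "i = j + int n * k" using assms(3) by (metis cong_iff_lin cong_sym)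
  have "g [^] i = g [^] j \<otimes> (g [^] int n) [^] k"
    unfolding k using assms(1) by (simp only: int_pow_mult int_pow_pow)
  then show ?thesis using assms(1,2) by (simp add: int_pow_int)
qed

lemma int_pow_minus_one: "g \<in> carrier G \<Longrightarrow> g [^] (-1::int) = inv g"
  using int_pow_neg[of g 1] by simp

text \<open>For \<open>p > 2\<close> the element \<open>z = a^p = b^(p-1)\<close> commutes with
  \<open>b\<close>. Raising the conjugation rule \<open>a^s \<mapsto> a^(s-1)\<close> to the power
  \<open>p\<close> therefore gives \<open>z^s = z^(s-1)\<close>, so \<open>z\<close> is trivial.
  Raising the same rule to an inverse of \<open>s\<close> modulo \<open>p\<close> then recovers the
  action of \<open>b\<close> on \<open>a\<close>.\<close>

lemma agl_relations_of_relators: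
  assumes exps: "agl_exponents p r s" and ab: "a \<in> carrier G" "b \<in> carrier G"
    and ord: "a [^] int p \<otimes> b [^] (1 - int p) = \<one>"
    and act: "if p = 2 then b = \<one> else (b \<otimes> a [^] s) \<otimes> (inv b \<otimes> a [^] (1 - s)) = \<one>"
  shows "a [^] p = \<one>" "b [^] (p - 1) = \<one>" "b \<otimes> a = a [^] r \<otimes> b"
proof -
  have p: "p \<ge> 2" using exps by (simp add: agl_exponents_def prime_ge_2_nat)
  have "1 - int p = - int (p - 1)" using p by simp
  then have "b [^] (1 - int p) = inv (b [^] (p - 1))"
    using ab by (simp only: int_pow_neg int_pow_int)
  then have z: "a [^] p = b [^] (p - 1)"
    using ord ab by (metis int_pow_int inv_closed inv_equality inv_inv nat_pow_closed)
  have "a [^] p = \<one> \<and> b \<otimes> a = a [^] r \<otimes> b"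
  proof (cases "p = 2")
    case True
    then have "r = 1" using exps by (simp add: agl_exponents_def generates_units_def)
    then show ?thesis using act z True ab by simp
  next
    case False
    interpret c: group_hom G G "conj_by b" by (rule group_hom_conj) fact
    have conj_as: "conj_by b (a [^] s) = a [^] (s - 1)"
    proof -
      have "conj_by b (a [^] s) \<otimes> a [^] (1 - s) = \<one>"
        using act False ab by (simp add: conj_by_def m_assoc)
      then have "conj_by b (a [^] s) = inv (a [^] (1 - s))"
        using ab by (metis conj_closed int_pow_closed inv_equality inv_inv inv_closed)
      then show ?thesis using ab int_pow_neg[of a "1 - s"] by simp
    qed
    have conj_asm: "conj_by b (a [^] (s * m)) = a [^] ((s - 1) * m)" for m :: int
      using ab conj_as c.hom_int_pow[of "a [^] s" m] by (simp add: int_pow_pow)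
    define z where "z = a [^] p"
    have zc: "z \<in> carrier G" using ab by (simp add: z_def)
    have "conj_by b z = z"
    proof (rule conj_eqI)
      show "b \<otimes> z = z \<otimes> b"
        using ab by (simp add: z_def z nat_pow_comm[of b 1, simplified])
    qed (use ab zc in auto)
    then have "conj_by b (z [^] s) = z [^] s"
      using zc by (simp add: c.hom_int_pow)
    moreover have z_pow: "z [^] m = a [^] (m * int p)" for m :: int
      using ab by (simp add: z_def int_pow_int[symmetric] int_pow_pow mult.commute)
    ultimately have "z [^] s = z [^] (s - 1)"
      using conj_asm[of "int p"] by simp
    moreover have "z [^] s = z [^] (s - 1) \<otimes> z"
      using zc int_pow_mult[of z "s - 1" 1] by simp
    ultimately have "z = \<one>" using zc by (metis int_pow_closed l_cancel_one)
    then have ap: "a [^] p = \<one>" by (simp add: z_def)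
    have sr: "[s * int r = s - 1] (mod int p)" using exps False by (simp add: agl_exponents_def)
    \<comment> \<open>This inverts \<open>s\<close> modulo \<open>p\<close>, because
      \<open>s - s * r \<equiv> s - (s - 1) = 1\<close>. It also carries
      \<open>s - 1 \<equiv> s * r\<close> to \<open>r\<close>.\<close>
    define m where "m = 1 - int r"
    have sm: "[s * m = 1] (mod int p)"
      using cong_diff[OF cong_refl[of s] sr] by (simp add: m_def algebra_simps)
    have "[(s - 1) * m = (s * int r) * m] (mod int p)"
      using sr by (metis cong_scalar_right cong_sym)
    also have "[(s * int r) * m = int r * 1] (mod int p)"
      using cong_scalar_left[OF sm, of "int r"] by (simp add: ac_simps)
    finally have "a [^] ((s - 1) * m) = a [^] r"
      using int_pow_cong[OF ab(1) ap, of "(s - 1) * m" "int r"] by (simp add: int_pow_int)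
    then have "conj_by b a = a [^] r"
      using conj_asm[of m] int_pow_cong[OF ab(1) ap sm] ab by simp
    then show ?thesis using ap mult_eq_conj_mult[of b a] ab by simp
  qed
  then show "a [^] p = \<one>" "b \<otimes> a = a [^] r \<otimes> b" by auto
  then show "b [^] (p - 1) = \<one>" using z by simp
qed

lemma relators_of_agl_relations:
  assumes exps: "agl_exponents p r s" and rels: "agl_relations G p r a b x"
  shows "a [^] int p \<otimes> b [^] (1 - int p) = \<one>"
    and "if p = 2 then b = \<one> else (b \<otimes> a [^] s) \<otimes> (inv b \<otimes> a [^] (1 - s)) = \<one>"
    and "(b \<otimes> x) \<otimes> (inv b \<otimes> inv x) = \<one>"
proof -
  have p: "p \<ge> 2" using exps by (simp add: agl_exponents_def prime_ge_2_nat)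
  have [simp]: "a \<in> carrier G" "b \<in> carrier G" "x \<in> carrier G"
    and ap: "a [^] p = \<one>" and bp: "b [^] (p - 1) = \<one>" and ba: "b \<otimes> a = a [^] r \<otimes> b"
    and bx: "b \<otimes> x = x \<otimes> b"
    using rels by (auto simp: agl_relations_def)
  have "1 - int p = - int (p - 1)" using p by simp
  then have "b [^] (1 - int p) = inv (b [^] (p - 1))"
    by (simp only: int_pow_neg int_pow_int \<open>b \<in> carrier G\<close>)
  then show "a [^] int p \<otimes> b [^] (1 - int p) = \<one>"
    using ap bp by (simp add: int_pow_int)
  show "(b \<otimes> x) \<otimes> (inv b \<otimes> inv x) = \<one>"
    unfolding bx by (simp add: m_assoc) (simp add: m_assoc[symmetric])
  show "if p = 2 then b = \<one> else (b \<otimes> a [^] s) \<otimes> (inv b \<otimes> a [^] (1 - s)) = \<one>"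
  proof (cases "p = 2")
    case False
    interpret c: group_hom G G "conj_by b" by (rule group_hom_conj) simp
    have "conj_by b a = a [^] r" by (rule conj_eqI) (simp_all add: ba)
    then have "conj_by b (a [^] s) = a [^] (int r * s)"
      by (simp add: c.hom_int_pow int_pow_int[symmetric] int_pow_pow)
    then have "conj_by b (a [^] s) \<otimes> a [^] (1 - s) = a [^] (int r * s + (1 - s))"
      by (simp add: int_pow_mult)
    \<comment> \<open>By the choice of \<open>s\<close> the total exponent
      \<open>r * s + 1 - s\<close> is a multiple of \<open>p\<close>.\<close>
    also have "\<dots> = a [^] (0::int)"
    proof (rule int_pow_cong[OF _ ap])
      have "[s * int r = s - 1] (mod int p)" using exps False by (simp add: agl_exponents_def)
      then have "[s * int r + (1 - s) = (s - 1) + (1 - s)] (mod int p)"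
        by (intro cong_add) auto
      then show "[int r * s + (1 - s) = 0] (mod int p)" by (simp add: mult.commute)
    qed simp
    finally show ?thesis using False by (simp add: conj_by_def m_assoc)
  qed (use bp in simp)
qed

lemma card_le_sym_relation:
  assumes "prime p" "generates_units p r" "agl_relations G p r a b x"
    "generate G {a, b, x} = carrier G" "sym_relation G p a b x"
  shows "finite (carrier G) \<and> card (carrier G) \<le> fact (p + 2)"
proof -
  interpret agl_extension G p r a b x
    by unfold_locales (use assms in auto)
  have "p \<noteq> 4" using assms(1) prime_nat_not_dvd[of 4 2] by auto
  then consider "p = 2" | "p = 3" | "p \<ge> 5" using p_ge_2 by linarith
  then show ?thesis
  proof cases
    case 1
    then show ?thesis using card_le_sym assms(5) by (simp add: sym_relation_def)
  next
    case 2
    then show ?thesis using card_le_sym_3 assms(5) by (simp add: sym_relation_def)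
  next
    case 3
    then show ?thesis using card_le_sym_large assms(5) by (simp add: sym_relation_def)
  qed
qed

end

section \<open>The three lists of relators and the groups they present\<close>

definition three_gens_relators :: "nat \<Rightarrow> int \<Rightarrow> nat word_expr list" where
  "three_gens_relators p s =
     [rel_order p (Gen 0) (Gen 1), rel_act p s (Gen 0) (Gen 1), rel_comm (Gen 1) (Gen 2),
      Power (Gen 2) 3, rel_square (Gen 0) (Gen 2), rel_sym p (Gen 0) (Gen 1) (Gen 2)]"

text \<open>The commuting elements \<open>b\<close> and \<open>x\<close> have coprime orders \<open>p - 1\<close> and \<open>3\<close>, hence they are the powers
  \<open>c\<^sup>3\<close> and \<open>c\<^bsup>p-1\<^esup>\<close> of one element \<open>c\<close>, which makes two relators redundant.\<close>

definition two_gens_relators :: "nat \<Rightarrow> int \<Rightarrow> nat word_expr list" where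
  "two_gens_relators p s =
     [rel_order p (Gen 0) (Power (Gen 1) 3), rel_act p s (Gen 0) (Power (Gen 1) 3),
      rel_square (Gen 0) (Power (Gen 1) (int p - 1))]"

definition two_gens_sym_relators :: "nat \<Rightarrow> int \<Rightarrow> nat word_expr list" where
  "two_gens_sym_relators p s = rel_sym p (Gen 0) (Power (Gen 1) 3) (Power (Gen 1) (int p - 1)) #
     two_gens_relators p s"

lemma (in group) eval_rel_sym:
  assumes "f 0 \<in> carrier G" "eval_expr G f A = a" "eval_expr G f B = b" "eval_expr G f X = x"
    and [simp]: "a \<in> carrier G" "b \<in> carrier G" "x \<in> carrier G"
  shows "eval_expr G f (rel_sym p A B X) = \<one> \<longleftrightarrow> sym_relation G p a b x"
proof -
  have "(a \<otimes> (x \<otimes> inv a) \<otimes> b) [^] (int p + 1) = (a \<otimes> (x \<otimes> inv a) \<otimes> b) [^] (p + 1)"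
    using int_pow_int[of G _ "p + 1"] by (simp add: add.commute)
  moreover have "(x \<otimes> a) [^] (5::int) = (x \<otimes> a) [^] (5::nat)"
    using int_pow_int[of G _ 5] by simp
  ultimately show ?thesis
    using assms by (simp add: rel_sym_def sym_relation_def int_pow_minus_one)
qed

lemma (in group) eval_three_gens:
  assumes "agl_exponents p r s" "g 0 \<in> carrier G" "g 1 \<in> carrier G" "g 2 \<in> carrier G"
  shows "(\<forall>e\<in>set (three_gens_relators p s). eval_expr G g e = \<one>) \<longleftrightarrow>
    agl_relations G p r (g 0) (g 1) (g 2) \<and> sym_relation G p (g 0) (g 1) (g 2)"
    (is "?L \<longleftrightarrow> ?R")
proof -
  let ?a = "g 0" and ?b = "g 1" and ?x = "g 2"
  have three: "?x [^] (3::int) = ?x [^] (3::nat)" using int_pow_int[of G ?x 3] by simp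
  have two: "h [^] (2::int) = h [^] (2::nat)" for h using int_pow_int[of G h 2] by simp
  have L: "?L \<longleftrightarrow> ?a [^] int p \<otimes> ?b [^] (1 - int p) = \<one> \<and>
    (if p = 2 then ?b = \<one> else (?b \<otimes> ?a [^] s) \<otimes> (inv ?b \<otimes> ?a [^] (1 - s)) = \<one>) \<and>
    (?b \<otimes> ?x) \<otimes> (inv ?b \<otimes> inv ?x) = \<one> \<and> ?x [^] (3::nat) = \<one> \<and>
    (?x \<otimes> (?a \<otimes> (?x \<otimes> inv ?a))) [^] (2::nat) = \<one> \<and> sym_relation G p ?a ?b ?x"
    using assms eval_rel_sym[of g "Gen 0" ?a "Gen 1" ?b "Gen 2" ?x p]
    by (simp add: three_gens_relators_def rel_order_def rel_act_def rel_comm_def rel_square_def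
        int_pow_minus_one three two)
  show ?thesis
  proof
    assume ?L
    note * = this[unfolded L]
    have "(?b \<otimes> ?x) \<otimes> inv (?x \<otimes> ?b) = \<one>" using * assms by (simp add: inv_mult_group)
    then have "?b \<otimes> ?x = ?x \<otimes> ?b"
      using assms inv_solve_right'[of "\<one>" "?b \<otimes> ?x" "?x \<otimes> ?b"] by auto
    then show ?R
      using * assms agl_relations_of_relators[of p r s ?a ?b] unfolding agl_relations_def by blast
  next
    assume R: ?R
    then have "?x [^] (3::nat) = \<one> \<and> (?x \<otimes> (?a \<otimes> (?x \<otimes> inv ?a))) [^] (2::nat) = \<one>"
      unfolding agl_relations_def by blast
    then show ?L
      unfolding L using relators_of_agl_relations[OF assms(1), of ?a ?b ?x] R by blast
  qed
qed

text \<open>Powers of one element \<open>c\<close> commute, and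
  \<open>x^3 = c^(3(p-1)) = b^(p-1)\<close>. Hence the commutator relation and
  \<open>x^3 = 1\<close> follow once the relators for \<open>a\<close> and \<open>b\<close> are
  known to give \<open>b^(p-1) = 1\<close>.\<close>

lemma (in group) eval_two_gens:
  assumes exps: "agl_exponents p r s" and g: "g 0 \<in> carrier G" "g 1 \<in> carrier G"
  shows "(\<forall>e\<in>set (two_gens_relators p s). eval_expr G g e = \<one>) \<longleftrightarrow>
    agl_relations G p r (g 0) (g 1 [^] (3::nat)) (g 1 [^] (p - 1))"
    (is "?L \<longleftrightarrow> ?R")
proof -
  let ?a = "g 0" and ?b = "g 1 [^] (3::nat)" and ?x = "g 1 [^] (p - 1)"
  have p: "p \<ge> 2" using exps by (simp add: agl_exponents_def prime_ge_2_nat)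
  have three: "g 1 [^] (3::int) = ?b" using int_pow_int[of G _ 3] by simp
  have two: "h [^] (2::int) = h [^] (2::nat)" for h using int_pow_int[of G h 2] by simp
  have x: "g 1 [^] (int p - 1) = ?x" using p int_pow_int[of G _ "p - 1"] by (simp add: of_nat_diff)
  have L: "?L \<longleftrightarrow> ?a [^] int p \<otimes> ?b [^] (1 - int p) = \<one> \<and>
    (if p = 2 then ?b = \<one> else (?b \<otimes> ?a [^] s) \<otimes> (inv ?b \<otimes> ?a [^] (1 - s)) = \<one>) \<and>
    (?x \<otimes> (?a \<otimes> (?x \<otimes> inv ?a))) [^] (2::nat) = \<one>"
    using g by (simp add: two_gens_relators_def rel_order_def rel_act_def rel_square_def
        int_pow_minus_one three two x del: One_nat_def)
  show ?thesis
  proof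
    assume ?L
    note * = this[unfolded L]
    have "?a [^] p = \<one> \<and> ?b [^] (p - 1) = \<one> \<and> ?b \<otimes> ?a = ?a [^] r \<otimes> ?b"
      using * g agl_relations_of_relators[OF exps, of ?a ?b] by (simp del: One_nat_def)
    moreover have "?x [^] (3::nat) = ?b [^] (p - 1)"
      using g by (simp add: nat_pow_pow mult.commute)
    moreover have "?b \<otimes> ?x = ?x \<otimes> ?b"
      using g by (simp add: nat_pow_mult add.commute)
    ultimately show ?R
      using * g unfolding agl_relations_def by auto
  next
    assume R: ?R
    then have "(?x \<otimes> (?a \<otimes> (?x \<otimes> inv ?a))) [^] (2::nat) = \<one>"
      unfolding agl_relations_def by blast
    then show ?L
      unfolding L using relators_of_agl_relations[OF exps, of ?a ?b ?x] R by blast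
  qed
qed

lemma (in group) eval_two_gens_sym:
  assumes exps: "agl_exponents p r s" and g: "g 0 \<in> carrier G" "g 1 \<in> carrier G"
  shows "(\<forall>e\<in>set (two_gens_sym_relators p s). eval_expr G g e = \<one>) \<longleftrightarrow>
    agl_relations G p r (g 0) (g 1 [^] (3::nat)) (g 1 [^] (p - 1)) \<and>
    sym_relation G p (g 0) (g 1 [^] (3::nat)) (g 1 [^] (p - 1))"
proof -
  have p: "p \<ge> 2" using exps by (simp add: agl_exponents_def prime_ge_2_nat)
  have "eval_expr G g (Power (Gen 1) 3) = g 1 [^] (3::nat)"
    using int_pow_int[of G _ 3] by simp
  moreover have "eval_expr G g (Power (Gen 1) (int p - 1)) = g 1 [^] (p - 1)"
    using p int_pow_int[of G _ "p - 1"] by (simp add: of_nat_diff)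
  ultimately show ?thesis
    using eval_two_gens[OF assms] eval_rel_sym[of g "Gen 0" "g 0"] g
    by (auto simp add: two_gens_sym_relators_def simp del: One_nat_def)
qed

lemma three_gens_presentation:
  fixes G (structure)
  assumes G: "group G" "finite (carrier G)" "card (carrier G) = fact (p + 2)"
    and exps: "agl_exponents p r s" and rels: "agl_relations G p r a b x" "sym_relation G p a b x"
    and gens: "generate G {a, b, x} = carrier G"
  shows "is_presentation G {0, 1, 2} (three_gens_relators p s)"
proof (rule is_presentationI[OF G(1,2)])
  interpret group G by fact
  define f where "f = (\<lambda>i::nat. if i = 0 then a else if i = 1 then b else x)"
  have f: "f 0 = a" "f 1 = b" "f 2 = x" by (simp_all add: f_def)
  then have img: "f ` {0, 1, 2} = {a, b, x}" by auto
  have abx: "a \<in> carrier G" "b \<in> carrier G" "x \<in> carrier G"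
    using rels by (auto simp: agl_relations_def)
  show "f ` {0, 1, 2} \<subseteq> carrier G" "generate G (f ` {0, 1, 2}) = carrier G"
    unfolding img using abx gens by auto
  show "set_word_expr e \<subseteq> {0, 1, 2}" if "e \<in> set (three_gens_relators p s)" for e
    using that by (auto simp: three_gens_relators_def rel_defs split: if_splits)
  show "eval_expr G f e = \<one>" if "e \<in> set (three_gens_relators p s)" for e
    using that eval_three_gens[OF exps, of f] abx rels f by simp
  show "finite (carrier P) \<and> card (carrier P) \<le> card (carrier G)"
    if "group P" "g ` {0, 1, 2} \<subseteq> carrier P" "generate P (g ` {0, 1, 2}) = carrier P"
      "\<And>e. e \<in> set (three_gens_relators p s) \<Longrightarrow> eval_expr P g e = \<one>\<^bsub>P\<^esub>"
    for P :: "nat letter list set monoid" and g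
    unfolding G(3)
    using group.card_le_sym_relation[OF that(1), of p r "g 0" "g 1" "g 2"]
      group.eval_three_gens[OF that(1) exps, of g] that exps
    by (simp add: agl_exponents_def)
qed simp

lemma (in group) generate_nat_pow: "g \<in> generate G S \<Longrightarrow> g [^] (n::nat) \<in> generate G S"
  by (induction n) (auto intro: generate.one generate.eng)

text \<open>Since \<open>p - 1 = 3 * k + 1\<close>, the element \<open>c\<close> is recovered as
  \<open>c^(p-1)\<close> times the inverse of \<open>(c^3)^k\<close>.\<close>

lemma two_gens_coprime:
  fixes G (structure)
  assumes "group G" "p = 3 * k + (2::nat)" "a \<in> carrier G" "c \<in> carrier G" "generate G {a, c} = carrier G"
  shows "generate G {a, c [^] (3::nat), c [^] (p - 1)} = carrier G"
proof -
  interpret group G by fact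
  let ?S = "generate G {a, c [^] (3::nat), c [^] (p - 1)}"
  have S: "subgroup ?S G" using assms(3,4) by (intro generate_is_subgroup) auto
  have "p - 1 = Suc (3 * k)" using assms(2) by simp
  then have "c [^] (p - 1) = c \<otimes> (c [^] (3::nat)) [^] k"
    using assms(4) by (simp only: nat_pow_pow nat_pow_Suc2)
  then have "c = c [^] (p - 1) \<otimes> inv ((c [^] (3::nat)) [^] k)"
    using assms(4) by (simp add: m_assoc)
  moreover have "(c [^] (3::nat)) [^] k \<in> ?S"
    by (intro generate_nat_pow generate.incl) simp
  moreover have "c [^] (p - 1) \<in> ?S" by (rule generate.incl) simp
  ultimately have "c \<in> ?S"
    using subgroup.m_closed[OF S] subgroup.m_inv_closed[OF S] by metis
  then have "generate G {a, c} \<subseteq> ?S"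
    by (intro generate_subgroup_incl S) (auto intro: generate.incl)
  then show ?thesis using assms(5) subgroup.subset[OF S] by auto
qed

text \<open>The root is \<open>c = x b^(-k)\<close>. From \<open>b^(3k+1) = 1\<close> and
  \<open>x^3 = 1\<close> one gets \<open>c^3 = b^(-3k) = b\<close>, and
  \<open>c^(p-1) = x^(3k+1) = x\<close> because \<open>b^(p-1)\<close> is trivial.\<close>

lemma two_gens_root:
  fixes G (structure)
  assumes "group G" and p: "p = 3 * k + 2" and rels: "agl_relations G p r a b x"
    and gens: "generate G {a, b, x} = carrier G"
  obtains c where "c \<in> carrier G" "c [^] (3::nat) = b" "c [^] (p - 1) = x" "generate G {a, c} = carrier G"
proof -
  interpret group G by fact
  have [simp]: "a \<in> carrier G" "b \<in> carrier G" "x \<in> carrier G"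
    and bp: "b [^] (p - 1) = \<one>" and bx: "b \<otimes> x = x \<otimes> b" and x3: "x [^] (3::nat) = \<one>"
    using rels by (auto simp: agl_relations_def)
  define d where "d = inv (b [^] k)"
  define c where "c = x \<otimes> d"
  have [simp]: "d \<in> carrier G" "c \<in> carrier G" by (simp_all add: c_def d_def)
  have "x \<otimes> b [^] k = b [^] k \<otimes> x"
    using bx by (induction k) (auto simp: m_assoc, auto simp: m_assoc[symmetric])
  then have comm: "x \<otimes> d = d \<otimes> x"
    unfolding d_def by (metis \<open>b \<in> carrier G\<close> \<open>x \<in> carrier G\<close> inv_solve_left' inv_solve_right' m_assoc
        inv_closed nat_pow_closed m_closed)
  have pow: "c [^] n = x [^] n \<otimes> d [^] n" for n :: nat
    unfolding c_def by (rule pow_mult_distrib) (simp_all add: comm)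
  have "d [^] (3::nat) = b"
  proof -
    have "(b [^] k) [^] (3::nat) \<otimes> b = b [^] (p - 1)"
      by (simp add: p nat_pow_pow mult.commute)
    also have "\<dots> = \<one>" by (rule bp)
    finally have "b = inv ((b [^] k) [^] (3::nat))"
      by (metis \<open>b \<in> carrier G\<close> inv_closed inv_equality inv_inv nat_pow_closed)
    then show ?thesis by (simp add: d_def nat_pow_inv)
  qed
  then have c3: "c [^] (3::nat) = b" using pow[of 3] x3 by simp
  have "d [^] (p - 1) = \<one>"
  proof -
    have "(b [^] k) [^] (p - 1) = (b [^] (p - 1)) [^] k" by (simp only: nat_pow_pow mult.commute \<open>b \<in> carrier G\<close>)
    then have "(b [^] k) [^] (p - 1) = \<one>" unfolding bp by simp
    then show ?thesis by (simp add: d_def nat_pow_inv)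
  qed
  moreover have "x [^] (p - 1) = x [^] (1::nat)"
    by (rule nat_pow_cong[OF _ x3]) (simp_all add: p cong_def)
  ultimately have cp: "c [^] (p - 1) = x" using pow[of "p - 1"] by simp
  have S: "subgroup (generate G {a, c}) G" by (intro generate_is_subgroup) auto
  have "c [^] n \<in> generate G {a, c}" for n :: nat
    by (intro generate_nat_pow generate.incl) simp
  then have "b \<in> generate G {a, c}" "x \<in> generate G {a, c}" using c3 cp by metis+
  then have "generate G {a, b, x} \<subseteq> generate G {a, c}"
    by (intro generate_subgroup_incl S) (auto intro: generate.incl)
  then have "generate G {a, c} = carrier G" using gens subgroup.subset[OF S] by auto
  then show thesis by (rule that[OF \<open>c \<in> carrier G\<close> c3 cp])
qed

text \<open>Twice the order of the presented group is at most
  \<open>fact (p + 2) * (p * (p - 1))\<close> by \<open>card_le_subdirect\<close>. The factor 2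
  corresponds to the index of the subdirect product in the full product.\<close>

lemma two_gens_presentation:
  fixes G (structure)
  assumes G: "group G" "finite (carrier G)" "fact (p + 2) * (p * (p - 1)) \<le> 2 * card (carrier G)"
    and exps: "agl_exponents p r s" and p: "p = 3 * k + 2" and rels: "agl_relations G p r a b x"
    and gens: "generate G {a, b, x} = carrier G"
  shows "is_presentation G {0, 1} (two_gens_relators p s)"
proof -
  interpret group G by fact
  obtain c where c: "c \<in> carrier G" "c [^] (3::nat) = b" "c [^] (p - 1) = x" "generate G {a, c} = carrier G"
    using two_gens_root[OF G(1) p rels gens] .
  have a: "a \<in> carrier G" using rels by (simp add: agl_relations_def)
  define f where "f = (\<lambda>i::nat. if i = 0 then a else c)"
  have f: "f 0 = a" "f 1 = c" by (simp_all add: f_def)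
  then have img: "f ` {0, 1} = {a, c}" by auto
  show ?thesis
  proof (rule is_presentationI[OF G(1,2)])
    show "f ` {0, 1} \<subseteq> carrier G" "generate G (f ` {0, 1}) = carrier G"
      unfolding img using a c by auto
    show "set_word_expr e \<subseteq> {0, 1}" if "e \<in> set (two_gens_relators p s)" for e
      using that by (auto simp: two_gens_relators_def rel_defs split: if_splits)
    show "eval_expr G f e = \<one>" if "e \<in> set (two_gens_relators p s)" for e
      using that eval_two_gens[OF exps, of f] a c rels f by simp
    show "finite (carrier P) \<and> card (carrier P) \<le> card (carrier G)"
      if P: "group P" "g ` {0, 1} \<subseteq> carrier P" "generate P (g ` {0, 1}) = carrier P"
        "\<And>e. e \<in> set (two_gens_relators p s) \<Longrightarrow> eval_expr P g e = \<one>\<^bsub>P\<^esub>"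
      for P :: "nat letter list set monoid" and g
    proof -
      interpret P: agl_extension P p r "g 0" "g 1 [^]\<^bsub>P\<^esub> (3::nat)" "g 1 [^]\<^bsub>P\<^esub> (p - 1)"
      proof (intro agl_extension.intro agl_extension_axioms.intro P(1))
        show "agl_relations P p r (g 0) (g 1 [^]\<^bsub>P\<^esub> (3::nat)) (g 1 [^]\<^bsub>P\<^esub> (p - 1))"
          using group.eval_two_gens[OF P(1) exps, of g] P by simp
        show "generate P {g 0, g 1 [^]\<^bsub>P\<^esub> (3::nat), g 1 [^]\<^bsub>P\<^esub> (p - 1)} = carrier P"
          using two_gens_coprime[OF P(1) p, of "g 0" "g 1"] P by simp
      qed (use exps in \<open>auto simp: agl_exponents_def\<close>)
      show ?thesis using P.card_le_subdirect G(3) by simp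
    qed
  qed simp
qed

lemma two_gens_sym_presentation:
  fixes G (structure)
  assumes G: "group G" "finite (carrier G)" "card (carrier G) = fact (p + 2)"
    and exps: "agl_exponents p r s" and p: "p = 3 * k + 2"
    and rels: "agl_relations G p r a b x" "sym_relation G p a b x"
    and gens: "generate G {a, b, x} = carrier G"
  shows "is_presentation G {0, 1} (two_gens_sym_relators p s)"
proof -
  interpret group G by fact
  obtain c where c: "c \<in> carrier G" "c [^] (3::nat) = b" "c [^] (p - 1) = x" "generate G {a, c} = carrier G"
    using two_gens_root[OF G(1) p rels(1) gens] .
  have a: "a \<in> carrier G" using rels by (simp add: agl_relations_def)
  define f where "f = (\<lambda>i::nat. if i = 0 then a else c)"
  have f: "f 0 = a" "f 1 = c" by (simp_all add: f_def)
  then have img: "f ` {0, 1} = {a, c}" by auto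
  show ?thesis
  proof (rule is_presentationI[OF G(1,2)])
    show "f ` {0, 1} \<subseteq> carrier G" "generate G (f ` {0, 1}) = carrier G"
      unfolding img using a c by auto
    show "set_word_expr e \<subseteq> {0, 1}" if "e \<in> set (two_gens_sym_relators p s)" for e
      using that by (auto simp: two_gens_sym_relators_def two_gens_relators_def rel_defs split: if_splits)
    show "eval_expr G f e = \<one>" if "e \<in> set (two_gens_sym_relators p s)" for e
      using that eval_two_gens_sym[OF exps, of f] a c rels f by simp
    show "finite (carrier P) \<and> card (carrier P) \<le> card (carrier G)"
      if P: "group P" "g ` {0, 1} \<subseteq> carrier P" "generate P (g ` {0, 1}) = carrier P"
        "\<And>e. e \<in> set (two_gens_sym_relators p s) \<Longrightarrow> eval_expr P g e = \<one>\<^bsub>P\<^esub>"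
      for P :: "nat letter list set monoid" and g
    proof -
      have "agl_relations P p r (g 0) (g 1 [^]\<^bsub>P\<^esub> (3::nat)) (g 1 [^]\<^bsub>P\<^esub> (p - 1)) \<and>
          sym_relation P p (g 0) (g 1 [^]\<^bsub>P\<^esub> (3::nat)) (g 1 [^]\<^bsub>P\<^esub> (p - 1))"
        using group.eval_two_gens_sym[OF P(1) exps, of g] P by simp
      moreover have "generate P {g 0, g 1 [^]\<^bsub>P\<^esub> (3::nat), g 1 [^]\<^bsub>P\<^esub> (p - 1)} = carrier P"
        using two_gens_coprime[OF P(1) p, of "g 0" "g 1"] P by simp
      ultimately show ?thesis
        unfolding G(3)
        by (intro group.card_le_sym_relation[OF P(1), of p r "g 0" "g 1 [^]\<^bsub>P\<^esub> (3::nat)" "g 1 [^]\<^bsub>P\<^esub> (p - 1)"])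
           (use exps in \<open>auto simp only: agl_exponents_def\<close>)
    qed
  qed simp
qed

subsection \<open>Bit-length\<close>

text \<open>For \<open>p > 2\<close> a primitive root \<open>r\<close> is not 1, so
  \<open>r - 1\<close> has an inverse modulo \<open>p\<close>; \<open>s\<close> is minus this
  inverse, reduced to the interval from 0 to \<open>p - 1\<close>.\<close>

lemma agl_exponents_exist:
  assumes "prime p"
  obtains r s where "agl_exponents p r s"
proof -
  have p2: "p \<ge> 2" using assms by (rule prime_ge_2_nat)
  obtain r where r: "r \<in> {1..p - 1}" "{1..p - 1} = {r ^ i mod p | i. i \<in> UNIV}"
    using residue_prime_mult_group_has_gen[OF assms] by blast
  have gen: "generates_units p r"
    unfolding generates_units_def
  proof (intro conjI allI impI)
    fix j assume "0 < j \<and> j < p"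
    then have "j \<in> {1..p - 1}" by auto
    then show "\<exists>k. r ^ k mod p = j" unfolding r(2) by blast
  qed (use r(1) p2 in auto)
  show thesis
  proof (cases "p = 2")
    case True
    then have "agl_exponents p r 0" using assms gen by (simp add: agl_exponents_def)
    then show thesis by (rule that)
  next
    case False
    have "r \<noteq> 1"
    proof
      assume "r = 1"
      then have "{1..p - 1} \<subseteq> {1}" using r(2) p2 by auto
      moreover have "2 \<in> {1..p - 1}" using False p2 by auto
      ultimately have "2 \<in> {1::nat}" by blast
      then show False by simp
    qed
    then have "0 < r - 1" "r - 1 < p" using r(1) by auto
    then have "\<not> p dvd r - 1" by (auto dest: dvd_imp_le)
    then have "coprime (int (r - 1)) (int p)"
      using assms by (simp add: prime_imp_coprime coprime_commute)
    then obtain m where m: "[int (r - 1) * m = 1] (mod int p)" using cong_solve_coprime_int by blast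
    define s where "s = (- m) mod int p"
    have "[s * int r = (- m) * int r] (mod int p)"
      unfolding s_def by (intro cong_mult) (simp_all add: cong_def)
    also have "(- m) * int r = - m - int (r - 1) * m"
      using r(1) by (simp add: of_nat_diff algebra_simps)
    also have "[- m - int (r - 1) * m = - m - 1] (mod int p)"
      by (intro cong_diff m cong_refl)
    also have "[- m - 1 = s - 1] (mod int p)"
      unfolding s_def by (intro cong_diff) (simp_all add: cong_def)
    finally have "agl_exponents p r s"
      using assms gen p2 by (simp add: agl_exponents_def s_def)
    then show thesis by (rule that)
  qed
qed

lemma bl_nonneg: "bl e \<ge> 0"
proof (induction e)
  case (Power e m)
  have "0 \<le> log 2 (real_of_int (max 2 \<bar>m\<bar>))" by simp
  then show ?case using Power by simp
qed auto

text \<open>A crude bound for every exponent that occurs: \<open>p \<ge> 2\<close> gives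
  \<open>4 p \<le> p^3\<close>. The factor 4 leaves room for \<open>p + 1\<close> and for the
  constants 2, 3 and 5.\<close>

lemma log_exponent_le:
  assumes "p \<ge> 2" "\<bar>m\<bar> \<le> 4 * int p"
  shows "log 2 (real_of_int (max 2 \<bar>m\<bar>)) \<le> 3 * log 2 (real p)"
proof -
  have "4 * p \<le> p * p * p"
    using mult_le_mono[OF mult_le_mono[OF assms(1) assms(1)] order_refl[of p]] by simp
  then have "int (4 * p) \<le> int (p * p * p)" by (simp only: of_nat_le_iff)
  then have "4 * int p \<le> int p ^ 3" by (simp add: power3_eq_cube)
  then have "max 2 \<bar>m\<bar> \<le> int p ^ 3" using assms by linarith
  then have "real_of_int (max 2 \<bar>m\<bar>) \<le> real_of_int (int p ^ 3)" by (simp only: of_int_le_iff)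
  then have "log 2 (real_of_int (max 2 \<bar>m\<bar>)) \<le> log 2 (real p ^ 3)"
    by (intro log_mono) (auto simp: less_max_iff_disj)
  then show ?thesis using assms(1) by (simp add: log_nat_power)
qed

lemma bl_Power_le:
  "p \<ge> 2 \<Longrightarrow> \<bar>m\<bar> \<le> 4 * int p \<Longrightarrow> bl (Power e m) \<le> bl e + 3 * log 2 (real p)"
  using log_exponent_le by simp

text \<open>Each power costs at most \<open>3 * log 2 p\<close>, so the last summand counts the two
  or three powers in the general form of the relator. The special forms for \<open>p = 2\<close> and
  \<open>p = 3\<close> stay below the same bounds.\<close>

lemma bl_relators_le:
  fixes A B X :: "'a word_expr"
  assumes p: "p \<ge> 2" and s: "0 \<le> s" "s < int p"
  shows "bl (rel_order p A B) \<le> bl A + bl B + 6 * log 2 (real p)"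
    and "bl (rel_act p s A B) \<le> 2 * bl A + 2 * bl B + 9 * log 2 (real p)"
    and "bl (rel_comm B X) \<le> 2 * bl B + 2 * bl X + 6 * log 2 (real p)"
    and "bl (rel_square A X) \<le> 2 * bl A + 2 * bl X + 6 * log 2 (real p)"
    and "bl (rel_sym p A B X) \<le> 2 * bl A + bl B + bl X + 6 * log 2 (real p)"
proof -
  have L: "0 \<le> log 2 (real p)" using p by simp
  note P = bl_Power_le[OF p]
  have inv: "bl (Power e (-1)) \<le> bl e + 3 * log 2 (real p)" for e :: "'a word_expr"
    by (rule P) (use p in linarith)
  have order: "bl (Power e (int p)) \<le> bl e + 3 * log 2 (real p)"
    "bl (Power e (1 - int p)) \<le> bl e + 3 * log 2 (real p)" for e :: "'a word_expr"
    by (rule P, use p in linarith)+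
  have act: "bl (Power e s) \<le> bl e + 3 * log 2 (real p)"
    "bl (Power e (1 - s)) \<le> bl e + 3 * log 2 (real p)" for e :: "'a word_expr"
    by (rule P, use p s in linarith)+
  have square: "bl (Power e 2) \<le> bl e + 3 * log 2 (real p)" for e :: "'a word_expr"
    by (rule P) (use p in linarith)
  note simps = bl.simps(2)
  have [simp]: "bl A \<ge> 0" "bl B \<ge> 0" "bl X \<ge> 0" by (rule bl_nonneg)+
  show "bl (rel_order p A B) \<le> bl A + bl B + 6 * log 2 (real p)"
    using order(1)[of A] order(2)[of B] unfolding rel_order_def simps by linarith
  show "bl (rel_act p s A B) \<le> 2 * bl A + 2 * bl B + 9 * log 2 (real p)"
  proof (cases "p = 2")
    case True
    then show ?thesis using L by (simp add: rel_act_def)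
  next
    case False
    then have "rel_act p s A B = Mul (Mul B (Power A s)) (Mul (Power B (-1)) (Power A (1 - s)))"
      by (simp add: rel_act_def)
    then have "bl (rel_act p s A B) = (bl B + bl (Power A s)) + (bl (Power B (-1)) + bl (Power A (1 - s)))"
      by (simp only: simps)
    then show ?thesis using act(1)[of A] act(2)[of A] inv[of B] by linarith
  qed
  show "bl (rel_comm B X) \<le> 2 * bl B + 2 * bl X + 6 * log 2 (real p)"
    using inv[of B] inv[of X] unfolding rel_comm_def simps by linarith
  show "bl (rel_square A X) \<le> 2 * bl A + 2 * bl X + 6 * log 2 (real p)"
    using inv[of A] square[of "Mul X (Mul A (Mul X (Power A (-1))))"]
    unfolding rel_square_def simps by linarith
  consider "p = 2" | "p = 3" | "p \<noteq> 2" "p \<noteq> 3" by blast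
  then show "bl (rel_sym p A B X) \<le> 2 * bl A + bl B + bl X + 6 * log 2 (real p)"
  proof cases
    case 1
    then show ?thesis using L by (simp add: rel_sym_def)
  next
    case 2
    have "bl (rel_sym p A B X) = bl (Power (Mul X A) 5)" using 2 by (simp add: rel_sym_def)
    also have "\<dots> \<le> bl (Mul X A) + 3 * log 2 (real p)" using 2 by (intro P) simp
    also have "\<dots> \<le> 2 * bl A + bl B + bl X + 6 * log 2 (real p)" using L by (simp add: add_increasing)
    finally show ?thesis .
  next
    case 3
    have "bl (rel_sym p A B X) = bl (Power (Mul (Mul A (Mul X (Power A (-1)))) B) (int p + 1))"
      using 3 by (simp add: rel_sym_def)
    also have "\<dots> \<le> bl (Mul (Mul A (Mul X (Power A (-1)))) B) + 3 * log 2 (real p)"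
      using p by (intro P) simp
    also have "\<dots> \<le> 2 * bl A + bl B + bl X + 6 * log 2 (real p)"
      using inv[of A] unfolding simps by linarith
    finally show ?thesis .
  qed
qed

text \<open>With \<open>L = log 2 p\<close> the estimates add up to \<open>28 + 36 L\<close>,
  \<open>15 + 36 L\<close> and \<open>20 + 48 L\<close>. As \<open>L \<ge> 1\<close>, the last and
  largest gives the constant 68.\<close>

lemma bit_length_le:
  assumes "agl_exponents p r s"
  shows "bit_length {0, 1, 2 :: nat} (three_gens_relators p s) \<le> 68 * log 2 (real p)"
    and "bit_length {0, 1 :: nat} (two_gens_relators p s) \<le> 68 * log 2 (real p)"
    and "bit_length {0, 1 :: nat} (two_gens_sym_relators p s) \<le> 68 * log 2 (real p)"
proof -
  have p: "p \<ge> 2" and s: "0 \<le> s" "s < int p"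
    using assms by (auto simp: agl_exponents_def prime_ge_2_nat)
  have L: "1 \<le> log 2 (real p)" using p by (simp add: le_log_iff)
  note R = bl_relators_le[OF p s]
  let ?A = "Gen 0 :: nat word_expr" and ?B = "Gen 1 :: nat word_expr" and ?X = "Gen 2 :: nat word_expr"
  let ?B' = "Power (Gen 1) 3 :: nat word_expr" and ?X' = "Power (Gen 1) (int p - 1) :: nat word_expr"
  have gen: "bl ?A = 1" "bl ?B = 1" "bl ?X = 1" by simp_all
  have gen': "bl ?B' \<le> 1 + 3 * log 2 (real p)" "bl ?X' \<le> 1 + 3 * log 2 (real p)"
    using bl_Power_le[OF p, of 3 ?B] bl_Power_le[OF p, of "int p - 1" ?B] p by simp_all
  have X3: "bl (Power ?X 3) \<le> 1 + 3 * log 2 (real p)"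
    using bl_Power_le[OF p, of 3 ?X] p by simp
  have "bit_length {0, 1, 2 :: nat} (three_gens_relators p s) = 9 + (bl (rel_order p ?A ?B) +
      bl (rel_act p s ?A ?B) + bl (rel_comm ?B ?X) + bl (Power ?X 3) + bl (rel_square ?A ?X) +
      bl (rel_sym p ?A ?B ?X))"
    by (simp add: bit_length_def three_gens_relators_def)
  then show "bit_length {0, 1, 2 :: nat} (three_gens_relators p s) \<le> 68 * log 2 (real p)"
    using R(1)[of ?A ?B] R(2)[of ?A ?B] R(3)[of ?B ?X] R(4)[of ?A ?X] R(5)[of ?A ?B ?X] X3 L gen
    by linarith
  have "bit_length {0, 1 :: nat} (two_gens_relators p s) = 5 + (bl (rel_order p ?A ?B') +
      bl (rel_act p s ?A ?B') + bl (rel_square ?A ?X'))"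
    by (simp add: bit_length_def two_gens_relators_def del: bl.simps)
  then show two: "bit_length {0, 1 :: nat} (two_gens_relators p s) \<le> 68 * log 2 (real p)"
    using R(1)[of ?A ?B'] R(2)[of ?A ?B'] R(4)[of ?A ?X'] L gen gen' by linarith
  have "bit_length {0, 1 :: nat} (two_gens_sym_relators p s) = 6 + (bl (rel_order p ?A ?B') +
      bl (rel_act p s ?A ?B') + bl (rel_square ?A ?X') + bl (rel_sym p ?A ?B' ?X'))"
    by (simp add: bit_length_def two_gens_sym_relators_def two_gens_relators_def del: bl.simps)
  then show "bit_length {0, 1 :: nat} (two_gens_sym_relators p s) \<le> 68 * log 2 (real p)"
    using R(1)[of ?A ?B'] R(2)[of ?A ?B'] R(4)[of ?A ?X'] R(5)[of ?A ?B' ?X'] L gen gen' by linarith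
qed

subsection \<open>Permutations\<close>

text \<open>Serves to recognise the permutations induced by \<open>a\<close> and \<open>b\<close> as
  cycles, from which their parities and their products with 3-cycles can be read off.\<close>

lemma cycle_of_list_eqI:
  assumes "distinct cs" "\<And>i. i < length cs \<Longrightarrow> f (cs ! i) = cs ! (Suc i mod length cs)"
    and "\<And>k. k \<notin> set cs \<Longrightarrow> f k = k"
  shows "f = cycle_of_list cs"
proof
  fix k
  show "f k = cycle_of_list cs k"
  proof (cases "k \<in> set cs")
    case True
    then obtain i where i: "i < length cs" "k = cs ! i" by (metis in_set_conv_nth)
    have "cycle_of_list cs (cs ! i) = map (cycle_of_list cs ^^ 1) cs ! i" using i by simp
    also have "\<dots> = rotate 1 cs ! i" by (simp only: cyclic_rotation[OF assms(1)])
    also have "\<dots> = cs ! (Suc i mod length cs)" using i by (simp add: nth_rotate del: rotate_Suc)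
    finally show ?thesis using i assms(2) by simp
  next
    case False
    then show ?thesis using assms(3) id_outside_supp[OF False] by simp
  qed
qed

lemma evenperm_cycle_of_list: "distinct cs \<Longrightarrow> cs \<noteq> [] \<Longrightarrow> evenperm (cycle_of_list cs) \<longleftrightarrow> odd (length cs)"
proof (induction cs rule: cycle_of_list.induct)
  case (1 i j cs)
  have "evenperm (cycle_of_list (i # j # cs)) \<longleftrightarrow>
      evenperm (transpose i j) = evenperm (cycle_of_list (j # cs))"
    unfolding cycle_of_list.simps
    by (rule evenperm_comp) (simp_all only: permutation_swap_id permutation_of_cycle)
  then show ?case
    using 1 by (auto simp: evenperm_swap simp del: cycle_of_list.simps)
qed simp_all

text \<open>The product of the two 3-cycles is (u i)(v j), an involution; this is Carmichael's
  relation in the symmetric group.\<close>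

lemma double_transposition:
  assumes "distinct [u, v, i, j]"
  shows "(cycle_of_list [u, v, i] \<circ> cycle_of_list [u, v, j]) \<circ>
    (cycle_of_list [u, v, i] \<circ> cycle_of_list [u, v, j]) = id"
proof
  fix k
  consider "k = u" | "k = v" | "k = i" | "k = j" | "k \<notin> {u, v, i, j}" by blast
  then show "((cycle_of_list [u, v, i] \<circ> cycle_of_list [u, v, j]) \<circ>
    (cycle_of_list [u, v, i] \<circ> cycle_of_list [u, v, j])) k = id k"
    by cases (use assms in \<open>auto simp: transpose_def\<close>)
qed

lemma nat_pow_sym_group: "f [^]\<^bsub>sym_group n\<^esub> (k::nat) = f ^^ k"
proof (induction k)
  case (Suc k)
  have "f [^]\<^bsub>sym_group n\<^esub> Suc k = f [^]\<^bsub>sym_group n\<^esub> k \<circ> f"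
    by (simp add: sym_group_mult)
  then show ?case unfolding Suc by (simp only: funpow_Suc_right)
qed (simp add: sym_group_one)

text \<open>The 3-cycles in \<open>J\<close> are closed under rotation of the notation, inversion
  and conjugation by elements of \<open>J\<close>. Starting from the given ones this yields all
  3-cycles, and these generate the alternating group.\<close>

lemma alt_group_subset_if_three_cycles:
  assumes J: "subgroup J (sym_group (n + 2))"
    and c: "\<And>i. i \<in> {1..n} \<Longrightarrow> cycle_of_list [n + 2, n + 1, i] \<in> J"
  shows "carrier (alt_group (n + 2)) \<subseteq> J"
proof -
  define F where "F u v w \<longleftrightarrow> cycle_of_list [u, v, w] \<in> J" for u v w
  have perm: "g permutes {1..n + 2}" if "g \<in> J" for g
    using subgroup.subset[OF J] that by (auto simp: sym_group_carrier)
  have comp: "g \<circ> h \<in> J" if "g \<in> J" "h \<in> J" for g h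
    using subgroup.m_closed[OF J that] by (simp add: sym_group_mult)
  have inv: "inv' g \<in> J" if "g \<in> J" for g
    using subgroup.m_inv_closed[OF J that] sym_group_inv_equality[of g "n + 2"] perm[OF that]
    by (simp add: sym_group_carrier)
  have rot: "F v w u" if "F u v w" "distinct [u, v, w]" for u v w
    using that cycle_of_list_rotate_independent[of "[u, v, w]" 1] by (simp add: F_def)
  have rev: "F w v u" if "F u v w" "distinct [u, v, w]" for u v w
  proof -
    have "inv' (cycle_of_list [u, v, w]) = cycle_of_list [w, v, u]"
      using that(2) by (intro inv_unique_comp) (auto simp: fun_eq_iff transpose_def)
    then show ?thesis using inv that(1) by (metis F_def)
  qed
  have conj: "F (g u) (g v) (g w)" if "F u v w" "distinct [u, v, w]" "g \<in> J" for g u v w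
  proof -
    have "g \<circ> cycle_of_list [u, v, w] \<circ> inv' g = cycle_of_list (map g [u, v, w])"
      by (rule conjugation_of_cycle) (use that(2) perm[OF that(3)] permutes_bij in auto)
    moreover have "g \<circ> cycle_of_list [u, v, w] \<circ> inv' g \<in> J"
      using comp[OF comp[OF that(3) that(1)[unfolded F_def]] inv[OF that(3)]] .
    ultimately show ?thesis by (simp only: F_def list.map)
  qed
  define P where "P = n + 2"
  define Q where "Q = n + 1"
  have base: "F P Q i" if "i \<in> {1..n}" for i
    using c[OF that] by (simp add: F_def P_def Q_def)
  have new: "P \<noteq> i" "Q \<noteq> i" "P \<noteq> Q" if "i \<in> {1..n}" for i
    using that by (auto simp: P_def Q_def)
  have act: "cycle_of_list [P, Q, i] P = Q" "cycle_of_list [P, Q, i] Q = i" "cycle_of_list [P, Q, i] i = P"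
    "k \<notin> {P, Q, i} \<Longrightarrow> cycle_of_list [P, Q, i] k = k" if "i \<in> {1..n}" for i k
    using new[OF that] by (auto simp: transpose_def)
  have fixes_other: "cycle_of_list [P, Q, i] j = j" if "i \<in> {1..n}" "j \<in> {1..n}" "i \<noteq> j" for i j
    by (rule act(4)[OF that(1)]) (use new[OF that(2)] that(3) in auto)
  \<comment> \<open>The conjugating element (P Q i) moves P to Q, Q to i and i to P. It takes (P Q
    j) to (Q i j), that cycle to (i P j), and (Q j k) to (i j k), which gives \<open>baseQ\<close>,
    \<open>baseP\<close> and \<open>base0\<close>.\<close>
  have baseQ: "F Q i j" if "i \<in> {1..n}" "j \<in> {1..n}" "i \<noteq> j" for i j
    using conj[OF base[OF that(2)] _ base[OF that(1), unfolded F_def]] new[OF that(2)]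
    by (simp only: act(1,2)[OF that(1)] fixes_other[OF that]) simp
  have baseP: "F P i j" if "i \<in> {1..n}" "j \<in> {1..n}" "i \<noteq> j" for i j
  proof -
    have "F i P j"
      using conj[OF baseQ[OF that] _ base[OF that(1), unfolded F_def]] new[OF that(1)] new[OF that(2)] that(3)
      by (simp only: act(2,3)[OF that(1)] fixes_other[OF that]) simp
    then show ?thesis using rev[of i P j] rot[of j P i] new[OF that(1)] new[OF that(2)] that(3) by simp
  qed
  have base0: "F i j k" if "i \<in> {1..n}" "j \<in> {1..n}" "k \<in> {1..n}" "distinct [i, j, k]" for i j k
    using conj[OF baseQ[OF that(2,3)] _ base[OF that(1), unfolded F_def]] new[OF that(2)] new[OF that(3)] that(4)
      fixes_other[OF that(1,2)] fixes_other[OF that(1,3)] act(2)[OF that(1)]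
    by (simp del: cycle_of_list.simps)
  have cases: "k = P \<or> k = Q \<or> k \<in> {1..n}" if "k \<in> {1..n + 2}" for k
    using that by (auto simp: P_def Q_def)
  have rot2: "F w u v" if "F u v w" "distinct [u, v, w]" for u v w
    using rot[OF rot[OF that]] that(2) by auto
  have FP: "F P v w" if vw: "distinct [P, v, w]" "v = Q \<or> v \<in> {1..n}" "w = Q \<or> w \<in> {1..n}" for v w
  proof -
    consider "v = Q" "w \<in> {1..n}" | "w = Q" "v \<in> {1..n}" | "v \<in> {1..n}" "w \<in> {1..n}"
      using vw by auto
    then show ?thesis
    proof cases
      case 2
      have "distinct [P, Q, v]" using vw(1) 2 by auto
      then have "F v Q P" using rev[OF base[OF 2(2)]] by simp
      then show ?thesis using rot2[of v Q P] vw(1) 2 by auto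
    qed (use vw(1) base baseP in auto)
  qed
  have FQ: "F Q v w" if vw: "distinct [Q, v, w]" "v = P \<or> v \<in> {1..n}" "w = P \<or> w \<in> {1..n}" for v w
  proof -
    consider "v = P" "w \<in> {1..n}" | "w = P" "v \<in> {1..n}" | "v \<in> {1..n}" "w \<in> {1..n}"
      using vw by auto
    then show ?thesis
    proof cases
      case 1
      have "F P w Q" by (rule FP) (use vw(1) 1 in auto)
      then show ?thesis using rot2[of P w Q] vw(1) 1 by auto
    next
      case 2
      have "F P Q v" by (rule FP) (use vw(1) 2 in auto)
      then show ?thesis using rot[of P Q v] vw(1) 2 by auto
    qed (use vw(1) baseQ in auto)
  qed
  have F: "F u v w" if "distinct [u, v, w]" "u \<in> {1..n + 2}" "v \<in> {1..n + 2}" "w \<in> {1..n + 2}" for u v w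
  proof -
    note uvw = cases[OF that(2)] cases[OF that(3)] cases[OF that(4)] that(1)
    \<comment> \<open>A rotation brings \<open>P\<close>, or in its absence \<open>Q\<close>, to the
      front of the cycle.\<close>
    consider "u = P" | "v = P" | "w = P" | "P \<notin> {u, v, w}" "u = Q" | "P \<notin> {u, v, w}" "v = Q"
      | "P \<notin> {u, v, w}" "w = Q" | "P \<notin> {u, v, w}" "Q \<notin> {u, v, w}"
      by blast
    then show ?thesis
    proof cases
      case 1
      have "F P v w" by (rule FP) (use uvw 1 in auto)
      then show ?thesis using 1 by simp
    next
      case 2
      have "F P w u" by (rule FP) (use uvw 2 in auto)
      then show ?thesis using rot2[of P w u] that(1) 2 by auto
    next
      case 3
      have "F P u v" by (rule FP) (use uvw 3 in auto)
      then show ?thesis using rot[of P u v] that(1) 3 by auto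
    next
      case 4
      have "F Q v w" by (rule FQ) (use uvw 4 in auto)
      then show ?thesis using 4 by simp
    next
      case 5
      have "F Q w u" by (rule FQ) (use uvw 5 in auto)
      then show ?thesis using rot2[of Q w u] that(1) 5 by auto
    next
      case 6
      have "F Q u v" by (rule FQ) (use uvw 6 in auto)
      then show ?thesis using rot[of Q u v] that(1) 6 by auto
    next
      case 7
      show ?thesis by (rule base0) (use uvw 7 in auto)
    qed
  qed
  have "three_cycles (n + 2) \<subseteq> J"
  proof
    fix g assume "g \<in> three_cycles (n + 2)"
    then obtain cs where cs: "g = cycle_of_list cs" "distinct cs" "length cs = 3" "set cs \<subseteq> {1..n + 2}"
      by blast
    then obtain u v w where "cs = [u, v, w]" using stupid_lemma by blast
    then show "g \<in> J" using cs F[of u v w] by (simp add: F_def)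
  qed
  then have "generate (sym_group (n + 2)) (three_cycles (n + 2)) \<subseteq> J"
    using J by (rule group.generate_subgroup_incl[OF sym_group_is_group])
  moreover have "generate (alt_group (n + 2)) (three_cycles (n + 2)) =
      generate (sym_group (n + 2)) (three_cycles (n + 2))"
    unfolding alt_group_def
    using group.generate_consistent[OF sym_group_is_group three_cycles_incl alt_group_is_subgroup]
    by (simp add: alt_group_def)
  ultimately show ?thesis by (simp add: alt_group_carrier_as_three_cycles)
qed

subsection \<open>The affine group\<close>

text \<open>Arbitrary integer coefficients keep the composition law free of reductions; the
  restriction of the domain matches the extensional maps in \<open>AGL1\<close>.\<close>

definition aff :: "nat \<Rightarrow> int \<Rightarrow> int \<Rightarrow> int \<Rightarrow> int" where
  "aff p u v = (\<lambda>x\<in>{0..<int p}. (u * x + v) mod int p)"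

lemma aff_cong:
  assumes "[u = u'] (mod int p)" "[v = v'] (mod int p)"
  shows "aff p u v = aff p u' v'"
proof -
  have "(u * x + v) mod int p = (u' * x + v') mod int p" for x
    using cong_add[OF cong_mult[OF assms(1) cong_refl[of x]] assms(2)] by (simp add: cong_def)
  then show ?thesis by (simp add: aff_def)
qed

locale prime_modulus =
  fixes p :: nat
  assumes prime: "prime p"
begin

lemma p2: "p \<ge> 2" using prime by (rule prime_ge_2_nat)

lemma aff_compose: "compose {0..<int p} (aff p u v) (aff p u' v') = aff p (u * u') (u * v' + v)"
proof
  fix x
  have "(u * ((u' * x + v') mod int p) + v) mod int p = ((u * u') * x + (u * v' + v)) mod int p"
    by (metis (no_types, opaque_lifting) add.assoc distrib_left mod_add_left_eq mod_mult_right_eq mult.assoc)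
  then show "compose {0..<int p} (aff p u v) (aff p u' v') x = aff p (u * u') (u * v' + v) x"
    using p2 by (auto simp: compose_def aff_def)
qed

lemma aff_1_0: "aff p 1 0 = (\<lambda>x\<in>{0..<int p}. x)"
  by (auto simp: aff_def)

lemma aff_inverse:
  assumes "coprime u (int p)"
  obtains u' where "coprime u' (int p)" "aff p (u' * u) (u' * v + - (u' * v)) = aff p 1 0"
    "aff p (u * u') (u * - (u' * v) + v) = aff p 1 0"
proof -
  obtain u' where u': "[u * u' = 1] (mod int p)" using assms cong_solve_coprime_int by blast
  have "coprime u' (int p)" using u' by (metis coprime_iff_invertible_int mult.commute)
  moreover have "[u * - (u' * v) + v = 0] (mod int p)"
    using cong_diff[OF cong_refl[of v] cong_mult[OF u' cong_refl[of v]]] by (simp add: algebra_simps)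
  then have "aff p (u * u') (u * - (u' * v) + v) = aff p 1 0"
    by (rule aff_cong[OF u'])
  moreover have "aff p (u' * u) (u' * v + - (u' * v)) = aff p 1 0"
    by (rule aff_cong) (use u' in \<open>simp_all add: mult.commute\<close>)
  ultimately show thesis by (intro that)
qed

lemma aff_Bij:
  assumes "coprime u (int p)"
  shows "aff p u v \<in> Bij {0..<int p}"
proof -
  obtain u' where u': "coprime u' (int p)" "aff p (u' * u) (u' * v + - (u' * v)) = aff p 1 0"
    "aff p (u * u') (u * - (u' * v) + v) = aff p 1 0"
    using aff_inverse[OF assms] .
  have img: "aff p u v ` {0..<int p} \<subseteq> {0..<int p}" for u v using p2 by (auto simp: aff_def)
  have "compose {0..<int p} (aff p u' (- (u' * v))) (aff p u v) = (\<lambda>x\<in>{0..<int p}. x)"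
    "compose {0..<int p} (aff p u v) (aff p u' (- (u' * v))) = (\<lambda>x\<in>{0..<int p}. x)"
    using u' by (simp_all only: aff_compose aff_1_0)
  then have "\<forall>x\<in>{0..<int p}. aff p u' (- (u' * v)) (aff p u v x) = x"
    "\<forall>x\<in>{0..<int p}. aff p u v (aff p u' (- (u' * v)) x) = x"
    by (metis compose_eq restrict_apply')+
  then have "bij_betw (aff p u v) {0..<int p} {0..<int p}"
    by (intro bij_betw_byWitness[of _ "aff p u' (- (u' * v))"] img)
  then show ?thesis by (simp add: Bij_def aff_def)
qed

abbreviation "T \<equiv> AGL1 (residue_ring (int p))"

lemma carrier_ring: "carrier (residue_ring (int p)) = {0..<int p}"
  by (auto simp: residue_ring_def)

text \<open>Describing the slopes as integers coprime to \<open>p\<close>, instead of nonzero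
  residues, lets products of slopes stay in the same form.\<close>

lemma carrier_T: "carrier T = {aff p u v | u v. coprime u (int p)}"
proof -
  have eq: "(\<lambda>x\<in>{0..<int p}. u \<otimes>\<^bsub>residue_ring (int p)\<^esub> x \<oplus>\<^bsub>residue_ring (int p)\<^esub> v) = aff p u v" for u v
    by (auto simp: aff_def residue_ring_def mod_simps)
  have 0: "\<zero>\<^bsub>residue_ring (int p)\<^esub> = 0" by (simp add: residue_ring_def)
  have T: "carrier T = {aff p u v | u v. u \<in> {0..<int p} - {0} \<and> v \<in> {0..<int p}}"
    by (simp add: AGL1_def carrier_ring 0 eq)
  have cop: "coprime u (int p) \<longleftrightarrow> \<not> int p dvd u" for u
    using prime by (metis coprime_commute prime_imp_coprime prime_nat_int_transfer coprime_absorb_right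
        not_prime_unit)
  show ?thesis
    unfolding T
  proof (intro subset_antisym subsetI)
    fix t assume "t \<in> {aff p u v | u v. u \<in> {0..<int p} - {0} \<and> v \<in> {0..<int p}}"
    then obtain u v where t: "t = aff p u v" "u \<in> {0..<int p} - {0}" by blast
    then have "\<not> int p dvd u" by (auto dest: zdvd_imp_le)
    then show "t \<in> {aff p u v | u v. coprime u (int p)}" using t cop by blast
  next
    fix t assume "t \<in> {aff p u v | u v. coprime u (int p)}"
    then obtain u v where t: "t = aff p u v" "coprime u (int p)" by blast
    have "t = aff p (u mod int p) (v mod int p)"
      unfolding t by (rule aff_cong) (auto simp: cong_def)
    moreover have "u mod int p \<noteq> 0" using t(2) cop by (simp add: dvd_eq_mod_eq_0)
    ultimately show "t \<in> {aff p u v | u v. u \<in> {0..<int p} - {0} \<and> v \<in> {0..<int p}}"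
      using p2 by fastforce
  qed
qed

lemma mult_BijGroup_aff:
  "coprime u (int p) \<Longrightarrow> coprime u' (int p) \<Longrightarrow>
    aff p u v \<otimes>\<^bsub>BijGroup {0..<int p}\<^esub> aff p u' v' = aff p (u * u') (u * v' + v)"
  by (simp add: BijGroup_def aff_Bij aff_compose)

lemma mult_T: "coprime u (int p) \<Longrightarrow> coprime u' (int p) \<Longrightarrow>
    aff p u v \<otimes>\<^bsub>T\<^esub> aff p u' v' = aff p (u * u') (u * v' + v)"
  using mult_BijGroup_aff by (simp add: AGL1_def carrier_ring)

lemma one_T: "\<one>\<^bsub>T\<^esub> = aff p 1 0"
  by (simp add: AGL1_def carrier_ring BijGroup_def aff_1_0)

lemma group_T: "group T"
proof (rule groupI)
  fix s t assume "s \<in> carrier T" "t \<in> carrier T"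
  then show "s \<otimes>\<^bsub>T\<^esub> t \<in> carrier T"
    by (auto simp: carrier_T mult_T) (metis coprime_mult_left_iff)
next
  fix s t w assume "s \<in> carrier T" "t \<in> carrier T" "w \<in> carrier T"
  then show "s \<otimes>\<^bsub>T\<^esub> t \<otimes>\<^bsub>T\<^esub> w = s \<otimes>\<^bsub>T\<^esub> (t \<otimes>\<^bsub>T\<^esub> w)"
    by (auto simp: carrier_T mult_T algebra_simps)
next
  fix t assume "t \<in> carrier T"
  then obtain u v where t: "t = aff p u v" "coprime u (int p)" by (auto simp: carrier_T)
  obtain u' where "coprime u' (int p)" "aff p (u' * u) (u' * v + - (u' * v)) = aff p 1 0"
    using aff_inverse[OF t(2)] by metis
  then show "\<exists>s\<in>carrier T. s \<otimes>\<^bsub>T\<^esub> t = \<one>\<^bsub>T\<^esub>"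
    using t by (intro bexI[of _ "aff p u' (- (u' * v))"]) (auto simp: mult_T one_T carrier_T)
next
  show "\<one>\<^bsub>T\<^esub> \<in> carrier T" by (auto simp: one_T carrier_T)
  show "\<one>\<^bsub>T\<^esub> \<otimes>\<^bsub>T\<^esub> t = t" if "t \<in> carrier T" for t
    using that by (auto simp: one_T carrier_T mult_T)
qed

lemma finite_T: "finite (carrier T)"
proof -
  have "carrier T \<subseteq> {0..<int p} \<rightarrow>\<^sub>E {0..<int p}"
    using p2 by (auto simp: carrier_T aff_def)
  then show ?thesis by (rule finite_subset) (simp add: finite_PiE)
qed

text \<open>An affine map is determined by its values at 0 and 1, so distinct pairs of residues give
  distinct maps. The lower bound is the direction needed against the upper bound for the presented
  group.\<close>

lemma card_T: "p * (p - 1) \<le> card (carrier T)"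
proof -
  let ?f = "\<lambda>(u, v). aff p (int u) (int v)"
  have "inj_on ?f ({1..<p} \<times> {0..<p})"
  proof (rule inj_onI, clarify)
    fix u v u' v'
    assume uv: "u \<in> {1..<p}" "v \<in> {0..<p}" "u' \<in> {1..<p}" "v' \<in> {0..<p}"
      and eq: "aff p (int u) (int v) = aff p (int u') (int v')"
    have "aff p (int u) (int v) 0 = aff p (int u') (int v') 0" by (simp add: eq)
    then have v: "v = v'" using uv p2 by (simp add: aff_def)
    have "aff p (int u) (int v) 1 = aff p (int u') (int v') 1" by (simp add: eq)
    then have "[int u + int v = int u' + int v] (mod int p)"
      using v p2 by (simp add: aff_def cong_def)
    then have "[u = u'] (mod p)" by (simp add: cong_add_rcancel cong_int_iff)
    then show "u = u' \<and> v = v'" using uv v by (simp add: cong_less_modulus_unique_nat)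
  qed
  then have "card (?f ` ({1..<p} \<times> {0..<p})) = p * (p - 1)"
    by (simp add: card_image card_cartesian_product)
  moreover have "?f ` ({1..<p} \<times> {0..<p}) \<subseteq> carrier T"
  proof -
    have "coprime (int u) (int p)" if "u \<in> {1..<p}" for u
    proof -
      have "\<not> p dvd u" using that by (auto dest: dvd_imp_le)
      then show ?thesis using prime by (simp add: prime_imp_coprime coprime_commute)
    qed
    then show ?thesis by (force simp: carrier_T)
  qed
  ultimately show ?thesis using card_mono[OF finite_T] by metis
qed

end

declare add_2_eq_Suc' [simp del]

section \<open>Generators of AGL(1, p) and their images in the symmetric group\<close>

locale agl_sym = prime_modulus +
  fixes r :: nat
  assumes r: "generates_units p r"
begin

abbreviation "S \<equiv> sym_group (p + 2)"

lemma r_bounds: "0 < r" "r < p" using r by (simp_all add: generates_units_def)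

lemma coprime_r: "coprime (int (r ^ k)) (int p)"
proof -
  have "\<not> p dvd r" using r_bounds by (auto dest: dvd_imp_le)
  then have "coprime p r" using prime by (simp add: prime_imp_coprime)
  then show ?thesis by (simp add: coprime_commute)
qed

lemma r_pow: "[r ^ (p - 1) = 1] (mod p)"
proof (rule fermat_theorem[OF prime])
  show "\<not> p dvd r" using r_bounds by (auto dest: dvd_imp_le)
qed

definition a where "a = aff p 1 1"
definition b where "b = aff p (int r) 0"

lemma a_pow: "a [^]\<^bsub>T\<^esub> (k::nat) = aff p 1 (int k)"
proof (induction k)
  case (Suc k)
  then show ?case
    using group.is_monoid[OF group_T] by (simp add: a_def mult_T add.commute)
qed (simp add: one_T)

lemma b_pow: "b [^]\<^bsub>T\<^esub> (k::nat) = aff p (int (r ^ k)) 0"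
proof (induction k)
  case (Suc k)
  then show ?case
    using coprime_r[of k] coprime_r[of 1] by (simp add: b_def mult_T mult.commute)
qed (simp add: one_T)

lemma a_b_carrier: "a \<in> carrier T" "b \<in> carrier T"
  using coprime_r[of 1] by (auto simp: a_def b_def carrier_T)

lemma a_pow_p: "a [^]\<^bsub>T\<^esub> p = \<one>\<^bsub>T\<^esub>"
  unfolding a_pow one_T by (rule aff_cong) (simp_all add: cong_def)

lemma b_pow_p: "b [^]\<^bsub>T\<^esub> (p - 1) = \<one>\<^bsub>T\<^esub>"
  unfolding b_pow one_T
proof (rule aff_cong)
  show "[int (r ^ (p - 1)) = 1] (mod int p)"
    using r_pow by (metis cong_int_iff of_nat_1)
qed simp

lemma b_a: "b \<otimes>\<^bsub>T\<^esub> a = a [^]\<^bsub>T\<^esub> r \<otimes>\<^bsub>T\<^esub> b"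
  unfolding a_pow using coprime_r[of 1] by (simp add: a_def b_def mult_T)

lemma T_normal_form:
  assumes "t \<in> carrier T"
  obtains i j :: nat where "t = a [^]\<^bsub>T\<^esub> i \<otimes>\<^bsub>T\<^esub> b [^]\<^bsub>T\<^esub> j"
proof -
  obtain u v where t: "t = aff p u v" "coprime u (int p)" using assms by (auto simp: carrier_T)
  have p: "int p > 0" using p2 by simp
  define j where "j = nat (u mod int p)"
  have "u mod int p \<noteq> 0"
  proof
    assume "u mod int p = 0"
    then have "int p dvd u" by auto
    then have "is_unit (int p)" using t(2) by (metis coprime_absorb_right)
    then show False using p2 by simp
  qed
  then have j: "0 < j" "j < p" "int j = u mod int p"
    using p by (auto simp: j_def nat_less_iff order.not_eq_order_implies_strict)
  \<comment> \<open>The exponent of \<open>b\<close> is a discrete logarithm of the slope to the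
    base \<open>r\<close>.\<close>
  then obtain k where k: "r ^ k mod p = j" using r by (auto simp: generates_units_def)
  have "t = aff p (int (r ^ k)) (int (nat (v mod int p)))"
    unfolding t(1)
  proof (rule aff_cong)
    have "int (r ^ k) mod int p = u mod int p"
      using k j(3) by (metis zmod_int)
    then show "[u = int (r ^ k)] (mod int p)" by (simp add: cong_def)
  qed (use p in \<open>simp add: cong_def\<close>)
  also have "\<dots> = a [^]\<^bsub>T\<^esub> nat (v mod int p) \<otimes>\<^bsub>T\<^esub> b [^]\<^bsub>T\<^esub> k"
    unfolding a_pow b_pow using coprime_r[of k] by (simp add: mult_T)
  finally show thesis by (rule that)
qed

text \<open>The point \<open>k\<close> of \<open>{1..p}\<close> stands for the residue \<open>k - 1\<close>; the points \<open>p + 1\<close> and \<open>p + 2\<close> are fixed.\<close>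

definition \<iota> :: "(int \<Rightarrow> int) \<Rightarrow> nat \<Rightarrow> nat" where
  "\<iota> t k = (if k \<in> {1..p} then nat (t (int k - 1)) + 1 else k)"

lemma T_bij: "t \<in> carrier T \<Longrightarrow> bij_betw t {0..<int p} {0..<int p}"
  using aff_Bij by (auto simp: carrier_T Bij_def)

lemma T_range: "t \<in> carrier T \<Longrightarrow> x \<in> {0..<int p} \<Longrightarrow> t x \<in> {0..<int p}"
  using bij_betwE[OF T_bij] by blast

lemma \<iota>_permutes: assumes "t \<in> carrier T" shows "\<iota> t permutes {1..p}"
proof (rule bij_imp_permutes)
  have inj: "inj_on (\<iota> t) {1..p}"
  proof (rule inj_onI)
    fix k l assume kl: "k \<in> {1..p}" "l \<in> {1..p}" "\<iota> t k = \<iota> t l"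
    have r: "int k - 1 \<in> {0..<int p}" "int l - 1 \<in> {0..<int p}" using kl by auto
    then have "t (int k - 1) = t (int l - 1)"
      using kl T_range[OF assms r(1)] T_range[OF assms r(2)] by (simp add: \<iota>_def eq_nat_nat_iff)
    then have "int k - 1 = int l - 1"
      using T_bij[OF assms] r by (metis bij_betw_imp_inj_on inj_onD)
    then show "k = l" by simp
  qed
  have "\<iota> t k \<in> {1..p}" if "k \<in> {1..p}" for k
  proof -
    have "int k - 1 \<in> {0..<int p}" using that by auto
    from T_range[OF assms this] show ?thesis using that by (auto simp: \<iota>_def nat_less_iff Suc_le_eq)
  qed
  then have "\<iota> t ` {1..p} = {1..p}"
    using inj by (intro endo_inj_surj) auto
  then show "bij_betw (\<iota> t) {1..p} {1..p}" using inj by (simp add: bij_betw_def)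
qed (simp only: \<iota>_def if_False)

lemma \<iota>_carrier: "t \<in> carrier T \<Longrightarrow> \<iota> t \<in> carrier S"
  using permutes_subset[OF \<iota>_permutes] by (auto simp: sym_group_carrier)

lemma \<iota>_mult: assumes "s \<in> carrier T" "t \<in> carrier T" shows "\<iota> (s \<otimes>\<^bsub>T\<^esub> t) = \<iota> s \<circ> \<iota> t"
proof
  fix k
  have mult: "(s \<otimes>\<^bsub>T\<^esub> t) x = s (t x)" if "x \<in> {0..<int p}" for x
  proof -
    have "s \<in> Bij {0..<int p}" "t \<in> Bij {0..<int p}" using assms aff_Bij by (auto simp: carrier_T)
    then show ?thesis using that by (simp add: AGL1_def carrier_ring BijGroup_def compose_def)
  qed
  show "\<iota> (s \<otimes>\<^bsub>T\<^esub> t) k = (\<iota> s \<circ> \<iota> t) k"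
  proof (cases "k \<in> {1..p}")
    case True
    then have k: "int k - 1 \<in> {0..<int p}" by auto
    have "t (int k - 1) \<in> {0..<int p}" by (rule T_range[OF assms(2) k])
    then show ?thesis using True k by (auto simp: \<iota>_def mult nat_less_iff Suc_le_eq)
  next
    case False
    then have "\<iota> t k = k" "\<iota> s k = k" "\<iota> (s \<otimes>\<^bsub>T\<^esub> t) k = k" by (simp_all only: \<iota>_def if_False)
    then show ?thesis by simp
  qed
qed

lemma group_hom_\<iota>: "group_hom T S \<iota>"
  by (intro group_hom.intro group_T sym_group_is_group group_hom_axioms.intro homI)
     (simp_all add: \<iota>_carrier \<iota>_mult sym_group_mult)

text \<open>Models \<open>y (i - 1)\<close>, since the point \<open>i\<close> stands for the residue
  \<open>i - 1\<close>; in particular \<open>\<xi> 1\<close> plays the role of \<open>x\<close>. The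
  points \<open>p + 2\<close> and \<open>p + 1\<close> are the two points at infinity.\<close>

definition \<xi> :: "nat \<Rightarrow> nat \<Rightarrow> nat" where "\<xi> i = cycle_of_list [p + 2, p + 1, i]"

lemma \<xi>_carrier: "i \<in> {1..p} \<Longrightarrow> \<xi> i \<in> carrier S"
  using permutes_subset[OF cycle_permutes[of "[p + 2, p + 1, i]"], of "{1..p + 2}"]
  by (auto simp: sym_group_carrier \<xi>_def simp del: cycle_of_list.simps)

lemma \<iota>_fixes: "\<iota> t (p + 1) = p + 1" "\<iota> t (p + 2) = p + 2"
  by (simp_all add: \<iota>_def)

lemma \<iota>_conj_\<xi>:
  assumes "t \<in> carrier T" "i \<in> {1..p}"
  shows "\<iota> t \<circ> \<xi> i \<circ> inv' (\<iota> t) = \<xi> (\<iota> t i)"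
  unfolding \<xi>_def
  using conjugation_of_cycle[of "[p + 2, p + 1, i]" "\<iota> t"] permutes_bij[OF \<iota>_permutes[OF assms(1)]] assms(2)
  by (simp only: list.map \<iota>_fixes) simp

lemma inv_\<iota>: "t \<in> carrier T \<Longrightarrow> inv\<^bsub>S\<^esub> (\<iota> t) = inv' (\<iota> t)"
  by (simp add: \<iota>_carrier)

lemma \<iota>_a_1: "\<iota> (a [^]\<^bsub>T\<^esub> (i::nat)) 1 = i mod p + 1"
  using p2 by (simp add: a_pow \<iota>_def aff_def nat_int flip: zmod_int)

lemma \<iota>_b_1: "\<iota> b 1 = 1"
  using p2 by (simp add: b_def \<iota>_def aff_def)

lemma \<xi>_cube: "i \<in> {1..p} \<Longrightarrow> \<xi> i ^^ 3 = id"
  using cycle_is_id_root[of "[p + 2, p + 1, i]"] by (simp add: \<xi>_def numeral_3_eq_3 del: cycle_of_list.simps)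

lemma \<xi>_conj_a: "\<iota> a \<circ> (\<xi> 1 \<circ> inv' (\<iota> a)) = \<xi> 2"
proof -
  have "1 mod p = 1" using p2 by simp
  then have "\<iota> a 1 = 2" using \<iota>_a_1[of 1] group.is_monoid[OF group_T] a_b_carrier by (simp add: numeral_2_eq_2)
  then show ?thesis using \<iota>_conj_\<xi>[OF a_b_carrier(1), of 1] p2 by (simp add: comp_assoc)
qed

text \<open>Multiplication by \<open>r\<close> fixes the residue 0, which is the point 1, and the
  two points at infinity, so it commutes with \<open>\<xi> 1\<close>. The conjugate of
  \<open>\<xi> 1\<close> by the translation is \<open>\<xi> 2\<close>, and
  \<open>double_transposition\<close> applies.\<close>

lemma agl_relations_S: "agl_relations S p r (\<iota> a) (\<iota> b) (\<xi> 1)"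
proof -
  interpret \<iota>: group_hom T S \<iota> by (rule group_hom_\<iota>)
  have 1: "1 \<in> {1..p}" using p2 by simp
  have "\<iota> a [^]\<^bsub>S\<^esub> p = \<one>\<^bsub>S\<^esub>"
    using \<iota>.hom_nat_pow[of a p] a_b_carrier a_pow_p by simp
  moreover have "\<iota> b [^]\<^bsub>S\<^esub> (p - 1) = \<one>\<^bsub>S\<^esub>"
    using \<iota>.hom_nat_pow[of b "p - 1"] a_b_carrier b_pow_p by simp
  moreover have "\<iota> b \<otimes>\<^bsub>S\<^esub> \<iota> a = \<iota> a [^]\<^bsub>S\<^esub> r \<otimes>\<^bsub>S\<^esub> \<iota> b"
    using b_a a_b_carrier by (metis \<iota>.hom_mult \<iota>.hom_nat_pow \<iota>.G.nat_pow_closed)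
  moreover have "\<iota> b \<otimes>\<^bsub>S\<^esub> \<xi> 1 = \<xi> 1 \<otimes>\<^bsub>S\<^esub> \<iota> b"
  proof -
    have "\<iota> b \<circ> \<xi> 1 \<circ> inv' (\<iota> b) \<circ> \<iota> b = \<xi> 1 \<circ> \<iota> b"
      using \<iota>_conj_\<xi>[OF a_b_carrier(2) 1] by (simp only: \<iota>_b_1)
    moreover have "inv' (\<iota> b) \<circ> \<iota> b = id"
      using permutes_inv_o(2)[OF \<iota>_permutes[OF a_b_carrier(2)]] .
    ultimately show ?thesis by (simp add: sym_group_mult comp_assoc)
  qed
  moreover have "\<xi> 1 [^]\<^bsub>S\<^esub> (3::nat) = \<one>\<^bsub>S\<^esub>"
    using \<xi>_cube[OF 1] by (simp add: nat_pow_sym_group sym_group_one)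
  moreover have "(\<xi> 1 \<otimes>\<^bsub>S\<^esub> (\<iota> a \<otimes>\<^bsub>S\<^esub> (\<xi> 1 \<otimes>\<^bsub>S\<^esub> inv\<^bsub>S\<^esub> \<iota> a))) [^]\<^bsub>S\<^esub> (2::nat) = \<one>\<^bsub>S\<^esub>"
  proof -
    have "(\<xi> 1 \<circ> \<xi> 2) \<circ> (\<xi> 1 \<circ> \<xi> 2) = id"
      unfolding \<xi>_def by (rule double_transposition) (use p2 in auto)
    moreover have "f ^^ 2 = f \<circ> f" for f :: "nat \<Rightarrow> nat" by (simp add: numeral_2_eq_2)
    ultimately show ?thesis
      by (simp only: inv_\<iota>[OF a_b_carrier(1)] sym_group_mult \<xi>_conj_a nat_pow_sym_group sym_group_one)
  qed
  ultimately show ?thesis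
    using 1 a_b_carrier by (simp add: agl_relations_def \<iota>_carrier \<xi>_carrier)
qed

text \<open>Fermat's theorem makes the powers of \<open>r\<close> periodic with period
  \<open>p - 1\<close>, so one period already reaches every nonzero residue; counting then gives
  injectivity.\<close>

lemma powers_of_r: "inj_on (\<lambda>i. r ^ i mod p) {..<p - 1}" "(\<lambda>i. r ^ i mod p) ` {..<p - 1} = {1..<p}"
proof -
  have per: "r ^ (k mod (p - 1)) mod p = r ^ k mod p" for k
  proof -
    have "[r ^ k = (r ^ (p - 1)) ^ (k div (p - 1)) * r ^ (k mod (p - 1))] (mod p)"
      by (simp flip: power_mult power_add)
    also have "[(r ^ (p - 1)) ^ (k div (p - 1)) * r ^ (k mod (p - 1)) = 1 ^ (k div (p - 1)) * r ^ (k mod (p - 1))] (mod p)"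
      by (intro cong_mult cong_pow r_pow cong_refl)
    finally show ?thesis by (simp add: cong_def)
  qed
  show img: "(\<lambda>i. r ^ i mod p) ` {..<p - 1} = {1..<p}"
  proof (intro subset_antisym subsetI)
    fix j assume "j \<in> {1..<p}"
    then have "0 < j \<and> j < p" by auto
    then obtain k where "r ^ k mod p = j" using r unfolding generates_units_def by blast
    then show "j \<in> (\<lambda>i. r ^ i mod p) ` {..<p - 1}"
      using p2 per[of k] by (intro image_eqI[of _ _ "k mod (p - 1)"]) auto
  next
    fix j assume "j \<in> (\<lambda>i. r ^ i mod p) ` {..<p - 1}"
    then obtain i where j: "j = r ^ i mod p" by blast
    have "\<not> p dvd r" using r_bounds by (auto dest: dvd_imp_le)
    then have "\<not> p dvd r ^ i" using prime prime_dvd_power by blast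
    then have "j \<noteq> 0" using j by (simp add: dvd_eq_mod_eq_0)
    then show "j \<in> {1..<p}" using j p2 by simp
  qed
  show "inj_on (\<lambda>i. r ^ i mod p) {..<p - 1}"
    by (rule eq_card_imp_inj_on) (simp_all only: img finite_lessThan card_lessThan card_atLeastLessThan)
qed

lemma \<iota>_a_cycle: "\<iota> a = cycle_of_list [1..<p + 1]"
proof (rule cycle_of_list_eqI)
  fix i assume "i < length [1..<p + 1]"
  then have i: "i < p" by (simp del: upt_Suc)
  have "\<iota> a (i + 1) = nat ((int i + 1) mod int p) + 1" using i by (simp add: \<iota>_def a_def aff_def)
  also have "nat ((int i + 1) mod int p) = (i + 1) mod p"
    by (metis nat_int of_nat_1 of_nat_add zmod_int)
  finally show "\<iota> a ([1..<p + 1] ! i) = [1..<p + 1] ! (Suc i mod length [1..<p + 1])"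
    using i p2 by (simp add: nth_upt del: upt_Suc)
qed (auto simp: \<iota>_def)

text \<open>The orbit of the residue 1 under multiplication by \<open>r\<close>, in the order of
  visits; the shift by one passes from residues to points.\<close>

definition b_cycle :: "nat list" where "b_cycle = map (\<lambda>i. r ^ i mod p + 1) [0..<p - 1]"

lemma distinct_b_cycle: "distinct b_cycle"
  unfolding b_cycle_def distinct_map using powers_of_r(1) by (auto simp: inj_on_def atLeast0LessThan)

lemma set_b_cycle: "set b_cycle = {2..p}"
proof -
  have "set b_cycle = (\<lambda>j. j + 1) ` (\<lambda>i. r ^ i mod p) ` {..<p - 1}"
    by (auto simp: b_cycle_def image_image atLeast0LessThan)
  also have "\<dots> = {2..p}" unfolding powers_of_r(2) using p2 by (simp add: atLeastLessThanSuc_atLeastAtMost)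
  finally show ?thesis .
qed

lemma \<iota>_b_cycle: "\<iota> b = cycle_of_list b_cycle"
proof (rule cycle_of_list_eqI[OF distinct_b_cycle])
  fix i assume "i < length b_cycle"
  then have i: "i < p - 1" by (simp add: b_cycle_def)
  have "r ^ i mod p < p" using p2 by simp
  then have "\<iota> b (r ^ i mod p + 1) = nat ((int r * int (r ^ i mod p)) mod int p) + 1"
    by (simp add: \<iota>_def b_def aff_def)
  also have "nat ((int r * int (r ^ i mod p)) mod int p) = (r * (r ^ i mod p)) mod p"
    by (metis nat_int of_nat_mult zmod_int)
  also have "\<dots> = r ^ Suc i mod p" by (simp add: mod_mult_right_eq)
  also have "\<dots> = r ^ (Suc i mod (p - 1)) mod p"
  proof (cases "Suc i = p - 1")
    \<comment> \<open>The end of the list wraps around to its beginning by Fermat's theorem.\<close>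
    case True
    have "r ^ Suc i mod p = 1" unfolding True using r_pow p2 by (simp add: cong_def)
    then show ?thesis using True p2 by simp
  qed (use i in simp)
  finally show "\<iota> b (b_cycle ! i) = b_cycle ! (Suc i mod length b_cycle)"
    using i by (simp add: b_cycle_def nth_map)
next
  fix k assume k: "k \<notin> set b_cycle"
  then have "k = 1 \<or> k \<notin> {1..p}" by (auto simp: set_b_cycle)
  then show "\<iota> b k = k" using \<iota>_b_1 by (auto simp: \<iota>_def)
qed

text \<open>The list starts at the point 2, which it shares with \<open>\<xi> 2\<close>; there the
  two cycles are joined in \<open>sym_relation_S\<close>.\<close>

lemma b_cycle_Cons: "b_cycle = 2 # tl b_cycle"
proof -
  have "b_cycle ! 0 = 2" "b_cycle \<noteq> []" using p2 by (auto simp: b_cycle_def nth_map)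
  then show ?thesis by (metis hd_conv_nth list.collapse)
qed

lemma evenperm_\<iota>_a: "evenperm (\<iota> a) \<longleftrightarrow> odd p"
  unfolding \<iota>_a_cycle using p2 by (subst evenperm_cycle_of_list) auto

lemma evenperm_\<iota>_b: "evenperm (\<iota> b) \<longleftrightarrow> even p"
  unfolding \<iota>_b_cycle using p2 distinct_b_cycle b_cycle_Cons
  by (subst evenperm_cycle_of_list) (auto simp: b_cycle_def)

text \<open>Composition with (u v i) inserts \<open>u\<close> and \<open>v\<close> in front of
  \<open>i\<close>, so the product is a single cycle of length \<open>length cs + 3\<close>.\<close>

lemma cycle_prolong_power:
  assumes "distinct (u # v # i # cs)"
  shows "(cycle_of_list [u, v, i] \<circ> cycle_of_list (i # cs)) ^^ (length cs + 3) = id"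
proof -
  have "cycle_of_list [u, v, i] \<circ> cycle_of_list (i # cs) = cycle_of_list (u # v # i # cs)"
    by (simp only: cycle_of_list.simps comp_assoc id_comp comp_id)
  then show ?thesis using cycle_is_id_root[OF assms] by (simp add: eval_nat_numeral)
qed

text \<open>By \<open>cycle_prolong_power\<close>, \<open>\<xi> 1\<close> extends the
  \<open>p\<close>-cycle of \<open>a\<close> to length \<open>p + 2\<close>, which is 5 for
  \<open>p = 3\<close>, and \<open>\<xi> 2\<close> extends the \<open>(p - 1)\<close>-cycle of
  \<open>b\<close> to length \<open>p + 1\<close>.\<close>

lemma sym_relation_S: "sym_relation S p (\<iota> a) (\<iota> b) (\<xi> 1)"
proof -
  interpret \<iota>: group_hom T S \<iota> by (rule group_hom_\<iota>)
  have "\<iota> b = \<one>\<^bsub>S\<^esub>" if "p = 2"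
  proof -
    have "b [^]\<^bsub>T\<^esub> (1::nat) = \<one>\<^bsub>T\<^esub>" using b_pow_p that by simp
    then have "b = \<one>\<^bsub>T\<^esub>" using a_b_carrier by simp
    then show ?thesis by simp
  qed
  moreover have "(\<xi> 1 \<otimes>\<^bsub>S\<^esub> \<iota> a) [^]\<^bsub>S\<^esub> (5::nat) = \<one>\<^bsub>S\<^esub>" if "p = 3"
  proof -
    have "1 < p + 1" using prime_gt_0_nat[OF prime] by simp
    from upt_conv_Cons[OF this] have "[1..<p + 1] = 1 # [2..<p + 1]" by (simp only: Suc_1)
    then have a: "\<iota> a = cycle_of_list (1 # [2..<p + 1])" by (simp only: \<iota>_a_cycle)
    have "(\<xi> 1 \<circ> \<iota> a) ^^ (length [2..<p + 1] + 3) = id"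
      unfolding \<xi>_def a by (rule cycle_prolong_power) (use p2 in auto)
    moreover have "length [2..<p + 1] + 3 = 5" using that by simp
    ultimately show ?thesis by (simp only: nat_pow_sym_group sym_group_mult sym_group_one)
  qed
  moreover have "(\<iota> a \<otimes>\<^bsub>S\<^esub> (\<xi> 1 \<otimes>\<^bsub>S\<^esub> inv\<^bsub>S\<^esub> \<iota> a) \<otimes>\<^bsub>S\<^esub> \<iota> b) [^]\<^bsub>S\<^esub> (p + 1) = \<one>\<^bsub>S\<^esub>"
  proof -
    have b: "\<iota> b = cycle_of_list (2 # tl b_cycle)" using b_cycle_Cons by (simp only: \<iota>_b_cycle)
    have "distinct (2 # tl b_cycle)" "set (2 # tl b_cycle) = {2..p}"
      using distinct_b_cycle set_b_cycle b_cycle_Cons by metis+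
    moreover have "p + 2 \<notin> {2..p}" "p + 1 \<notin> {2..p}" by auto
    ultimately have "distinct ((p + 2) # (p + 1) # 2 # tl b_cycle)"
      by (metis distinct.simps(2) n_not_Suc_n set_ConsD add_2_eq_Suc' Suc_eq_plus1)
    then have "(\<xi> 2 \<circ> \<iota> b) ^^ (length (tl b_cycle) + 3) = id"
      unfolding \<xi>_def b by (rule cycle_prolong_power)
    moreover have "length b_cycle = p - 1" by (simp add: b_cycle_def)
    then have "length (tl b_cycle) + 3 = p + 1" using p2 unfolding length_tl by arith
    ultimately show ?thesis
      by (simp only: inv_\<iota>[OF a_b_carrier(1)] sym_group_mult \<xi>_conj_a nat_pow_sym_group sym_group_one)
  qed
  ultimately show ?thesis by (simp add: sym_relation_def)
qed

lemma three_cycles_by_conjugation: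
  assumes "i \<in> {1..p}"
  obtains k :: nat where "\<xi> i = \<iota> (a [^]\<^bsub>T\<^esub> k) \<circ> \<xi> 1 \<circ> inv' (\<iota> (a [^]\<^bsub>T\<^esub> k))"
proof -
  have "a [^]\<^bsub>T\<^esub> (i - 1) \<in> carrier T"
    using a_b_carrier group.is_monoid[OF group_T] by (simp add: monoid.nat_pow_closed)
  moreover have "\<iota> (a [^]\<^bsub>T\<^esub> (i - 1)) 1 = i"
    unfolding \<iota>_a_1 using assms by auto
  ultimately have "\<xi> i = \<iota> (a [^]\<^bsub>T\<^esub> (i - 1)) \<circ> \<xi> 1 \<circ> inv' (\<iota> (a [^]\<^bsub>T\<^esub> (i - 1)))"
    using \<iota>_conj_\<xi>[of "a [^]\<^bsub>T\<^esub> (i - 1)" 1] p2 by simp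
  then show thesis by (rule that)
qed

text \<open>A cycle of even length is odd: this is the \<open>(p - 1)\<close>-cycle of
  \<open>b\<close> if \<open>p\<close> is odd, and the \<open>p\<close>-cycle of \<open>a\<close>
  otherwise.\<close>

lemma odd_element: obtains t where "t \<in> {a, b}" "\<not> evenperm (\<iota> t)"
  using evenperm_\<iota>_a evenperm_\<iota>_b by (cases "odd p") auto

text \<open>The conjugates of \<open>\<xi> 1\<close> by translations are the 3-cycles that yield the
  alternating group. One of the generators is odd and supplies the other coset.\<close>

lemma generate_S: "generate S {\<iota> a, \<iota> b, \<xi> 1} = carrier S"
proof -
  interpret S: group S by (rule sym_group_is_group)
  interpret \<iota>: group_hom T S \<iota> by (rule group_hom_\<iota>)
  let ?J = "generate S {\<iota> a, \<iota> b, \<xi> 1}"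
  have J: "subgroup ?J S"
    using a_b_carrier p2 by (intro S.generate_is_subgroup) (auto simp: \<iota>_carrier \<xi>_carrier)
  have "cycle_of_list [p + 2, p + 1, i] \<in> ?J" if i: "i \<in> {1..p}" for i
  proof -
    obtain k :: nat where k: "\<xi> i = \<iota> (a [^]\<^bsub>T\<^esub> k) \<circ> \<xi> 1 \<circ> inv' (\<iota> (a [^]\<^bsub>T\<^esub> k))"
      using three_cycles_by_conjugation[OF i] .
    have t: "a [^]\<^bsub>T\<^esub> k \<in> carrier T" using a_b_carrier by simp
    have "\<iota> (a [^]\<^bsub>T\<^esub> k) = \<iota> a [^]\<^bsub>S\<^esub> k" using a_b_carrier by (simp add: \<iota>.hom_nat_pow)
    then have J1: "\<iota> (a [^]\<^bsub>T\<^esub> k) \<in> ?J" by (simp add: S.generate_nat_pow generate.incl)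
    have "\<xi> i = \<iota> (a [^]\<^bsub>T\<^esub> k) \<otimes>\<^bsub>S\<^esub> \<xi> 1 \<otimes>\<^bsub>S\<^esub> inv\<^bsub>S\<^esub> \<iota> (a [^]\<^bsub>T\<^esub> k)"
      unfolding k inv_\<iota>[OF t] by (simp add: sym_group_mult)
    moreover have "\<xi> 1 \<in> ?J" by (rule generate.incl) simp
    ultimately have "\<xi> i \<in> ?J"
      using J1 subgroup.m_closed[OF J] subgroup.m_inv_closed[OF J] by metis
    then show ?thesis by (simp only: \<xi>_def)
  qed
  then have alt: "carrier (alt_group (p + 2)) \<subseteq> ?J"
    using J by (rule alt_group_subset_if_three_cycles[rotated])
  obtain t where t: "t \<in> {a, b}" "\<not> evenperm (\<iota> t)" by (rule odd_element)
  have tJ: "\<iota> t \<in> ?J" using t(1) by (auto intro: generate.incl)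
  have tS: "\<iota> t \<in> carrier S" using t(1) a_b_carrier by (auto simp: \<iota>_carrier)
  have "s \<in> ?J" if s: "s \<in> carrier S" for s
  proof (cases "evenperm s")
    case True
    then show ?thesis using alt s by (auto simp: alt_group_carrier sym_group_carrier)
  next
    case False
    have "evenperm (s \<circ> \<iota> t)"
      using False t(2) sym_group_carrier'[OF s] sym_group_carrier'[OF tS] by (simp add: evenperm_comp)
    moreover have "s \<circ> \<iota> t \<in> carrier S" using S.m_closed[OF s tS] by (simp add: sym_group_mult)
    ultimately have "s \<otimes>\<^bsub>S\<^esub> \<iota> t \<in> ?J"
      using alt by (auto simp: alt_group_carrier sym_group_carrier sym_group_mult)
    then have "s \<otimes>\<^bsub>S\<^esub> \<iota> t \<otimes>\<^bsub>S\<^esub> inv\<^bsub>S\<^esub> \<iota> t \<in> ?J"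
      using tJ subgroup.m_closed[OF J] subgroup.m_inv_closed[OF J] by blast
    then show ?thesis using s tS by (simp add: S.m_assoc del: sym_group_inv_equality)
  qed
  then show ?thesis using subgroup.subset[OF J] by auto
qed

end

subsection \<open>The subdirect product of index two\<close>

text \<open>Membership in a subgroup of index two behaves like a parity. For \<open>x\<close> and
  \<open>y\<close> outside \<open>H\<close>, the cosets of \<open>x\<close> and \<open>inv y\<close>
  both differ from \<open>H\<close>, so they coincide and \<open>x \<otimes> y\<close> lies in
  \<open>H\<close>.\<close>

lemma (in group) index_two_mult:
  assumes H: "subgroup H G" "card (rcosets H) = 2" and xy: "x \<in> carrier G" "y \<in> carrier G"
  shows "x \<otimes> y \<in> H \<longleftrightarrow> (x \<in> H \<longleftrightarrow> y \<in> H)"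
proof -
  note Hm = subgroup.m_closed[OF H(1)] and Hi = subgroup.m_inv_closed[OF H(1)]
  have x: "x \<in> H" if "x \<otimes> y \<in> H" "y \<in> H"
    using Hm[OF that(1) Hi[OF that(2)]] xy by (simp add: m_assoc)
  have y: "y \<in> H" if "x \<otimes> y \<in> H" "x \<in> H"
    using Hm[OF Hi[OF that(2)] that(1)] xy by (simp add: m_assoc[symmetric])
  have "x \<otimes> y \<in> H" if "x \<notin> H" "y \<notin> H"
  proof -
    have coset: "H #> g \<in> rcosets H" "g \<in> H #> g" if "g \<in> carrier G" for g
      using that rcosetsI[OF subgroup.subset[OF H(1)]] rcos_self[OF that H(1)] by auto
    have "H \<in> rcosets H" using subgroup.subgroup_in_rcosets[OF H(1) is_group] .
    moreover have "H #> x \<noteq> H" using coset(2)[OF xy(1)] that(1) by auto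
    moreover have "H #> inv y \<noteq> H"
      using coset(2)[of "inv y"] that(2) xy Hi[of "inv y"] by auto
    ultimately have "H #> x = H #> inv y"
      using H(2) coset(1)[of x] coset(1)[of "inv y"] xy unfolding card_2_iff by auto
    then have "x \<in> H #> inv y" using coset(2)[OF xy(1)] by simp
    then obtain h where "h \<in> H" "x = h \<otimes> inv y" by (auto simp: r_coset_def)
    then show ?thesis using xy subgroup.mem_carrier[OF H(1)] by (simp add: m_assoc)
  qed
  then show ?thesis using Hm x y by blast
qed

lemma (in group) index_two_proper:
  assumes "subgroup H G" "card (rcosets H) = 2"
  obtains g where "g \<in> carrier G" "g \<notin> H"
proof -
  have "\<exists>g\<in>carrier G. g \<notin> H"
  proof (rule ccontr)
    assume "\<not> ?thesis"
    then have "rcosets H \<subseteq> {H}" using coset_join2[OF _ assms(1)] by (auto simp: RCOSETS_def)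
    then have "card (rcosets H) \<le> 1" using card_mono[of "{H}"] by simp
    then show False using assms(2) by simp
  qed
  then show thesis using that by blast
qed

lemma nat_pow_DirProd: "(g, h) [^]\<^bsub>G \<times>\<times> K\<^esub> (n::nat) = (g [^]\<^bsub>G\<^esub> n, h [^]\<^bsub>K\<^esub> n)"
  by (induction n) simp_all

lemma agl_relations_DirProd:
  assumes "group G" "group K" "agl_relations G p r a b x" "agl_relations K p r a' b' x'"
  shows "agl_relations (G \<times>\<times> K) p r (a, a') (b, b') (x, x')"
  using assms by (simp add: agl_relations_def nat_pow_DirProd)

lemma (in group) agl_relations_subgroup:
  assumes H: "subgroup H G" and "a \<in> H" "b \<in> H" "x \<in> H" and "agl_relations G p r a b x"
  shows "agl_relations (G\<lparr>carrier := H\<rparr>) p r a b x"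
  using assms m_inv_consistent[OF H] by (simp add: agl_relations_def nat_pow_consistent[symmetric])

context agl_sym
begin

abbreviation "ST \<equiv> S \<times>\<times> T"

lemma group_ST: "group ST"
  by (intro DirProd_group sym_group_is_group group_T)

text \<open>The fibre product of the two sign maps, where the sign of an affine map is that of its
  action on the residues.\<close>

definition H0 where
  "H0 = {(s, t). s \<in> carrier S \<and> t \<in> carrier T \<and> (evenperm s \<longleftrightarrow> evenperm (\<iota> t))}"

lemma evenperm_mult_S:
  "s \<in> carrier S \<Longrightarrow> s' \<in> carrier S \<Longrightarrow> evenperm (s \<otimes>\<^bsub>S\<^esub> s') \<longleftrightarrow> evenperm s = evenperm s'"
  using evenperm_comp[of s s'] sym_group_carrier'[of s] sym_group_carrier'[of s'] by (simp add: sym_group_mult)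

lemma evenperm_mult_T:
  "t \<in> carrier T \<Longrightarrow> t' \<in> carrier T \<Longrightarrow>
    evenperm (\<iota> (t \<otimes>\<^bsub>T\<^esub> t')) \<longleftrightarrow> evenperm (\<iota> t) = evenperm (\<iota> t')"
  using evenperm_mult_S[of "\<iota> t" "\<iota> t'"] by (simp add: \<iota>_mult \<iota>_carrier sym_group_mult)

lemma \<iota>_one: "\<iota> \<one>\<^bsub>T\<^esub> = id"
  using group_hom.hom_one[OF group_hom_\<iota>] by (simp add: sym_group_one)

text \<open>\<open>H0\<close> is the kernel of the product of the two signs, a homomorphism onto a
  group of order two.\<close>

lemma H0_index: "subgroup H0 ST" "card (rcosets\<^bsub>ST\<^esub> H0) = 2"
proof -
  define \<phi> :: "(nat \<Rightarrow> nat) \<times> (int \<Rightarrow> int) \<Rightarrow> int" where "\<phi> = (\<lambda>(s, t). sign s * sign (\<iota> t))"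
  have "\<phi> \<in> hom ST sign_img"
    by (rule homI) (auto simp: \<phi>_def sign_img_def sign_def evenperm_mult_S evenperm_mult_T split: if_splits)
  then interpret \<phi>: group_hom ST sign_img \<phi>
    by (simp add: group_hom_def group_hom_axioms_def group_ST sign_img_is_group)
  have kernel: "kernel ST sign_img \<phi> = H0"
    by (auto simp: kernel_def H0_def \<phi>_def sign_def sign_img_def split: if_splits)
  then show "subgroup H0 ST" using \<phi>.subgroup_kernel by simp
  obtain t where t: "t \<in> {a, b}" "\<not> evenperm (\<iota> t)" by (rule odd_element)
  have tT: "t \<in> carrier T" using t(1) a_b_carrier by auto
  have one: "id \<in> carrier S" by (simp add: sym_group_carrier permutes_id)
  have "\<phi> (id, t) = -1" "\<phi> (id, \<one>\<^bsub>T\<^esub>) = 1"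
    using t(2) by (simp_all add: \<phi>_def sign_def \<iota>_one)
  moreover have "(id, t) \<in> carrier ST" "(id, \<one>\<^bsub>T\<^esub>) \<in> carrier ST"
    using tT one group.is_monoid[OF group_T] by (auto intro: monoid.one_closed)
  ultimately have "{-1, 1} \<subseteq> \<phi> ` carrier ST" by force
  then have "\<phi> ` carrier ST = carrier sign_img"
    using \<phi>.hom_closed by (auto simp: sign_img_def)
  from iso_same_card[OF \<phi>.FactGroup_iso[OF this], unfolded kernel]
  show "card (rcosets\<^bsub>ST\<^esub> H0) = 2"
    by (simp add: FactGroup_def sign_img_def)
qed

lemma finite_S: "finite (carrier S)"
  by (simp add: sym_group_def finite_permutations)

lemma card_H0: "finite H0" "fact (p + 2) * (p * (p - 1)) \<le> 2 * card H0"
proof -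
  show "finite H0"
    by (rule finite_subset[OF subgroup.subset[OF H0_index(1)]]) (simp add: finite_S finite_T)
  have "2 * card H0 = card (carrier S) * card (carrier T)"
    using group.lagrange[OF group_ST H0_index(1)] H0_index(2)
    by (simp add: order_def card_cartesian_product)
  then show "fact (p + 2) * (p * (p - 1)) \<le> 2 * card H0"
    using mult_le_mono2[OF card_T, of "fact (p + 2)"] by (simp add: sym_group_card_carrier)
qed

lemma H0_subdirect: "index2_subdirect S T H0"
proof -
  obtain t where t: "t \<in> {a, b}" "\<not> evenperm (\<iota> t)" by (rule odd_element)
  have tT: "t \<in> carrier T" using t(1) a_b_carrier by auto
  have oneT: "\<one>\<^bsub>T\<^esub> \<in> carrier T" using group.is_monoid[OF group_T] by (rule monoid.one_closed)
  have "s \<in> fst ` H0" if "s \<in> carrier S" for s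
  proof (cases "evenperm s")
    case True
    then have "(s, \<one>\<^bsub>T\<^esub>) \<in> H0" using that oneT by (simp add: H0_def \<iota>_one)
    then show ?thesis by force
  next
    case False
    then have "(s, t) \<in> H0" using that t(2) tT by (simp add: H0_def)
    then show ?thesis by force
  qed
  moreover have "t \<in> snd ` H0" if "t \<in> carrier T" for t
  proof -
    have "(\<iota> t, t) \<in> H0" using that by (simp add: H0_def \<iota>_carrier)
    then show ?thesis by force
  qed
  ultimately have "fst ` H0 = carrier S" "snd ` H0 = carrier T" by (auto simp: H0_def)
  then show ?thesis using H0_index by (simp add: index2_subdirect_def)
qed

lemma \<xi>_even: "i \<in> {1..p} \<Longrightarrow> evenperm (\<xi> i)"
  unfolding \<xi>_def by (subst evenperm_cycle_of_list) auto

lemma even_p: "even p \<Longrightarrow> p = 2"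
  using prime prime_odd_nat p2 by (metis le_neq_implies_less)

text \<open>By \<open>index_two_mult\<close>, \<open>H\<close> is determined by its intersections
  with the two factors, and the projection conditions make both of these proper. Elements of odd
  order lie in \<open>H\<close>, which fixes the parity on each factor as the sign.\<close>

lemma subdirect_unique:
  assumes "index2_subdirect S T H"
  shows "H = H0"
proof -
  interpret S: group S by (rule sym_group_is_group)
  interpret T: group T by (rule group_T)
  interpret ST: group ST by (rule group_ST)
  have H: "subgroup H ST" "card (rcosets\<^bsub>ST\<^esub> H) = 2" "fst ` H = carrier S" "snd ` H = carrier T"
    using assms by (auto simp: index2_subdirect_def)
  have sub: "H \<subseteq> carrier S \<times> carrier T" using subgroup.subset[OF H(1)] by simp
  note mult = ST.index_two_mult[OF H(1,2)]
  have one: "(\<one>\<^bsub>S\<^esub>, \<one>\<^bsub>T\<^esub>) \<in> H" using subgroup.one_closed[OF H(1)] by simp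
  have split: "(s, t) \<in> H \<longleftrightarrow> ((s, \<one>\<^bsub>T\<^esub>) \<in> H \<longleftrightarrow> (\<one>\<^bsub>S\<^esub>, t) \<in> H)" if "s \<in> carrier S" "t \<in> carrier T" for s t
    using mult[of "(s, \<one>\<^bsub>T\<^esub>)" "(\<one>\<^bsub>S\<^esub>, t)"] that by simp
  have multS: "(s \<otimes>\<^bsub>S\<^esub> s', \<one>\<^bsub>T\<^esub>) \<in> H \<longleftrightarrow> ((s, \<one>\<^bsub>T\<^esub>) \<in> H \<longleftrightarrow> (s', \<one>\<^bsub>T\<^esub>) \<in> H)"
    if "s \<in> carrier S" "s' \<in> carrier S" for s s'
    using mult[of "(s, \<one>\<^bsub>T\<^esub>)" "(s', \<one>\<^bsub>T\<^esub>)"] that by simp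
  have multT: "(\<one>\<^bsub>S\<^esub>, t \<otimes>\<^bsub>T\<^esub> t') \<in> H \<longleftrightarrow> ((\<one>\<^bsub>S\<^esub>, t) \<in> H \<longleftrightarrow> (\<one>\<^bsub>S\<^esub>, t') \<in> H)"
    if "t \<in> carrier T" "t' \<in> carrier T" for t t'
    using mult[of "(\<one>\<^bsub>S\<^esub>, t)" "(\<one>\<^bsub>S\<^esub>, t')"] that by simp
  obtain g where g: "g \<in> carrier ST" "g \<notin> H" using ST.index_two_proper[OF H(1,2)] .
  \<comment> \<open>If \<open>H\<close> contained the first factor, then for each \<open>t\<close> a
    pair \<open>(s', t)\<close> in \<open>H\<close>, which exists because \<open>H\<close> projects
    onto \<open>T\<close>, would put every pair over \<open>t\<close> into \<open>H\<close>. The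
    argument for \<open>t1\<close> is symmetric.\<close>
  obtain s1 where s1: "s1 \<in> carrier S" "(s1, \<one>\<^bsub>T\<^esub>) \<notin> H"
  proof -
    have "\<exists>s\<in>carrier S. (s, \<one>\<^bsub>T\<^esub>) \<notin> H"
    proof (rule ccontr)
      assume no: "\<not> ?thesis"
      obtain s t where st: "g = (s, t)" "s \<in> carrier S" "t \<in> carrier T" using g(1) by auto
      obtain s' where "(s', t) \<in> H" using H(4) st(3) by force
      then have "(s, t) \<in> H" using no split[of s' t] split[of s t] st sub by auto
      then show False using g(2) st by simp
    qed
    then show thesis using that by blast
  qed
  obtain t1 where t1: "t1 \<in> carrier T" "(\<one>\<^bsub>S\<^esub>, t1) \<notin> H"
  proof -
    have "\<exists>t\<in>carrier T. (\<one>\<^bsub>S\<^esub>, t) \<notin> H"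
    proof (rule ccontr)
      assume no: "\<not> ?thesis"
      obtain s t where st: "g = (s, t)" "s \<in> carrier S" "t \<in> carrier T" using g(1) by auto
      obtain t' where "(s, t') \<in> H" using H(3) st(2) by force
      then have "(s, t) \<in> H" using no split[of s t'] split[of s t] st sub by auto
      then show False using g(2) st by simp
    qed
    then show thesis using that by blast
  qed

  have "subgroup {s \<in> carrier S. (s, \<one>\<^bsub>T\<^esub>) \<in> H} S"
  proof (rule S.subgroupI)
    show "{s \<in> carrier S. (s, \<one>\<^bsub>T\<^esub>) \<in> H} \<noteq> {}" using one S.one_closed by blast
    fix s assume s: "s \<in> {s \<in> carrier S. (s, \<one>\<^bsub>T\<^esub>) \<in> H}"
    then have "inv\<^bsub>ST\<^esub> (s, \<one>\<^bsub>T\<^esub>) \<in> H" using subgroup.m_inv_closed[OF H(1)] by blast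
    then show "inv\<^bsub>S\<^esub> s \<in> {s \<in> carrier S. (s, \<one>\<^bsub>T\<^esub>) \<in> H}"
      using s inv_DirProd[OF S.is_group T.is_group, of s "\<one>\<^bsub>T\<^esub>"] by (simp del: sym_group_inv_equality)
  qed (auto simp: multS)
  then have "carrier (alt_group (p + 2)) \<subseteq> {s \<in> carrier S. (s, \<one>\<^bsub>T\<^esub>) \<in> H}"
  proof (rule alt_group_subset_if_three_cycles)
    fix i assume i: "i \<in> {1..p}"
    have c: "\<xi> i \<in> carrier S" using i by (rule \<xi>_carrier)
    \<comment> \<open>The cube of the 3-cycle is trivial, so three times its parity is even, and
      hence so is its parity.\<close>
    have "\<xi> i \<otimes>\<^bsub>S\<^esub> \<xi> i \<otimes>\<^bsub>S\<^esub> \<xi> i = \<one>\<^bsub>S\<^esub>"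
      using \<xi>_cube[OF i] by (simp add: sym_group_mult sym_group_one numeral_3_eq_3 comp_assoc)
    then have "(\<xi> i \<otimes>\<^bsub>S\<^esub> \<xi> i \<otimes>\<^bsub>S\<^esub> \<xi> i, \<one>\<^bsub>T\<^esub>) \<in> H" using one by simp
    then have "(\<xi> i, \<one>\<^bsub>T\<^esub>) \<in> H" using c by (simp add: multS)
    then show "cycle_of_list [p + 2, p + 1, i] \<in> {s \<in> carrier S. (s, \<one>\<^bsub>T\<^esub>) \<in> H}"
      using c unfolding \<xi>_def by blast
  qed
  then have even: "(s, \<one>\<^bsub>T\<^esub>) \<in> H" if "s \<in> carrier S" "evenperm s" for s
    using that by (auto simp: alt_group_carrier sym_group_carrier)
  have S_iff: "(s, \<one>\<^bsub>T\<^esub>) \<in> H \<longleftrightarrow> evenperm s" if s: "s \<in> carrier S" for s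
  proof (cases "evenperm s")
    case False
    have "\<not> evenperm s1" using s1 even by blast
    then have "evenperm (s \<otimes>\<^bsub>S\<^esub> s1)" using False s s1(1) by (simp add: evenperm_mult_S)
    then have "(s \<otimes>\<^bsub>S\<^esub> s1, \<one>\<^bsub>T\<^esub>) \<in> H" using s s1(1) by (intro even) simp_all
    then show ?thesis using multS[OF s s1(1)] s1(2) False by simp
  qed (use s even in simp)

  have pow: "(\<one>\<^bsub>S\<^esub>, t [^]\<^bsub>T\<^esub> (k::nat)) \<in> H \<longleftrightarrow> (\<one>\<^bsub>S\<^esub>, t) \<in> H \<or> even k"
    "evenperm (\<iota> (t [^]\<^bsub>T\<^esub> (k::nat))) \<longleftrightarrow> evenperm (\<iota> t) \<or> even k" if "t \<in> carrier T" for t k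
    using that one by (induction k) (auto simp: multT evenperm_mult_T \<iota>_one)
  have all: "(\<one>\<^bsub>S\<^esub>, t) \<in> H" if "(\<one>\<^bsub>S\<^esub>, a) \<in> H" "(\<one>\<^bsub>S\<^esub>, b) \<in> H" and t: "t \<in> carrier T" for t
  proof -
    obtain i j :: nat where "t = a [^]\<^bsub>T\<^esub> i \<otimes>\<^bsub>T\<^esub> b [^]\<^bsub>T\<^esub> j" using T_normal_form[OF t] .
    then show ?thesis using that a_b_carrier by (simp add: multT pow)
  qed
  have "((\<one>\<^bsub>S\<^esub>, a) \<in> H \<longleftrightarrow> evenperm (\<iota> a)) \<and> ((\<one>\<^bsub>S\<^esub>, b) \<in> H \<longleftrightarrow> evenperm (\<iota> b))"
  \<comment> \<open>One generator of \<open>T\<close> has odd order and thus lies in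
    \<open>H\<close>: \<open>a\<close> if \<open>p\<close> is odd, and the trivial \<open>b\<close>
    if \<open>p = 2\<close>. The other must lie outside, since \<open>T\<close> is not contained in
    \<open>H\<close>. The signs of the two permutations show the same pattern.\<close>
  proof (cases "odd p")
    case True
    have "(\<one>\<^bsub>S\<^esub>, a) \<in> H" using pow(1)[OF a_b_carrier(1), of p] one True by (simp add: a_pow_p)
    then show ?thesis using all t1 True by (auto simp: evenperm_\<iota>_a evenperm_\<iota>_b)
  next
    case False
    then have "b [^]\<^bsub>T\<^esub> (1::nat) = \<one>\<^bsub>T\<^esub>" using b_pow_p even_p by simp
    then have "(\<one>\<^bsub>S\<^esub>, b) \<in> H" using one a_b_carrier by simp
    then show ?thesis using all t1 False by (auto simp: evenperm_\<iota>_a evenperm_\<iota>_b)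
  qed
  then have T_iff: "(\<one>\<^bsub>S\<^esub>, t) \<in> H \<longleftrightarrow> evenperm (\<iota> t)" if t: "t \<in> carrier T" for t
  proof -
    obtain i j :: nat where "t = a [^]\<^bsub>T\<^esub> i \<otimes>\<^bsub>T\<^esub> b [^]\<^bsub>T\<^esub> j" using T_normal_form[OF t] .
    then show ?thesis
      using \<open>_ \<and> _\<close> a_b_carrier by (simp add: multT evenperm_mult_T pow)
  qed
  have "(s, t) \<in> H \<longleftrightarrow> (s, t) \<in> H0" for s t
    using split[of s t] S_iff[of s] T_iff[of t] sub by (auto simp: H0_def)
  then show ?thesis by auto
qed

lemma agl_relations_T: "agl_relations T p r a b \<one>\<^bsub>T\<^esub>"
proof -
  interpret T: group T by (rule group_T)
  show ?thesis
    using a_b_carrier a_pow_p b_pow_p b_a by (simp add: agl_relations_def del: T.nat_pow_Suc)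
qed

lemma gens_in_H0: "(\<iota> a, a) \<in> H0" "(\<iota> b, b) \<in> H0" "(\<xi> 1, \<one>\<^bsub>T\<^esub>) \<in> H0"
  using a_b_carrier p2 group.is_monoid[OF group_T]
  by (auto simp: H0_def \<iota>_carrier \<xi>_carrier \<xi>_even \<iota>_one intro: monoid.one_closed)

lemma agl_relations_H0:
  "agl_relations (ST\<lparr>carrier := H0\<rparr>) p r (\<iota> a, a) (\<iota> b, b) (\<xi> 1, \<one>\<^bsub>T\<^esub>)"
  by (intro group.agl_relations_subgroup[OF group_ST H0_index(1)] gens_in_H0
      agl_relations_DirProd sym_group_is_group group_T agl_relations_S agl_relations_T)

text \<open>The pairs \<open>(a, a)\<close> and \<open>(b, b)\<close>, embedded by
  \<open>\<iota>\<close> in the first coordinate, generate the graph of \<open>\<iota>\<close>.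
  Conjugating \<open>(\<xi> 1, \<one>)\<close> by it produces the alternating group in the first
  factor. Each element \<open>(s, t)\<close> of \<open>H0\<close> is then an even permutation times
  the graph element over \<open>t\<close>.\<close>

lemma generate_H0:
  "generate (ST\<lparr>carrier := H0\<rparr>) {(\<iota> a, a), (\<iota> b, b), (\<xi> 1, \<one>\<^bsub>T\<^esub>)} = carrier (ST\<lparr>carrier := H0\<rparr>)"
proof -
  interpret S: group S by (rule sym_group_is_group)
  interpret T: group T by (rule group_T)
  interpret ST: group ST by (rule group_ST)
  interpret \<iota>: group_hom T S \<iota> by (rule group_hom_\<iota>)
  let ?gens = "{(\<iota> a, a), (\<iota> b, b), (\<xi> 1, \<one>\<^bsub>T\<^esub>)}"
  let ?I = "generate ST ?gens"
  have gens: "?gens \<subseteq> H0" using gens_in_H0 by simp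
  have gens_c: "?gens \<subseteq> carrier ST" using gens subgroup.subset[OF H0_index(1)] by blast
  have I: "subgroup ?I ST" by (rule ST.generate_is_subgroup[OF gens_c])
  note Im = subgroup.m_closed[OF I] and Ii = subgroup.m_inv_closed[OF I]
  have diag: "(\<iota> t, t) \<in> ?I" if t: "t \<in> carrier T" for t
  proof -
    obtain i j :: nat where ij: "t = a [^]\<^bsub>T\<^esub> i \<otimes>\<^bsub>T\<^esub> b [^]\<^bsub>T\<^esub> j" using T_normal_form[OF t] .
    have "(\<iota> t, t) = (\<iota> a, a) [^]\<^bsub>ST\<^esub> i \<otimes>\<^bsub>ST\<^esub> (\<iota> b, b) [^]\<^bsub>ST\<^esub> j"
      using a_b_carrier by (simp add: ij nat_pow_DirProd \<iota>.hom_nat_pow)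
    also have "\<dots> \<in> ?I"
      by (intro Im ST.generate_nat_pow generate.incl) simp_all
    finally show ?thesis .
  qed
  have "subgroup {s \<in> carrier S. (s, \<one>\<^bsub>T\<^esub>) \<in> ?I} S"
  proof (rule S.subgroupI)
    show "{s \<in> carrier S. (s, \<one>\<^bsub>T\<^esub>) \<in> ?I} \<noteq> {}"
      using subgroup.one_closed[OF I] S.one_closed by auto
    fix s s' assume s: "s \<in> {s \<in> carrier S. (s, \<one>\<^bsub>T\<^esub>) \<in> ?I}"
    then have "inv\<^bsub>ST\<^esub> (s, \<one>\<^bsub>T\<^esub>) \<in> ?I" using Ii by blast
    then show "inv\<^bsub>S\<^esub> s \<in> {s \<in> carrier S. (s, \<one>\<^bsub>T\<^esub>) \<in> ?I}"
      using s inv_DirProd[OF S.is_group T.is_group, of s "\<one>\<^bsub>T\<^esub>"] by (simp del: sym_group_inv_equality)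
    assume s': "s' \<in> {s \<in> carrier S. (s, \<one>\<^bsub>T\<^esub>) \<in> ?I}"
    have "(s, \<one>\<^bsub>T\<^esub>) \<otimes>\<^bsub>ST\<^esub> (s', \<one>\<^bsub>T\<^esub>) \<in> ?I" using Im s s' by blast
    then show "s \<otimes>\<^bsub>S\<^esub> s' \<in> {s \<in> carrier S. (s, \<one>\<^bsub>T\<^esub>) \<in> ?I}" using s s' by simp
  qed auto
  then have "carrier (alt_group (p + 2)) \<subseteq> {s \<in> carrier S. (s, \<one>\<^bsub>T\<^esub>) \<in> ?I}"
  proof (rule alt_group_subset_if_three_cycles)
    fix i assume i: "i \<in> {1..p}"
    obtain k :: nat where k: "\<xi> i = \<iota> (a [^]\<^bsub>T\<^esub> k) \<circ> \<xi> 1 \<circ> inv' (\<iota> (a [^]\<^bsub>T\<^esub> k))"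
      using three_cycles_by_conjugation[OF i] .
    define t where "t = a [^]\<^bsub>T\<^esub> k"
    have t: "t \<in> carrier T" using a_b_carrier by (simp add: t_def)
    have "(\<iota> t, t) \<otimes>\<^bsub>ST\<^esub> (\<xi> 1, \<one>\<^bsub>T\<^esub>) \<otimes>\<^bsub>ST\<^esub> inv\<^bsub>ST\<^esub> (\<iota> t, t) \<in> ?I"
      by (intro Im Ii diag[OF t] generate.incl) simp
    also have "(\<iota> t, t) \<otimes>\<^bsub>ST\<^esub> (\<xi> 1, \<one>\<^bsub>T\<^esub>) \<otimes>\<^bsub>ST\<^esub> inv\<^bsub>ST\<^esub> (\<iota> t, t) = (\<xi> i, \<one>\<^bsub>T\<^esub>)"
      using t k inv_DirProd[OF S.is_group T.is_group \<iota>_carrier[OF t] t]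
      by (simp add: inv_\<iota> sym_group_mult t_def[symmetric])
    finally show "cycle_of_list [p + 2, p + 1, i] \<in> {s \<in> carrier S. (s, \<one>\<^bsub>T\<^esub>) \<in> ?I}"
      using \<xi>_carrier[OF i] unfolding \<xi>_def by blast
  qed
  then have even: "(s, \<one>\<^bsub>T\<^esub>) \<in> ?I" if "s \<in> carrier S" "evenperm s" for s
    using that by (auto simp: alt_group_carrier sym_group_carrier)
  have "H0 \<subseteq> ?I"
  proof clarify
    fix s t assume "(s, t) \<in> H0"
    then have st: "s \<in> carrier S" "t \<in> carrier T" "evenperm s \<longleftrightarrow> evenperm (\<iota> t)"
      by (auto simp: H0_def)
    define u where "u = s \<otimes>\<^bsub>S\<^esub> inv\<^bsub>S\<^esub> (\<iota> t)"
    have u: "u \<in> carrier S" unfolding u_def by (intro S.m_closed S.inv_closed st \<iota>_carrier)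
    have us: "u \<otimes>\<^bsub>S\<^esub> \<iota> t = s"
      using st \<iota>_carrier[OF st(2)] by (simp add: u_def S.m_assoc del: sym_group_inv_equality)
    then have "evenperm u"
      using st(3) evenperm_mult_S[OF u \<iota>_carrier[OF st(2)]] by auto
    then have "(u, \<one>\<^bsub>T\<^esub>) \<otimes>\<^bsub>ST\<^esub> (\<iota> t, t) \<in> ?I" using even u diag st(2) Im by blast
    then show "(s, t) \<in> ?I" using us st by simp
  qed
  moreover have "?I \<subseteq> H0" by (rule ST.generate_subgroup_incl[OF gens H0_index(1)])
  ultimately show ?thesis
    using ST.generate_consistent[OF gens H0_index(1)] by simp
qed

end

section \<open>Assembly of the presentations with their bit-lengths\<close>

lemma (in agl_sym) presentations:
  assumes "agl_exponents p r s"
  shows "has_presentation S 3 6 (68 * log 2 (real p))"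
    and "p = 3 * k + 2 \<Longrightarrow> has_presentation (ST\<lparr>carrier := H0\<rparr>) 2 3 (68 * log 2 (real p))"
    and "p = 3 * k + 2 \<Longrightarrow> has_presentation S 2 4 (68 * log 2 (real p))"
proof -
  note S = sym_group_is_group finite_S sym_group_card_carrier assms
  show "has_presentation S 3 6 (68 * log 2 (real p))"
    unfolding has_presentation_def
    using three_gens_presentation[OF S agl_relations_S sym_relation_S generate_S] bit_length_le(1)[OF assms]
    by (intro exI[of _ "{0, 1, 2}"] exI[of _ "three_gens_relators p s"])
       (simp add: three_gens_relators_def)
  show "has_presentation (ST\<lparr>carrier := H0\<rparr>) 2 3 (68 * log 2 (real p))" if p: "p = 3 * k + 2"
  proof -
    have "group (ST\<lparr>carrier := H0\<rparr>)"
      by (rule subgroup.subgroup_is_group[OF H0_index(1) group_ST])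
    then have "is_presentation (ST\<lparr>carrier := H0\<rparr>) {0, 1} (two_gens_relators p s)"
      using card_H0 two_gens_presentation[OF _ _ _ assms p agl_relations_H0 generate_H0] by simp
    then show ?thesis
      unfolding has_presentation_def using bit_length_le(2)[OF assms]
      by (intro exI[of _ "{0, 1}"] exI[of _ "two_gens_relators p s"]) (simp add: two_gens_relators_def)
  qed
  show "has_presentation S 2 4 (68 * log 2 (real p))" if p: "p = 3 * k + 2"
    unfolding has_presentation_def
    using two_gens_sym_presentation[OF S p agl_relations_S sym_relation_S generate_S] bit_length_le(3)[OF assms]
    by (intro exI[of _ "{0, 1}"] exI[of _ "two_gens_sym_relators p s"])
       (simp add: two_gens_sym_relators_def two_gens_relators_def)
qed

theorem corollary3p12:
  shows
    "(\<exists>C::real. \<forall>p::nat. prime p \<longrightarrow>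
        has_presentation (sym_group (p + 2)) 3 6 (C * log 2 (real p))) \<and>
     (\<exists>C::real. \<forall>p::nat. prime p \<and> [p = 2] (mod 3) \<longrightarrow>
        (\<exists>!H. index2_subdirect (sym_group (p + 2)) (AGL1 (residue_ring (int p))) H) \<and>
        (\<forall>H. index2_subdirect (sym_group (p + 2)) (AGL1 (residue_ring (int p))) H \<longrightarrow>
           has_presentation
             ((sym_group (p + 2) \<times>\<times> AGL1 (residue_ring (int p)))\<lparr>carrier := H\<rparr>)
             2 3 (C * log 2 (real p)))) \<and>
     (\<exists>C::real. \<forall>p::nat. prime p \<and> [p = 2] (mod 3) \<longrightarrow>
        has_presentation (sym_group (p + 2)) 2 4 (C * log 2 (real p)))"
proof -
  have mod3: "p = 3 * (p div 3) + 2" if "[p = 2] (mod 3)" for p :: nat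
    using that div_mult_mod_eq[of p 3] by (simp add: cong_def)
  have main: "\<exists>r s. agl_sym p r \<and> agl_exponents p r s" if p: "prime p" for p :: nat
  proof -
    obtain r s where rs: "agl_exponents p r s" using agl_exponents_exist[OF p] .
    then have "agl_sym p r"
      by (simp add: agl_exponents_def agl_sym_def prime_modulus_def agl_sym_axioms_def)
    then show ?thesis using rs by blast
  qed
  show ?thesis
  proof (intro conjI exI[of _ "68 :: real"] allI impI)
    fix p :: nat assume "prime p"
    then show "has_presentation (sym_group (p + 2)) 3 6 (68 * log 2 (real p))"
      using main agl_sym.presentations(1) by blast
  next
    fix p :: nat assume p: "prime p \<and> [p = 2] (mod 3)"
    then obtain r s where rs: "agl_sym p r" "agl_exponents p r s" using main by blast
    show "\<exists>!H. index2_subdirect (sym_group (p + 2)) (AGL1 (residue_ring (int p))) H"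
      using agl_sym.H0_subdirect[OF rs(1)] agl_sym.subdirect_unique[OF rs(1)] by blast
    \<comment> \<open>Uniqueness reduces an arbitrary subdirect product of index two to
      \<open>H0\<close>.\<close>
    fix H assume "index2_subdirect (sym_group (p + 2)) (AGL1 (residue_ring (int p))) H"
    then have "H = agl_sym.H0 p" by (rule agl_sym.subdirect_unique[OF rs(1)])
    then show "has_presentation
        ((sym_group (p + 2) \<times>\<times> AGL1 (residue_ring (int p)))\<lparr>carrier := H\<rparr>) 2 3 (68 * log 2 (real p))"
      using agl_sym.presentations(2)[OF rs mod3] p by blast
  next
    fix p :: nat assume p: "prime p \<and> [p = 2] (mod 3)"
    then obtain r s where "agl_sym p r" "agl_exponents p r s" using main by blast
    then show "has_presentation (sym_group (p + 2)) 2 4 (68 * log 2 (real p))"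
      using agl_sym.presentations(3) mod3 p by blast
  qed
qed

end
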